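(* Let $r:E\to\mathbb R$ be continuous, bounded and non-negative, $\alpha_t=\int_0^t r(X_u)du$, and $$w(x)=\sup_{\tau}\limsup_{T\to\infty}\mathbb E^x\Big\{\int_0^{\tau\wedge T}e^{-\alpha_s}f(X_s)\,ds+e^{-\alpha_{\tau\wedge T}}g(X_{\tau\wedge T})\Big\}.$$ Assume (E1): for every $x$ there is $d(x)<0$ with $\sup_\tau\limsup_{T\to\infty}\mathbb E^x\{\int_0^{\tau\wedge T}e^{-\alpha_s}(f(X_s)-d(x))ds\}<\infty$; (D3'): there is $\delta>0$ with $\alpha_t\le-\log\delta$ $\mathbb P^x$-a.s. for all $t\ge0$ and all $x$; and that $w$ is continuous. Then $w$ is a viscosity solution of $$\min\big(-\mathcal A w+rw-f,\;w-g\big)=0,$$ where $\mathcal A$ is the infinitesimal generator of $(X_t)$.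
   Context: $E$ is a locally compact separable metric space in which every closed ball is compact. $(X_t)$ is a right-continuous time-homogeneous (standard) Markov process on $E$ with laws $\mathbb P^x$, expectations $\mathbb E^x$, satisfying the weak Feller property $P_t\mathcal C_0\subseteq\mathcal C_0$ ($P_t\phi(x)=\mathbb E^x\phi(X_t)$, $\mathcal C_0$ continuous bounded functions vanishing at infinity) and ergodicity (a unique probability measure $\mu$ with $\|P_t(x,\cdot)-\mu\|_{TV}\to0$ for all $x$). $f,g$ are continuous and bounded. Stopping times may be infinite. The generator $\mathcal A$ has domain $D_{\mathcal A}\subset\mathcal C_0$. A continuous $u$ is a viscosity subsolution if for every $x\in E$ and $\psi\in D_{\mathcal A}$ with $\psi\ge u$ and $\psi(x)=u(x)$: $\min(-\mathcal A\psi(x)+r(x)\psi(x)-f(x),u(x)-g(x))\le0$; a viscosity supersolution if for every $x$ and $\phi\in D_{\mathcal A}$ with $\phi\le u$ and $\phi(x)=u(x)$: $\min(-\mathcal A\phi(x)+r(x)\phi(x)-f(x),u(x)-g(x))\ge0$; a viscosity solution if both. *)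

theory Defs
  imports "HOL-Probability.Probability"
begin

text \<open>Continuous functions vanishing at infinity (they are automatically bounded;
  boundedness is stated explicitly as in the paper).\<close>
definition C0 :: "('e::metric_space \<Rightarrow> real) set" where
  "C0 = {\<phi>. continuous_on UNIV \<phi> \<and> bounded (range \<phi>) \<and>
              (\<forall>\<epsilon>>0. \<exists>K. compact K \<and> (\<forall>x. x \<notin> K \<longrightarrow> \<bar>\<phi> x\<bar> < \<epsilon>))}"

definition semigrp :: "('e \<Rightarrow> 'w measure) \<Rightarrow> (real \<Rightarrow> 'w \<Rightarrow> 'e) \<Rightarrow> real \<Rightarrow> ('e \<Rightarrow> real) \<Rightarrow> 'e \<Rightarrow> real" where
  "semigrp P X t \<phi> x = (\<integral>\<omega>. \<phi> (X t \<omega>) \<partial>(P x))"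

definition stopping_timeF :: "'w measure \<Rightarrow> (real \<Rightarrow> 'w set set) \<Rightarrow> ('w \<Rightarrow> ennreal) \<Rightarrow> bool" where
  "stopping_timeF M F \<tau> \<longleftrightarrow> (\<forall>t\<ge>0. {\<omega>\<in>space M. \<tau> \<omega> \<le> ennreal t} \<in> F t)"

definition prior_events :: "'w measure \<Rightarrow> (real \<Rightarrow> 'w set set) \<Rightarrow> ('w \<Rightarrow> ennreal) \<Rightarrow> 'w set set" where
  "prior_events M F \<tau> = {A \<in> sets M. \<forall>t\<ge>0. A \<inter> {\<omega>\<in>space M. \<tau> \<omega> \<le> ennreal t} \<in> F t}"

definition standard_markov ::
  "'w measure \<Rightarrow> (real \<Rightarrow> 'w set set) \<Rightarrow> ('e::metric_space \<Rightarrow> 'w measure) \<Rightarrow> (real \<Rightarrow> 'w \<Rightarrow> 'e) \<Rightarrow> bool" where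
  "standard_markov M F P X \<longleftrightarrow>
     \<comment> \<open>laws\<close>
     (\<forall>x. prob_space (P x) \<and> space (P x) = space M \<and> sets (P x) = sets M) \<and>
     \<comment> \<open>filtration: sub-sigma-algebras, increasing, right-continuous\<close>
     (\<forall>t\<ge>0. sigma_algebra (space M) (F t) \<and> F t \<subseteq> sets M) \<and>
     (\<forall>s t. 0 \<le> s \<and> s \<le> t \<longrightarrow> F s \<subseteq> F t) \<and>
     (\<forall>t\<ge>0. F t = (\<Inter>s\<in>{t<..}. F s)) \<and>
     \<comment> \<open>adaptedness\<close>
     (\<forall>t\<ge>0. \<forall>A\<in>sets borel. {\<omega>\<in>space M. X t \<omega> \<in> A} \<in> F t) \<and>
     \<comment> \<open>start in x\<close>
     (\<forall>x. AE \<omega> in P x. X 0 \<omega> = x) \<and>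
     \<comment> \<open>measurability of the transition kernel\<close>
     (\<forall>t\<ge>0. \<forall>A\<in>sets borel. (\<lambda>x. measure (P x) {\<omega>\<in>space M. X t \<omega> \<in> A}) \<in> borel_measurable borel) \<and>
     \<comment> \<open>right-continuous paths with left limits\<close>
     (\<forall>\<omega>\<in>space M. \<forall>t\<ge>0. ((\<lambda>s. X s \<omega>) \<longlongrightarrow> X t \<omega>) (at_right t)) \<and>
     (\<forall>\<omega>\<in>space M. \<forall>t>0. \<exists>l. ((\<lambda>s. X s \<omega>) \<longlongrightarrow> l) (at_left t)) \<and>
     \<comment> \<open>strong Markov property (time-homogeneous)\<close>
     (\<forall>x \<tau> A t \<phi>. stopping_timeF M F \<tau> \<and> A \<in> prior_events M F \<tau> \<and> t \<ge> 0 \<and>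
        \<phi> \<in> borel_measurable borel \<and> bounded (range \<phi>) \<longrightarrow>
        (\<integral>\<omega>. indicator (A \<inter> {\<omega>. \<tau> \<omega> < \<infinity>}) \<omega> * \<phi> (X (enn2real (\<tau> \<omega>) + t) \<omega>) \<partial>(P x)) =
        (\<integral>\<omega>. indicator (A \<inter> {\<omega>. \<tau> \<omega> < \<infinity>}) \<omega> * semigrp P X t \<phi> (X (enn2real (\<tau> \<omega>)) \<omega>) \<partial>(P x))) \<and>
     \<comment> \<open>quasi-left-continuity\<close>
     (\<forall>x \<sigma> \<tau>. (\<forall>n. stopping_timeF M F (\<sigma> n)) \<and> stopping_timeF M F \<tau> \<and>
        (\<forall>\<omega>\<in>space M. incseq (\<lambda>n. \<sigma> n \<omega>) \<and> (\<lambda>n. \<sigma> n \<omega>) \<longlonglongrightarrow> \<tau> \<omega>) \<longrightarrow>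
        (AE \<omega> in P x. \<tau> \<omega> < \<infinity> \<longrightarrow>
            (\<lambda>n. X (enn2real (\<sigma> n \<omega>)) \<omega>) \<longlonglongrightarrow> X (enn2real (\<tau> \<omega>)) \<omega>))"

definition weak_feller :: "('e::metric_space \<Rightarrow> 'w measure) \<Rightarrow> (real \<Rightarrow> 'w \<Rightarrow> 'e) \<Rightarrow> bool" where
  "weak_feller P X \<longleftrightarrow> (\<forall>t\<ge>0. \<forall>\<phi>\<in>C0. semigrp P X t \<phi> \<in> C0)"

definition ergodic :: "'w measure \<Rightarrow> ('e::metric_space \<Rightarrow> 'w measure) \<Rightarrow> (real \<Rightarrow> 'w \<Rightarrow> 'e) \<Rightarrow> bool" where
  "ergodic M P X \<longleftrightarrow> (\<exists>!\<mu>. prob_space \<mu> \<and> sets \<mu> = sets borel \<and> space \<mu> = UNIV \<and>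
      (\<forall>x. ((\<lambda>t. SUP A\<in>sets borel. \<bar>measure (P x) {\<omega>\<in>space M. X t \<omega> \<in> A} - measure \<mu> A\<bar>)
              \<longlongrightarrow> 0) at_top))"

definition gen_dom :: "('e::metric_space \<Rightarrow> 'w measure) \<Rightarrow> (real \<Rightarrow> 'w \<Rightarrow> 'e) \<Rightarrow> ('e \<Rightarrow> real) set" where
  "gen_dom P X = {\<psi>\<in>C0. \<exists>h\<in>C0.
      (\<exists>C. \<forall>t\<in>{0<..1}. \<forall>x. \<bar>(semigrp P X t \<psi> x - \<psi> x) / t\<bar> \<le> C) \<and>
      (\<forall>x. ((\<lambda>t. (semigrp P X t \<psi> x - \<psi> x) / t) \<longlongrightarrow> h x) (at_right 0))}"

definition gen :: "('e::metric_space \<Rightarrow> 'w measure) \<Rightarrow> (real \<Rightarrow> 'w \<Rightarrow> 'e) \<Rightarrow> ('e \<Rightarrow> real) \<Rightarrow> 'e \<Rightarrow> real" where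
  "gen P X \<psi> x = Lim (at_right 0) (\<lambda>t. (semigrp P X t \<psi> x - \<psi> x) / t)"

definition alpha :: "('e \<Rightarrow> real) \<Rightarrow> (real \<Rightarrow> 'w \<Rightarrow> 'e) \<Rightarrow> real \<Rightarrow> 'w \<Rightarrow> real" where
  "alpha r X t \<omega> = set_lebesgue_integral lborel {0..t} (\<lambda>u. r (X u \<omega>))"

definition stopT :: "('w \<Rightarrow> ennreal) \<Rightarrow> real \<Rightarrow> 'w \<Rightarrow> real" where
  "stopT \<tau> T \<omega> = enn2real (min (\<tau> \<omega>) (ennreal T))"

definition payoff :: "('e \<Rightarrow> real) \<Rightarrow> ('e \<Rightarrow> real) \<Rightarrow> ('e \<Rightarrow> real) \<Rightarrow> (real \<Rightarrow> 'w \<Rightarrow> 'e)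
    \<Rightarrow> ('w \<Rightarrow> ennreal) \<Rightarrow> real \<Rightarrow> 'w \<Rightarrow> real" where
  "payoff r f g X \<tau> T \<omega> =
     set_lebesgue_integral lborel {0..stopT \<tau> T \<omega>} (\<lambda>s. exp (- alpha r X s \<omega>) * f (X s \<omega>))
     + exp (- alpha r X (stopT \<tau> T \<omega>) \<omega>) * g (X (stopT \<tau> T \<omega>) \<omega>)"

definition value_fn :: "'w measure \<Rightarrow> (real \<Rightarrow> 'w set set) \<Rightarrow> ('e \<Rightarrow> 'w measure) \<Rightarrow> (real \<Rightarrow> 'w \<Rightarrow> 'e)
    \<Rightarrow> ('e \<Rightarrow> real) \<Rightarrow> ('e \<Rightarrow> real) \<Rightarrow> ('e \<Rightarrow> real) \<Rightarrow> 'e \<Rightarrow> ereal" where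
  "value_fn M F P X r f g x =
     (SUP \<tau>\<in>{\<tau>. stopping_timeF M F \<tau>}.
        Limsup at_top (\<lambda>T::real. ereal (\<integral>\<omega>. payoff r f g X \<tau> T \<omega> \<partial>(P x))))"

definition visc_sub :: "('e::topological_space \<Rightarrow> real) set \<Rightarrow> (('e \<Rightarrow> real) \<Rightarrow> 'e \<Rightarrow> real)
    \<Rightarrow> ('e \<Rightarrow> real) \<Rightarrow> ('e \<Rightarrow> real) \<Rightarrow> ('e \<Rightarrow> real) \<Rightarrow> ('e \<Rightarrow> real) \<Rightarrow> bool" where
  "visc_sub D A r f g u \<longleftrightarrow> continuous_on UNIV u \<and>
     (\<forall>x. \<forall>\<psi>\<in>D. (\<forall>y. \<psi> y \<ge> u y) \<and> \<psi> x = u x \<longrightarrow>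
        min (- A \<psi> x + r x * \<psi> x - f x) (u x - g x) \<le> 0)"

definition visc_super :: "('e::topological_space \<Rightarrow> real) set \<Rightarrow> (('e \<Rightarrow> real) \<Rightarrow> 'e \<Rightarrow> real)
    \<Rightarrow> ('e \<Rightarrow> real) \<Rightarrow> ('e \<Rightarrow> real) \<Rightarrow> ('e \<Rightarrow> real) \<Rightarrow> ('e \<Rightarrow> real) \<Rightarrow> bool" where
  "visc_super D A r f g u \<longleftrightarrow> continuous_on UNIV u \<and>
     (\<forall>x. \<forall>\<phi>\<in>D. (\<forall>y. \<phi> y \<le> u y) \<and> \<phi> x = u x \<longrightarrow>
        min (- A \<phi> x + r x * \<phi> x - f x) (u x - g x) \<ge> 0)"

definition visc_solution where
  "visc_solution D A r f g u \<longleftrightarrow> visc_sub D A r f g u \<and> visc_super D A r f g u"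

end

theory Submission
  imports Defs
begin

text \<open>
  The payoff of a possibly infinite stopping time is the upper limit of payoffs of bounded ones, so
  \<open>w\<close> is a supremum over bounded stopping times. Discretising time gives Bellman iterates which
  are computed from the Feynman--Kac semigroup alone; each of them is realised by one stopping time
  that works for all initial laws at once, and along refining grids they converge pointwise to
  \<open>w\<close>. Hence \<open>w\<close> dominates its own discounted one-step operator at all times, which gives the
  supersolution property, and the discounted value process is a supermartingale. For the
  subsolution property, if the inequality failed at \<open>x\<close>, then up to a short deterministic time
  both stopping (because \<open>g < \<psi>\<close> near \<open>x\<close>) and continuing (by Dynkin's formula) would lose a
  fixed amount against \<open>\<psi> x = w x\<close>, uniformly over all stopping times.
\<close>

section \<open>Integrals of right-continuous functions\<close>

text \<open>The Markov property is given for functions of the state at one later time, while payoffs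
  depend on the whole path through \<open>alpha\<close> and the running reward. Such functionals are
  therefore written as limits of right-endpoint Riemann sums, for which right continuity of paths
  suffices. Iterating the Markov property along the grid and passing to the limit yields both the
  Markov property of path functionals and the measurability of their expectations in the initial
  state. Boundedness of \<open>w\<close> is not known beforehand, so dynamic programming is proved
  for bounded measurable functions below \<open>w\<close>; in the subsolution part \<open>w\<close>
  is bounded because it lies between \<open>g\<close> and the test function. The generator is a
  bounded pointwise limit, not a uniform one, so Dynkin's inequality rests on right derivatives and
  bounded convergence alone. The subsolution argument compares \<open>f\<close> with the reward
  \<open>k = r \<psi> - A \<psi>\<close>, for which the test function \<open>\<psi>\<close> is
  exactly balanced to first order.\<close>

lemma emeasure_Ico_finite: "emeasure lborel {a..<b::real} < \<top>"
  by (cases "a \<le> b") auto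

lemma integrable_indicator_Icc_mult: "integrable lborel (\<lambda>u. indicator {a..b::real} u * (c::real))"
  by (intro integrable_mult_left integrable_real_indicator) (auto simp: emeasure_lborel_Icc_eq)

definition right_cont :: "(real \<Rightarrow> 'a::topological_space) \<Rightarrow> bool" where
  "right_cont q \<longleftrightarrow> (\<forall>t\<ge>0. (q \<longlongrightarrow> q t) (at_right t))"

lemma right_cont_LIMSEQ:
  assumes q: "right_cont q" and t: "0 \<le> t" and s: "s \<longlonglongrightarrow> t" "\<And>n. t \<le> s n"
  shows "(\<lambda>n. q (s n)) \<longlonglongrightarrow> q t"
proof (rule topological_tendstoI)
  fix S assume S: "open S" "q t \<in> S"
  have "(q \<longlongrightarrow> q t) (at_right t)"
    using q t by (simp add: right_cont_def)
  then have "eventually (\<lambda>x. q x \<in> S) (at_right t)"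
    using S by (rule topological_tendstoD)
  then obtain b where b: "t < b" "\<And>y. t < y \<Longrightarrow> y < b \<Longrightarrow> q y \<in> S"
    by (auto simp: eventually_at_right_field)
  have "eventually (\<lambda>n. s n < b) sequentially"
    using s(1) b(1) by (rule order_tendstoD)
  then show "eventually (\<lambda>n. q (s n) \<in> S) sequentially"
  proof eventually_elim
    case (elim n)
    then show ?case
      using b(2)[of "s n"] s(2)[of n] S(2) by (cases "s n = t") auto
  qed
qed

lemma right_cont_compose:
  assumes "right_cont q" "continuous_on UNIV f"
  shows "right_cont (\<lambda>t. f (q t))"
  unfolding right_cont_def
proof (intro allI impI)
  fix t :: real assume "0 \<le> t"
  then have "(q \<longlongrightarrow> q t) (at_right t)"
    using assms(1) by (simp add: right_cont_def)
  then show "((\<lambda>t. f (q t)) \<longlongrightarrow> f (q t)) (at_right t)"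
    by (rule continuous_on_tendsto_compose[OF assms(2)]) auto
qed

lemma right_cont_shift:
  assumes "right_cont q" "0 \<le> s"
  shows "right_cont (\<lambda>t. q (s + t))"
  unfolding right_cont_def
proof (intro allI impI)
  fix t :: real assume t: "0 \<le> t"
  have "(q \<longlongrightarrow> q (s + t)) (at_right (s + t))"
    using assms t by (simp add: right_cont_def)
  then show "((\<lambda>u. q (s + u)) \<longlongrightarrow> q (s + t)) (at_right t)"
    by (subst (asm) at_right_to_0, subst at_right_to_0)
       (simp add: filterlim_filtermap add_ac)
qed

lemma right_cont_mult:
  fixes p q :: "real \<Rightarrow> real"
  assumes "right_cont p" "right_cont q"
  shows "right_cont (\<lambda>t. p t * q t)"
  using assms unfolding right_cont_def by (auto intro: tendsto_mult)

text \<open>Only the values of \<open>q\<close> on \<open>[0,\<infinity>)\<close> matter.\<close>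

locale bounded_right_cont =
  fixes q :: "real \<Rightarrow> real" and K :: real
  assumes rc: "right_cont q" and bd: "\<And>t. 0 \<le> t \<Longrightarrow> \<bar>q t\<bar> \<le> K"
begin

text \<open>Right endpoints are sampled: the node used at \<open>u\<close> then approaches
  \<open>u\<close> from above, which is the side on which \<open>q\<close> is continuous.\<close>

definition step :: "real \<Rightarrow> nat \<Rightarrow> real \<Rightarrow> real" where
  "step t n u = (\<Sum>j<Suc n. indicator {real j * t / Suc n ..< real (Suc j) * t / Suc n} u
     * q (real (Suc j) * t / Suc n))"

text \<open>The cells are disjoint and the only one that can contain \<open>u\<close> has index
  floor of \<open>u (n + 1) / t\<close>, so at most one term of the sum survives.\<close>

lemma step_eq:
  assumes t: "0 < t"
  shows "step t n u = (if 0 \<le> u \<and> u < t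
     then q (real (Suc (nat \<lfloor>u * Suc n / t\<rfloor>)) * t / Suc n) else 0)"
proof -
  have *: "(real j * t / Suc n \<le> u \<and> u < real (Suc j) * t / Suc n)
     \<longleftrightarrow> (0 \<le> u \<and> j = nat \<lfloor>u * Suc n / t\<rfloor>)" for j
  proof -
    have "(real j * t / Suc n \<le> u \<and> u < real (Suc j) * t / Suc n)
       \<longleftrightarrow> (real j \<le> u * Suc n / t \<and> u * Suc n / t < real j + 1)"
      using t by (simp add: field_simps)
    also have "\<dots> \<longleftrightarrow> \<lfloor>u * Suc n / t\<rfloor> = int j"
      by (simp add: floor_eq_iff)
    also have "\<dots> \<longleftrightarrow> (0 \<le> u \<and> j = nat \<lfloor>u * Suc n / t\<rfloor>)"
    proof -
      have "0 \<le> \<lfloor>u * Suc n / t\<rfloor> \<longleftrightarrow> 0 \<le> u"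
        using t by (simp add: zero_le_divide_iff zero_le_mult_iff)
      then show ?thesis by linarith
    qed
    finally show ?thesis .
  qed
  have "step t n u = (\<Sum>j<Suc n. if j = nat \<lfloor>u * Suc n / t\<rfloor> then
     (if 0 \<le> u then q (real (Suc j) * t / Suc n) else 0) else 0)"
    unfolding step_def by (intro sum.cong refl) (auto simp: indicator_def * simp del: of_nat_Suc)
  also have "\<dots> = (if nat \<lfloor>u * Suc n / t\<rfloor> < Suc n then
     (if 0 \<le> u then q (real (Suc (nat \<lfloor>u * Suc n / t\<rfloor>)) * t / Suc n) else 0) else 0)"
    by (subst sum.delta) auto
  also have "\<dots> = (if 0 \<le> u \<and> u < t
     then q (real (Suc (nat \<lfloor>u * Suc n / t\<rfloor>)) * t / Suc n) else 0)"
  proof (cases "0 \<le> u")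
    case True
    have "nat \<lfloor>u * Suc n / t\<rfloor> < Suc n \<longleftrightarrow> \<lfloor>u * Suc n / t\<rfloor> < int (Suc n)"
      by (auto simp: nat_less_iff)
    also have "\<dots> \<longleftrightarrow> u * Suc n / t < Suc n"
      by (simp add: floor_less_iff)
    also have "\<dots> \<longleftrightarrow> u < t"
    proof -
      have "u * Suc n / t < Suc n \<longleftrightarrow> u * Suc n < t * Suc n"
        using t by (simp add: divide_less_eq mult.commute del: of_nat_Suc)
      then show ?thesis by (simp del: of_nat_Suc)
    qed
    finally show ?thesis using True by simp
  qed simp
  finally show ?thesis .
qed

lemma step_LIMSEQ:
  assumes t: "0 < t"
  shows "(\<lambda>n. step t n u) \<longlonglongrightarrow> indicator {0..<t} u * q u"
proof (cases "0 \<le> u \<and> u < t")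
  case True
  let ?s = "\<lambda>n. real (Suc (nat \<lfloor>u * Suc n / t\<rfloor>)) * t / Suc n"
  have e: "?s n = (real_of_int \<lfloor>u * Suc n / t\<rfloor> + 1) * t / Suc n" for n
    using True t by (simp add: add_ac)
  have lo: "u \<le> ?s n" for n
  proof -
    have "u * Suc n / t \<le> real_of_int \<lfloor>u * Suc n / t\<rfloor> + 1" by linarith
    then show ?thesis unfolding e using t by (simp add: field_simps)
  qed
  have hi: "?s n \<le> u + t * inverse (real (Suc n))" for n
  proof -
    have "real_of_int \<lfloor>u * Suc n / t\<rfloor> + 1 \<le> u * Suc n / t + 1" by linarith
    then have "?s n \<le> (u * Suc n / t + 1) * t / Suc n"
      unfolding e using t by (intro divide_right_mono mult_right_mono) auto
    also have "\<dots> = u + t * inverse (real (Suc n))"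
    proof -
      have "(u * real (Suc n) / t + 1) * t = u * real (Suc n) + t"
        using t by (simp add: distrib_right del: of_nat_Suc)
      then show ?thesis
        by (simp add: add_divide_distrib divide_inverse[of t "real (Suc n)"] del: of_nat_Suc)
    qed
    finally show ?thesis .
  qed
  have "?s \<longlonglongrightarrow> u"
  proof (rule tendsto_sandwich[OF _ _ tendsto_const])
    show "eventually (\<lambda>n. u \<le> ?s n) sequentially" using lo by simp
    show "eventually (\<lambda>n. ?s n \<le> u + t * inverse (real (Suc n))) sequentially" using hi by simp
    have "(\<lambda>n. u + t * inverse (real (Suc n))) \<longlonglongrightarrow> u + t * 0"
      by (intro tendsto_intros LIMSEQ_inverse_real_of_nat)
    then show "(\<lambda>n. u + t * inverse (real (Suc n))) \<longlonglongrightarrow> u" by simp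
  qed
  then have "(\<lambda>n. q (?s n)) \<longlonglongrightarrow> q u"
    using True lo by (intro right_cont_LIMSEQ[OF rc]) auto
  then show ?thesis using True t by (simp add: step_eq)
next
  case False
  then show ?thesis using t by (auto simp: step_eq)
qed

lemma step_bound: "0 < t \<Longrightarrow> \<bar>step t n u\<bar> \<le> indicator {0..<t} u * K"
  using bd[of "real (Suc (nat \<lfloor>u * Suc n / t\<rfloor>)) * t / Suc n"] by (auto simp: step_eq)

lemma step_integrable: "0 < t \<Longrightarrow> integrable lborel (step t n)"
  unfolding step_def
  by (intro Bochner_Integration.integrable_sum integrable_mult_left)
     (auto intro!: integrable_real_indicator simp: emeasure_Ico_finite)

lemma step_integral:
  assumes "0 < t"
  shows "integral\<^sup>L lborel (step t n) = (\<Sum>j<Suc n. t / Suc n * q (real (Suc j) * t / Suc n))"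
proof -
  have "integral\<^sup>L lborel (step t n) = (\<Sum>j<Suc n. integral\<^sup>L lborel
      (\<lambda>u. indicator {real j * t / Suc n ..< real (Suc j) * t / Suc n} u * q (real (Suc j) * t / Suc n)))"
    unfolding step_def
    by (intro Bochner_Integration.integral_sum integrable_mult_left)
       (auto intro!: integrable_real_indicator simp: emeasure_Ico_finite)
  also have "\<dots> = (\<Sum>j<Suc n. t / Suc n * q (real (Suc j) * t / Suc n))"
  proof (intro sum.cong refl)
    fix j
    have "real (Suc j) * t / Suc n - real j * t / Suc n = t / Suc n"
      by (simp add: diff_divide_distrib[symmetric] algebra_simps)
    moreover have "real j * t / Suc n \<le> real (Suc j) * t / Suc n"
      using assms by (intro divide_right_mono mult_right_mono) auto
    ultimately show "(\<integral>u. indicator {real j * t / Suc n ..< real (Suc j) * t / Suc n} u * q (real (Suc j) * t / Suc n) \<partial>lborel)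
      = t / Suc n * q (real (Suc j) * t / Suc n)"
      by simp
  qed
  finally show ?thesis .
qed

lemma half_open_integrable:
  assumes t: "0 < t"
  shows "integrable lborel (\<lambda>u. indicator {0..<t} u * q u)"
    and "(\<lambda>n. integral\<^sup>L lborel (step t n)) \<longlonglongrightarrow> (\<integral>u. indicator {0..<t} u * q u \<partial>lborel)"
proof -
  \<comment> \<open>Measurability of \<open>q\<close> on the interval is inherited from the step
    functions that converge to it.\<close>
  have m: "(\<lambda>u. indicator {0..<t} u * q u) \<in> borel_measurable lborel"
    using step_integrable[OF t] by (intro borel_measurable_LIMSEQ_real[OF step_LIMSEQ[OF t]]) auto
  have ib: "integrable lborel (\<lambda>u. indicator {0..<t} u * K)"
    by (intro integrable_mult_left) (use t in \<open>auto intro!: integrable_real_indicator simp: emeasure_lborel_Ico\<close>)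
  have sm: "step t n \<in> borel_measurable lborel" for n
    using step_integrable[OF t] by auto
  have lim: "AE u in lborel. (\<lambda>n. step t n u) \<longlonglongrightarrow> indicator {0..<t} u * q u"
    using step_LIMSEQ[OF t] by (rule AE_I2)
  have sb: "AE u in lborel. norm (step t n u) \<le> indicator {0..<t} u * K" for n
    unfolding real_norm_def using step_bound[OF t] by (rule AE_I2)
  show "integrable lborel (\<lambda>u. indicator {0..<t} u * q u)"
    by (rule integrable_dominated_convergence[OF m sm ib lim sb])
  show "(\<lambda>n. integral\<^sup>L lborel (step t n)) \<longlonglongrightarrow> (\<integral>u. indicator {0..<t} u * q u \<partial>lborel)"
    by (rule integral_dominated_convergence[OF m sm ib lim sb])
qed


lemma set_integrable_Icc: "set_integrable lborel {0..t} q"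
proof (cases "0 < t")
  case True
  have "integrable lborel (\<lambda>u. indicator {0..<t} u * q u + indicator {t} u * q t)"
    using half_open_integrable(1)[OF True]
    by (intro Bochner_Integration.integrable_add integrable_mult_left)
       (auto intro!: integrable_real_indicator)
  moreover have "(\<lambda>u. indicator {0..<t} u * q u + indicator {t} u * q t)
      = (\<lambda>u. indicator {0..t} u *\<^sub>R q u)"
    using True by (auto simp: indicator_def fun_eq_iff)
  ultimately show ?thesis by (simp add: set_integrable_def)
next
  \<comment> \<open>The interval is empty or the single point 0, where \<open>q\<close> agrees with
    the constant \<open>q 0\<close>.\<close>
  case False
  have "integrable lborel (\<lambda>u. indicator {0..t} u * q 0)"
    by (rule integrable_indicator_Icc_mult)
  moreover have "indicator {0..t} u * q 0 = indicator {0..t} u *\<^sub>R q u" for u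
    using False by (cases "u = 0") (auto simp: indicator_def)
  ultimately show ?thesis by (simp add: set_integrable_def)
qed

lemma set_integral_half_open:
  "set_lebesgue_integral lborel {0..t} q = (\<integral>u. indicator {0..<t} u * q u \<partial>lborel)"
proof -
  have ae: "AE u in lborel. indicator {0..t} u *\<^sub>R q u = indicator {0..<t} u * q u"
    using AE_lborel_singleton[of t] by eventually_elim (auto simp: indicator_def)
  show ?thesis
  proof (cases "0 < t")
    case True
    then show ?thesis
      unfolding set_lebesgue_integral_def
      by (intro integral_cong_AE ae)
        (use set_integrable_Icc[of t] half_open_integrable(1)[OF True] in \<open>auto simp: set_integrable_def\<close>)
  next
    case False
    then have e: "(\<lambda>u. indicator {0..<t} u * q u) = (\<lambda>u. 0)"
      by (auto simp: indicator_def fun_eq_iff)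
    show ?thesis
      unfolding set_lebesgue_integral_def
      by (intro integral_cong_AE ae)
        (use set_integrable_Icc[of t] in \<open>auto simp: set_integrable_def e\<close>)
  qed
qed

lemma riemann_sum_LIMSEQ:
  assumes "0 \<le> t"
  shows "(\<lambda>n. \<Sum>j<Suc n. t / Suc n * q (real (Suc j) * t / Suc n))
    \<longlonglongrightarrow> set_lebesgue_integral lborel {0..t} q"
proof (cases "t = 0")
  case False
  then have "0 < t" using assms by simp
  from half_open_integrable(2)[OF this] show ?thesis
    by (simp only: step_integral[OF \<open>0 < t\<close>] set_integral_half_open)
qed (use set_integral_half_open[of 0] in simp)

lemma set_integral_bound:
  assumes "0 \<le> t"
  shows "\<bar>set_lebesgue_integral lborel {0..t} q\<bar> \<le> K * t"
proof -
  have "norm (set_lebesgue_integral lborel {0..t} q) \<le> (\<integral>u. indicator {0..t} u * K \<partial>lborel)"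
    unfolding set_lebesgue_integral_def
    by (rule Bochner_Integration.integral_norm_bound_integral[OF _ integrable_indicator_Icc_mult])
       (use set_integrable_Icc[of t] bd in \<open>auto simp: set_integrable_def indicator_def\<close>)
  then show ?thesis using assms by (simp add: mult.commute)
qed

lemma shift: "0 \<le> s \<Longrightarrow> bounded_right_cont (\<lambda>u. q (s + u)) K"
  by unfold_locales (auto intro: right_cont_shift rc bd)

text \<open>Half-open intervals make the two pieces disjoint; the second is then translated by
  \<open>s\<close>.\<close>

lemma set_integral_split:
  assumes "0 \<le> s" "0 \<le> t"
  shows "set_lebesgue_integral lborel {0..s + t} q
    = set_lebesgue_integral lborel {0..s} q + set_lebesgue_integral lborel {0..t} (\<lambda>u. q (s + u))"
proof -
  interpret sh: bounded_right_cont "\<lambda>u. q (s + u)" K by (rule shift) fact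
  have "(\<integral>u. indicator {s..<s + t} u * q u \<partial>lborel)
      = (\<integral>u. indicator {s..<s + t} (s + 1 * u) * q (s + 1 * u) \<partial>lborel)"
    using lborel_integral_real_affine[of 1 "\<lambda>u. indicator {s..<s + t} u * q u" s] by simp
  also have "\<dots> = (\<integral>u. indicator {0..<t} u * q (s + u) \<partial>lborel)"
    by (intro Bochner_Integration.integral_cong) (auto simp: indicator_def)
  finally have 1: "(\<integral>u. indicator {s..<s + t} u * q u \<partial>lborel)
      = set_lebesgue_integral lborel {0..t} (\<lambda>u. q (s + u))"
    by (simp add: sh.set_integral_half_open)
  have i: "integrable lborel (\<lambda>u. indicator {0..<t} u * q u)" for t
  proof (cases "0 < t")
    case False
    then have "(\<lambda>u. indicator {0..<t} u * q u) = (\<lambda>u. 0)"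
      by (auto simp: indicator_def fun_eq_iff)
    then show ?thesis by simp
  qed (rule half_open_integrable)
  have e: "(\<lambda>u. indicator {s..<s + t} u * q u)
      = (\<lambda>u. indicator {0..<s + t} u * q u - indicator {0..<s} u * q u)"
    using assms by (auto simp: indicator_def fun_eq_iff)
  have "(\<integral>u. indicator {s..<s + t} u * q u \<partial>lborel)
     = (\<integral>u. indicator {0..<s + t} u * q u \<partial>lborel) - (\<integral>u. indicator {0..<s} u * q u \<partial>lborel)"
    unfolding e by (rule Bochner_Integration.integral_diff[OF i i])
  then show ?thesis
    unfolding set_integral_half_open[of "s + t"] set_integral_half_open[of s] 1[symmetric] by linarith
qed

lemma set_integral_Lipschitz:
  assumes "0 \<le> s" "s \<le> t"
  shows "\<bar>set_lebesgue_integral lborel {0..t} q - set_lebesgue_integral lborel {0..s} q\<bar> \<le> K * (t - s)"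
proof -
  interpret sh: bounded_right_cont "\<lambda>u. q (s + u)" K by (rule shift) fact
  show ?thesis
    using set_integral_split[of s "t - s"] sh.set_integral_bound[of "t - s"] assms by simp
qed

lemma set_integral_right_cont: "right_cont (\<lambda>t. set_lebesgue_integral lborel {0..t} q)"
  unfolding right_cont_def
proof (intro allI impI)
  fix t :: real assume t: "0 \<le> t"
  have "((\<lambda>s. K * (s - t)) \<longlongrightarrow> K * (t - t)) (at_right t)"
    by (intro tendsto_intros)
  then have 1: "((\<lambda>s. K * (s - t)) \<longlongrightarrow> 0) (at_right t)"
    by simp
  have 2: "eventually (\<lambda>s. norm (set_lebesgue_integral lborel {0..s} q - set_lebesgue_integral lborel {0..t} q)
      \<le> K * (s - t)) (at_right t)"
    unfolding eventually_at_filter real_norm_def using set_integral_Lipschitz[OF t]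
    by (intro always_eventually allI impI) simp
  have "((\<lambda>s. set_lebesgue_integral lborel {0..s} q - set_lebesgue_integral lborel {0..t} q)
      \<longlongrightarrow> 0) (at_right t)"
    by (rule Lim_null_comparison[OF 2 1])
  then show "((\<lambda>s. set_lebesgue_integral lborel {0..s} q) \<longlongrightarrow> set_lebesgue_integral lborel {0..t} q) (at_right t)"
    by (rule LIM_zero_cancel)
qed

lemma set_integral_average_bound:
  assumes "0 < a" "\<And>u. 0 \<le> u \<Longrightarrow> u \<le> a \<Longrightarrow> \<bar>q u - c\<bar> \<le> \<epsilon>"
  shows "\<bar>set_lebesgue_integral lborel {0..a} q / a - c\<bar> \<le> \<epsilon>"
proof -
  have ic: "set_integrable lborel {0..a} (\<lambda>u. c)"
    using integrable_indicator_Icc_mult[of 0 a c] by (simp add: set_integrable_def del: integrable_mult_left_iff)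
  have "set_lebesgue_integral lborel {0..a} q - c * a = set_lebesgue_integral lborel {0..a} (\<lambda>u. q u - c)"
    using assms(1) set_integrable_Icc[of a] ic
    by (simp add: set_integral_diff(2)) (simp add: set_lebesgue_integral_def)
  also have "norm \<dots> \<le> (\<integral>u. indicator {0..a} u * \<epsilon> \<partial>lborel)"
    unfolding set_lebesgue_integral_def
    by (rule Bochner_Integration.integral_norm_bound_integral[OF _ integrable_indicator_Icc_mult])
       (use set_integral_diff(1)[OF set_integrable_Icc[of a] ic] assms in
         \<open>auto simp: set_integrable_def indicator_def\<close>)
  finally have "\<bar>set_lebesgue_integral lborel {0..a} q - c * a\<bar> \<le> \<epsilon> * a"
    using assms(1) by (simp add: mult.commute)
  moreover have "set_lebesgue_integral lborel {0..a} q / a - c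
      = (set_lebesgue_integral lborel {0..a} q - c * a) / a"
    using assms(1) by (simp add: diff_divide_distrib)
  ultimately show ?thesis
    using assms(1) by (simp add: abs_divide pos_divide_le_eq)
qed

lemma set_integral_average:
  "((\<lambda>a. set_lebesgue_integral lborel {0..a} q / a) \<longlongrightarrow> q 0) (at_right 0)"
proof (rule tendstoI)
  fix e :: real assume e: "0 < e"
  have "(q \<longlongrightarrow> q 0) (at_right 0)"
    using rc by (simp add: right_cont_def)
  then have "eventually (\<lambda>u. dist (q u) (q 0) < e / 2) (at_right 0)"
    using e by (intro tendstoD) auto
  then obtain b where b: "0 < b" "\<And>u. 0 < u \<Longrightarrow> u < b \<Longrightarrow> dist (q u) (q 0) < e / 2"
    by (auto simp: eventually_at_right_field)
  have "dist (set_lebesgue_integral lborel {0..a} q / a) (q 0) < e" if a: "0 < a" "a < b" for a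
  proof -
    have "\<bar>q u - q 0\<bar> \<le> e / 2" if "0 \<le> u" "u \<le> a" for u
      using b(2)[of u] that a e by (cases "u = 0") (auto simp: dist_real_def)
    from set_integral_average_bound[OF a(1) this] show ?thesis
      using e by (simp add: dist_real_def)
  qed
  then show "eventually (\<lambda>a. dist (set_lebesgue_integral lborel {0..a} q / a) (q 0) < e) (at_right 0)"
    using b(1) by (auto simp: eventually_at_right_field)
qed

lemma set_integral_lower:
  assumes t: "0 \<le> t" and c: "\<And>u. 0 \<le> u \<Longrightarrow> u \<le> t \<Longrightarrow> c \<le> q u"
  shows "c * t \<le> set_lebesgue_integral lborel {0..t} q"
proof -
  have "(\<integral>u. indicator {0..t} u * c \<partial>lborel) \<le> set_lebesgue_integral lborel {0..t} q"
    unfolding set_lebesgue_integral_def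
    by (rule integral_mono[OF integrable_indicator_Icc_mult])
       (use set_integrable_Icc[of t] c in \<open>auto simp: set_integrable_def indicator_def\<close>)
  then show ?thesis using t by (simp add: mult.commute)
qed

end

text \<open>After tilting by \<open>\<epsilon> t\<close>, compactness provides the last time in
  \<open>[0,T]\<close> at which the tilted function is at most \<open>\<theta> 0\<close>; the local
  estimate would push this time further right unless it is \<open>T\<close>. The local information
  is one-sided, which is all that difference quotients of a semigroup provide.\<close>

lemma right_decreasing:
  fixes \<theta> :: "real \<Rightarrow> real"
  assumes T: "0 \<le> T" and cont: "continuous_on {0..T} \<theta>"
    and step: "\<And>\<epsilon> t. 0 < \<epsilon> \<Longrightarrow> 0 \<le> t \<Longrightarrow> t < T \<Longrightarrow> eventually (\<lambda>s. \<theta> s \<le> \<theta> t + \<epsilon> * (s - t)) (at_right t)"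
  shows "\<theta> T \<le> \<theta> 0"
proof (rule field_le_epsilon)
  fix e :: real assume e: "0 < e"
  \<comment> \<open>Dividing by \<open>T + 1\<close> instead of \<open>T\<close> also covers
    \<open>T = 0\<close>.\<close>
  define \<epsilon> where "\<epsilon> = e / (T + 1)"
  have \<epsilon>: "0 < \<epsilon>" "\<epsilon> * T \<le> e" using e T by (auto simp: \<epsilon>_def field_simps)
  let ?\<phi> = "\<lambda>t. \<theta> t - \<epsilon> * t"
  let ?S = "{0..T} \<inter> ?\<phi> -` {..\<theta> 0}"
  have "closed ?S"
    by (intro continuous_closed_preimage continuous_intros cont)
  moreover have "bounded ?S" by (rule bounded_subset[OF bounded_closed_interval[of 0 T]]) auto
  ultimately have "compact ?S" by (simp only: compact_eq_bounded_closed)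
  moreover have "0 \<in> ?S" using T by simp
  ultimately obtain t where t: "t \<in> ?S" and sup: "\<And>s. s \<in> ?S \<Longrightarrow> s \<le> t"
    using compact_attains_sup[of ?S] by blast
  have "t = T"
  proof (rule ccontr)
    assume "t \<noteq> T"
    then have "t < T" "0 \<le> t" using t by auto
    from step[OF \<epsilon>(1) this(2,1)] obtain b where b: "t < b" "\<And>s. t < s \<Longrightarrow> s < b \<Longrightarrow> \<theta> s \<le> \<theta> t + \<epsilon> * (s - t)"
      by (auto simp: eventually_at_right_field)
    obtain s where s: "t < s" "s < min b T" using dense[of t "min b T"] b(1) \<open>t < T\<close> by auto
    then have "\<theta> s \<le> \<theta> t + \<epsilon> * (s - t)" using b(2) by auto
    then have "s \<in> ?S" using t s by (simp add: right_diff_distrib)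
    then show False using sup[of s] s by simp
  qed
  then show "\<theta> T \<le> \<theta> 0 + e" using t \<epsilon>(2) by simp
qed

lemma filterlim_at_right_0_sequentially:
  fixes a :: "nat \<Rightarrow> real"
  assumes "\<And>n. 0 < a n" "a \<longlonglongrightarrow> 0"
  shows "filterlim a (at_right 0) sequentially"
  unfolding filterlim_at using assms by (auto intro: always_eventually simp: less_imp_neq[symmetric])

text \<open>The upper half combines \<open>exp (- A) \<le> 1 / (1 + A)\<close> with
  \<open>(1 - A + A^2) (1 + A) = 1 + A^3\<close>.\<close>

lemma exp_minus_bounds:
  fixes A :: real
  assumes "0 \<le> A"
  shows "\<bar>exp (- A) - 1 + A\<bar> \<le> A\<^sup>2"
proof -
  have "1 - A \<le> exp (- A)" using exp_ge_add_one_self[of "- A"] by simp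
  moreover have "exp (- A) \<le> 1 - A + A\<^sup>2"
  proof -
    have "exp (- A) \<le> inverse (1 + A)"
      unfolding exp_minus using assms by (intro le_imp_inverse_le exp_ge_add_one_self) auto
    also have "\<dots> \<le> 1 - A + A\<^sup>2"
    proof -
      have "1 \<le> (1 - A + A\<^sup>2) * (1 + A)" using assms by (simp add: algebra_simps power2_eq_square)
      then show ?thesis using assms by (simp add: inverse_eq_divide pos_divide_le_eq)
    qed
    finally show ?thesis .
  qed
  ultimately show ?thesis by simp
qed

text \<open>Turns the value at a variable index into a sum of fixed length whose terms are switched
  on by \<open>j < n\<close>, so that for a random index expectations can be taken term by
  term.\<close>

lemma telescope_upto:
  fixes g :: "nat \<Rightarrow> real"
  assumes "n \<le> m"
  shows "g n = g 0 + (\<Sum>j<m. if j < n then g (Suc j) - g j else 0)"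
proof -
  have "(\<Sum>j<m. if j < n then g (Suc j) - g j else 0) = (\<Sum>j<n. g (Suc j) - g j)"
    using assms by (intro sum.mono_neutral_cong_right) auto
  then show ?thesis by (simp add: sum_lessThan_telescope)
qed

section \<open>The discounted semigroup\<close>

definition bmf :: "('e::topological_space \<Rightarrow> real) \<Rightarrow> bool" where
  "bmf \<phi> \<longleftrightarrow> \<phi> \<in> borel_measurable borel \<and> bounded (range \<phi>)"

lemma bmfI: "\<phi> \<in> borel_measurable borel \<Longrightarrow> (\<And>y. \<bar>\<phi> y\<bar> \<le> K) \<Longrightarrow> bmf \<phi>"
  unfolding bmf_def by (auto intro!: boundedI[of _ K])

lemma bmf_bound:
  assumes "bmf \<phi>" obtains K where "0 < K" "\<And>y. \<bar>\<phi> y\<bar> \<le> K"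
  using assms unfolding bmf_def bounded_pos by auto

lemma bmf_continuous: "continuous_on UNIV \<phi> \<Longrightarrow> bounded (range \<phi>) \<Longrightarrow> bmf \<phi>"
  by (simp add: bmf_def borel_measurable_continuous_onI)

lemma bmf_add: "bmf p \<Longrightarrow> bmf q \<Longrightarrow> bmf (\<lambda>y. p y + q y)"
  unfolding bmf_def by (auto intro!: bounded_plus_comp)

lemma bmf_mult:
  assumes "bmf p" "bmf q"
  shows "bmf (\<lambda>y. p y * q y)"
proof -
  obtain K L where "0 < K" "\<And>y. \<bar>p y\<bar> \<le> K" "0 < L" "\<And>y. \<bar>q y\<bar> \<le> L"
    using assms by (metis bmf_bound)
  then show ?thesis
    using assms by (intro bmfI[of _ "K * L"]) (auto simp: abs_mult bmf_def less_imp_le intro!: mult_mono)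
qed

lemma bmf_max:
  assumes "bmf p" "bmf q"
  shows "bmf (\<lambda>y. max (p y) (q y))"
proof -
  obtain K L where "\<And>y. \<bar>p y\<bar> \<le> K" "\<And>y. \<bar>q y\<bar> \<le> L"
    using assms by (metis bmf_bound)
  then have "\<bar>max (p y) (q y)\<bar> \<le> max K L" for y
    by (smt (verit))
  then show ?thesis
    using assms by (intro bmfI[of _ "max K L"]) (auto simp: bmf_def)
qed

lemma bmf_min:
  assumes "bmf p" "bmf q"
  shows "bmf (\<lambda>y. min (p y) (q y))"
proof -
  obtain K L where "\<And>y. \<bar>p y\<bar> \<le> K" "\<And>y. \<bar>q y\<bar> \<le> L"
    using assms by (metis bmf_bound)
  then have "\<bar>min (p y) (q y)\<bar> \<le> max K L" for y
    by (smt (verit))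
  then show ?thesis
    using assms by (intro bmfI[of _ "max K L"]) (auto simp: bmf_def)
qed

lemma bmf_LIMSEQ:
  assumes "\<And>n. bmf (\<phi> n)" "\<And>y. (\<lambda>n. \<phi> n y) \<longlonglongrightarrow> \<psi> y" "\<And>n y. \<bar>\<phi> n y\<bar> \<le> K"
  shows "bmf \<psi>"
proof (rule bmfI)
  show "\<psi> \<in> borel_measurable borel"
    by (rule borel_measurable_LIMSEQ_real[OF assms(2)]) (use assms(1) in \<open>simp add: bmf_def\<close>)
  show "\<bar>\<psi> y\<bar> \<le> K" for y
    using LIMSEQ_le_const2[OF tendsto_rabs[OF assms(2)]] assms(3) by auto
qed

definition cbf :: "('e::topological_space \<Rightarrow> real) \<Rightarrow> bool" where
  "cbf k \<longleftrightarrow> continuous_on UNIV k \<and> bounded (range k)"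

lemma cbf_bmf: "cbf k \<Longrightarrow> bmf k"
  by (simp add: cbf_def bmf_continuous)

lemma cbf_bound:
  assumes "cbf k" obtains L where "0 < L" "\<And>y. \<bar>k y\<bar> \<le> L"
  using bmf_bound[OF cbf_bmf[OF assms]] by blast

lemma cbf_add: "cbf p \<Longrightarrow> cbf q \<Longrightarrow> cbf (\<lambda>y. p y + q y)"
  unfolding cbf_def by (auto intro!: bounded_plus_comp continuous_intros)

lemma cbf_uminus: "cbf p \<Longrightarrow> cbf (\<lambda>y. - p y)"
  unfolding cbf_def by (auto intro!: continuous_intros simp: bounded_iff)

lemma cbf_diff: "cbf p \<Longrightarrow> cbf q \<Longrightarrow> cbf (\<lambda>y. p y - q y)"
  using cbf_add[of p "\<lambda>y. - q y"] cbf_uminus[of q] by simp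

lemma cbf_mult: "cbf p \<Longrightarrow> cbf q \<Longrightarrow> cbf (\<lambda>y. p y * q y)"
  using bmf_mult[OF cbf_bmf cbf_bmf, of p q] by (auto simp: cbf_def bmf_def intro!: continuous_intros)

text \<open>Supplies boundedness of the value function, which has \<open>g\<close> below it and, in
  the subsolution argument, a test function above it.\<close>

lemma cbf_sandwich:
  assumes "cbf p" "cbf q" "continuous_on UNIV u" "\<And>y. p y \<le> u y" "\<And>y. u y \<le> q y"
  shows "cbf u"
proof -
  obtain K where K: "\<And>y. \<bar>p y\<bar> \<le> K" using assms(1) by (metis cbf_bmf bmf_bound)
  obtain L where L: "\<And>y. \<bar>q y\<bar> \<le> L" using assms(2) by (metis cbf_bmf bmf_bound)
  have "norm (u y) \<le> K + L" for y using K[of y] L[of y] assms(4,5)[of y] by (simp add: abs_le_iff)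
  then show ?thesis using assms(3) unfolding cbf_def by (auto intro!: boundedI)
qed

lemma mult_half_cancel: "(b::real) \<noteq> 0 \<Longrightarrow> 2 * (b * (q / (2 * b))) = q"
  by simp

locale discounted_markov =
  fixes M :: "'w measure" and F :: "real \<Rightarrow> 'w set set"
    and P :: "'e::{metric_space, second_countable_topology} \<Rightarrow> 'w measure"
    and X :: "real \<Rightarrow> 'w \<Rightarrow> 'e" and r :: "'e \<Rightarrow> real" and R :: real
  assumes markov: "standard_markov M F P X"
    and r_cont: "continuous_on UNIV r"
    and r_nonneg: "\<And>y. 0 \<le> r y" and r_le: "\<And>y. r y \<le> R"
begin

section \<open>The process, its filtration and bounded adapted random variables\<close>

lemma R_nonneg: "0 \<le> R"
  using r_nonneg[of undefined] r_le[of undefined] by simp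

lemmas markov_unfolded = markov[unfolded standard_markov_def]

lemma prob_space_P: "prob_space (P x)"
  and space_P [simp]: "space (P x) = space M"
  and sets_P [simp, measurable_cong]: "sets (P x) = sets M"
  using markov_unfolded[THEN conjunct1] by simp_all

lemma F_algebra: "0 \<le> t \<Longrightarrow> sigma_algebra (space M) (F t)"
  and F_sub: "0 \<le> t \<Longrightarrow> F t \<subseteq> sets M"
  using markov_unfolded[THEN conjunct2, THEN conjunct1] by simp_all

lemma F_mono: "0 \<le> s \<Longrightarrow> s \<le> t \<Longrightarrow> F s \<subseteq> F t"
  using markov_unfolded[THEN conjunct2, THEN conjunct2, THEN conjunct1] by simp

lemma start: "AE \<omega> in P x. X 0 \<omega> = x"
  and kernel: "0 \<le> t \<Longrightarrow> A \<in> sets borel \<Longrightarrow> (\<lambda>x. measure (P x) {\<omega>\<in>space M. X t \<omega> \<in> A}) \<in> borel_measurable borel"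
  and adapted: "0 \<le> t \<Longrightarrow> A \<in> sets borel \<Longrightarrow> {\<omega>\<in>space M. X t \<omega> \<in> A} \<in> F t"
  and paths: "\<omega> \<in> space M \<Longrightarrow> right_cont (\<lambda>t. X t \<omega>)"
  using markov_unfolded unfolding right_cont_def by (elim conjE; blast)+

text \<open>\<open>F t\<close> is a bare family of sets; wrapping it as a measure space makes
  \<open>measurable\<close> and \<open>real_cond_exp\<close> applicable. Only the sets of this space
  matter.\<close>

definition Nt :: "real \<Rightarrow> 'w measure" where
  "Nt t = sigma (space M) (F t)"

lemma space_Nt [simp]: "space (Nt t) = space M"
  by (simp add: Nt_def space_measure_of_conv)

lemma sets_Nt: "0 \<le> t \<Longrightarrow> sets (Nt t) = F t"
  unfolding Nt_def
  by (rule sigma_algebra.sets_measure_of_eq[OF F_algebra])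

lemma subalgebra_Nt: "0 \<le> t \<Longrightarrow> subalgebra (P x) (Nt t)"
  using F_sub by (simp add: subalgebra_def sets_Nt)

lemma Nt_mono: "0 \<le> s \<Longrightarrow> s \<le> t \<Longrightarrow> Z \<in> measurable (Nt s) N \<Longrightarrow> Z \<in> measurable (Nt t) N"
  by (rule measurable_from_subalg[where F="Nt s"]) (auto simp: subalgebra_def sets_Nt F_mono)

lemma Nt_M: "0 \<le> s \<Longrightarrow> Z \<in> measurable (Nt s) N \<Longrightarrow> Z \<in> measurable M N"
  by (rule measurable_from_subalg[where F="Nt s"]) (use F_sub in \<open>auto simp: subalgebra_def sets_Nt\<close>)

lemma X_Nt: "0 \<le> s \<Longrightarrow> s \<le> t \<Longrightarrow> X s \<in> measurable (Nt t) borel"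
proof (rule Nt_mono[where s=s])
  assume s: "0 \<le> s" "s \<le> t"
  show "X s \<in> measurable (Nt s) borel"
  proof (rule measurableI)
    fix A :: "'e set" assume "A \<in> sets borel"
    then have "{\<omega>\<in>space M. X s \<omega> \<in> A} \<in> F s"
      using s by (intro adapted)
    moreover have "X s -` A \<inter> space (Nt s) = {\<omega>\<in>space M. X s \<omega> \<in> A}" by auto
    ultimately show "X s -` A \<inter> space (Nt s) \<in> sets (Nt s)" using s by (simp add: sets_Nt)
  qed simp
qed

lemma X_M: "0 \<le> s \<Longrightarrow> X s \<in> measurable M borel"
  by (rule Nt_M[OF _ X_Nt]) auto

lemma integrable_bounded:
  fixes Z :: "'w \<Rightarrow> real"
  assumes "Z \<in> borel_measurable M" "\<And>\<omega>. \<omega> \<in> space M \<Longrightarrow> \<bar>Z \<omega>\<bar> \<le> K"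
  shows "integrable (P x) Z"
proof -
  interpret prob_space "P x" by (rule prob_space_P)
  show ?thesis
    by (rule integrable_const_bound[of _ K])
       (use assms measurable_cong_sets[OF sets_P refl] in auto)
qed

text \<open>Bounded random variables known at time \<open>t\<close>: the factors that can be pulled
  out of a conditional expectation given \<open>F t\<close>.\<close>

definition weight :: "real \<Rightarrow> ('w \<Rightarrow> real) \<Rightarrow> bool" where
  "weight t Z \<longleftrightarrow> Z \<in> borel_measurable (Nt t) \<and> (\<exists>K. \<forall>\<omega>\<in>space M. \<bar>Z \<omega>\<bar> \<le> K)"

lemma weightI: "Z \<in> borel_measurable (Nt t) \<Longrightarrow> (\<And>\<omega>. \<omega> \<in> space M \<Longrightarrow> \<bar>Z \<omega>\<bar> \<le> K) \<Longrightarrow> weight t Z"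
  unfolding weight_def by auto

lemma weight_bound:
  assumes "weight t Z" obtains K where "0 < K" "\<And>\<omega>. \<omega> \<in> space M \<Longrightarrow> \<bar>Z \<omega>\<bar> \<le> K"
proof -
  obtain K where "\<forall>\<omega>\<in>space M. \<bar>Z \<omega>\<bar> \<le> K" using assms unfolding weight_def by auto
  then show thesis by (intro that[of "max K 1"]) (auto simp: le_max_iff_disj)
qed

lemma weight_measurable: "0 \<le> t \<Longrightarrow> weight t Z \<Longrightarrow> Z \<in> borel_measurable M"
  using Nt_M by (auto simp: weight_def)

lemma weight_mono: "0 \<le> s \<Longrightarrow> s \<le> t \<Longrightarrow> weight s Z \<Longrightarrow> weight t Z"
  using Nt_mono by (auto simp: weight_def)

lemma weight_integrable:
  assumes "0 \<le> t" "weight t Z"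
  shows "integrable (P x) Z"
  using assms(2) by (rule weight_bound) (auto intro: integrable_bounded weight_measurable[OF assms])

lemma weight_mult:
  assumes "weight t Y" "weight t Z"
  shows "weight t (\<lambda>\<omega>. Y \<omega> * Z \<omega>)"
proof -
  obtain K L where "0 < K" "\<And>\<omega>. \<omega> \<in> space M \<Longrightarrow> \<bar>Y \<omega>\<bar> \<le> K"
    "0 < L" "\<And>\<omega>. \<omega> \<in> space M \<Longrightarrow> \<bar>Z \<omega>\<bar> \<le> L"
    using assms by (metis weight_bound)
  then show ?thesis
    using assms by (intro weightI[of _ _ "K * L"])
      (auto simp: abs_mult weight_def less_imp_le intro!: mult_mono)
qed

lemma weight_add:
  assumes "weight t Y" "weight t Z"
  shows "weight t (\<lambda>\<omega>. Y \<omega> + Z \<omega>)"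
proof -
  obtain K L where "\<And>\<omega>. \<omega> \<in> space M \<Longrightarrow> \<bar>Y \<omega>\<bar> \<le> K" "\<And>\<omega>. \<omega> \<in> space M \<Longrightarrow> \<bar>Z \<omega>\<bar> \<le> L"
    using assms by (metis weight_bound)
  then show ?thesis
    using assms by (intro weightI[of _ _ "K + L"])
      (auto simp: weight_def intro!: order.trans[OF abs_triangle_ineq add_mono])
qed

lemma weight_const: "weight t (\<lambda>_. c)"
  by (rule weightI) auto

lemma weight_indicator: "0 \<le> t \<Longrightarrow> A \<in> F t \<Longrightarrow> weight t (indicator A)"
  using borel_measurable_indicator[of A "Nt t"]
  by (intro weightI[of _ _ 1]) (auto simp: sets_Nt indicator_def)

lemma weight_X:
  assumes "0 \<le> s" "s \<le> t" "bmf \<phi>"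
  shows "weight t (\<lambda>\<omega>. \<phi> (X s \<omega>))"
proof -
  obtain K where "\<And>y. \<bar>\<phi> y\<bar> \<le> K" using assms(3) by (metis bmf_bound)
  then show ?thesis
    using assms by (intro weightI[of _ _ K] measurable_compose[OF X_Nt]) (auto simp: bmf_def)
qed

text \<open>The kernel is assumed measurable on sets; regarding the laws of \<open>X t\<close> as a
  map into \<open>subprob_algebra\<close> lifts this to integrals of functions.\<close>

lemma semigrp_bmf:
  assumes t: "0 \<le> t" and \<phi>: "bmf \<phi>"
  shows "bmf (semigrp P X t \<phi>)"
proof -
  obtain K where K: "\<And>y. \<bar>\<phi> y\<bar> \<le> K" using \<phi> by (metis bmf_bound)
  have X: "X t \<in> measurable (P x) borel" for x
    using X_M[OF t] by (simp cong: measurable_cong_sets)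
  have "(\<lambda>x. distr (P x) borel (X t)) \<in> measurable borel (subprob_algebra borel)"
  proof (rule measurable_subprob_algebra)
    show "subprob_space (distr (P x) borel (X t))" for x
      by (intro prob_space_imp_subprob_space prob_space.prob_space_distr[OF prob_space_P] X)
    fix A :: "'e set" assume A: "A \<in> sets borel"
    have "emeasure (distr (P x) borel (X t)) A = ennreal (measure (P x) {\<omega>\<in>space M. X t \<omega> \<in> A})" for x
    proof -
      interpret prob_space "P x" by (rule prob_space_P)
      show ?thesis
        using A X[of x] by (simp add: emeasure_distr emeasure_eq_measure Collect_conj_eq vimage_def Int_commute)
    qed
    then show "(\<lambda>x. emeasure (distr (P x) borel (X t)) A) \<in> borel_measurable borel"
      using kernel[OF t A] by simp
  qed simp
  then have "(\<lambda>x. \<integral>y. \<phi> y \<partial>distr (P x) borel (X t)) \<in> borel_measurable borel"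
    by (rule measurable_compose[OF _ integral_measurable_subprob_algebra])
       (use \<phi> in \<open>simp add: bmf_def\<close>)
  moreover have "(\<integral>y. \<phi> y \<partial>distr (P x) borel (X t)) = semigrp P X t \<phi> x" for x
    unfolding semigrp_def using X[of x] \<phi> by (intro integral_distr) (auto simp: bmf_def)
  ultimately have "semigrp P X t \<phi> \<in> borel_measurable borel" by simp
  moreover have "\<bar>semigrp P X t \<phi> x\<bar> \<le> K" for x
  proof -
    have "\<bar>\<integral>\<omega>. \<phi> (X t \<omega>) \<partial>P x\<bar> \<le> (\<integral>\<omega>. \<bar>\<phi> (X t \<omega>)\<bar> \<partial>P x)" by (rule integral_abs_bound)
    also have "\<dots> \<le> (\<integral>\<omega>. K \<partial>P x)"
      by (rule integral_mono[OF integrable_abs])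
         (auto simp: K intro!: weight_integrable[OF t weight_X] weight_integrable[OF t weight_const] t \<phi>)
    finally show ?thesis by (simp add: semigrp_def prob_space.prob_space[OF prob_space_P, of x, simplified])
  qed
  ultimately show ?thesis by (rule bmfI)
qed

text \<open>The strong Markov property at the deterministic time \<open>s\<close>, where every
  \<open>A\<close> in \<open>F s\<close> is a prior event.\<close>

lemma markov_indicator:
  assumes s: "0 \<le> s" and t: "0 \<le> t" and A: "A \<in> F s" and \<phi>: "bmf \<phi>"
  shows "(\<integral>\<omega>. indicator A \<omega> * \<phi> (X (s + t) \<omega>) \<partial>P x) = (\<integral>\<omega>. indicator A \<omega> * semigrp P X t \<phi> (X s \<omega>) \<partial>P x)"
proof -
  let ?\<tau> = "\<lambda>\<omega>::'w. ennreal s"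
  have st: "stopping_timeF M F ?\<tau>"
    unfolding stopping_timeF_def
  proof (intro allI impI)
    fix t :: real assume "0 \<le> t"
    then interpret sigma_algebra "space M" "F t" by (rule F_algebra)
    show "{\<omega> \<in> space M. ennreal s \<le> ennreal t} \<in> F t"
      by (cases "ennreal s \<le> ennreal t") auto
  qed
  have pr: "A \<in> prior_events M F ?\<tau>"
    unfolding prior_events_def
  proof (intro CollectI conjI allI impI)
    show "A \<in> sets M" using A F_sub s by auto
    fix u :: real assume u: "0 \<le> u"
    then interpret sigma_algebra "space M" "F u" by (rule F_algebra)
    \<comment> \<open>For \<open>u < s\<close> the second event is empty; otherwise it is the whole
      space and \<open>A\<close> lies in \<open>F u\<close> by monotonicity.\<close>
    show "A \<inter> {\<omega> \<in> space M. ennreal s \<le> ennreal u} \<in> F u"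
      using A F_mono[OF s, of u] u by (cases "s \<le> u") (auto simp: ennreal_le_iff)
  qed
  from markov have "(\<integral>\<omega>. indicator (A \<inter> {\<omega>. ?\<tau> \<omega> < \<infinity>}) \<omega> * \<phi> (X (enn2real (?\<tau> \<omega>) + t) \<omega>) \<partial>(P x)) =
        (\<integral>\<omega>. indicator (A \<inter> {\<omega>. ?\<tau> \<omega> < \<infinity>}) \<omega> * semigrp P X t \<phi> (X (enn2real (?\<tau> \<omega>)) \<omega>) \<partial>(P x))"
    unfolding standard_markov_def using st pr t \<phi> unfolding bmf_def by (elim conjE; blast)
  then show ?thesis using s by simp
qed

text \<open>The indicator version identifies \<open>semigrp P X t \<phi> (X s)\<close> as the
  conditional expectation of \<open>\<phi> (X (s + t))\<close> given \<open>F s\<close>; a bounded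
  factor known at time \<open>s\<close> passes through it.\<close>

lemma markov_weight:
  assumes s: "0 \<le> s" and t: "0 \<le> t" and Z: "weight s Z" and \<phi>: "bmf \<phi>"
  shows "(\<integral>\<omega>. Z \<omega> * \<phi> (X (s + t) \<omega>) \<partial>P x) = (\<integral>\<omega>. Z \<omega> * semigrp P X t \<phi> (X s \<omega>) \<partial>P x)"
proof -
  interpret prob_space "P x" by (rule prob_space_P)
  interpret sigma_finite_subalgebra "P x" "Nt s"
    by (rule finite_measure_subalgebra_is_sigma_finite[OF finite_measure_subalgebra.intro])
       (auto simp: finite_measure_subalgebra_axioms_def subalgebra_Nt s intro: finite_measure_axioms)
  let ?f = "\<lambda>\<omega>. \<phi> (X (s + t) \<omega>)" and ?g = "\<lambda>\<omega>. semigrp P X t \<phi> (X s \<omega>)"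
  have wf: "weight (s + t) ?f" using s t \<phi> by (intro weight_X) auto
  have wg: "weight s ?g" using s t \<phi> by (intro weight_X semigrp_bmf) auto
  have ae: "AE \<omega> in P x. real_cond_exp (P x) (Nt s) ?f \<omega> = ?g \<omega>"
  proof (rule real_cond_exp_charact)
    show "integrable (P x) ?f" using weight_integrable[OF _ wf] s t by simp
    show "integrable (P x) ?g" by (rule weight_integrable[OF s wg])
    show "?g \<in> borel_measurable (Nt s)" using wg by (simp add: weight_def)
    fix A assume "A \<in> sets (Nt s)"
    then show "(\<integral>\<omega>\<in>A. ?f \<omega> \<partial>P x) = (\<integral>\<omega>\<in>A. ?g \<omega> \<partial>P x)"
      using markov_indicator[OF s t _ \<phi>] s by (simp add: sets_Nt set_lebesgue_integral_def)
  qed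
  have i: "integrable (P x) (\<lambda>\<omega>. Z \<omega> * ?f \<omega>)"
    using s t by (intro weight_integrable[where t="s + t"] weight_mult weight_mono[OF _ _ Z] wf) auto
  have "(\<integral>\<omega>. Z \<omega> * ?f \<omega> \<partial>P x) = (\<integral>\<omega>. Z \<omega> * real_cond_exp (P x) (Nt s) ?f \<omega> \<partial>P x)"
    by (rule real_cond_exp_intg(2)[symmetric, OF i])
       (use Z wf weight_measurable[OF _ wf] s t in \<open>auto simp: weight_def cong: measurable_cong_sets\<close>)
  also have "\<dots> = (\<integral>\<omega>. Z \<omega> * ?g \<omega> \<partial>P x)"
    using ae weight_measurable[OF s Z] weight_measurable[OF s wg] real_cond_exp_intg(1)[OF i]
    by (intro integral_cong_AE) (auto cong: measurable_cong_sets intro!: borel_measurable_times)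
  finally show ?thesis .
qed

lemma expectation_LIMSEQ:
  fixes Y :: "nat \<Rightarrow> 'w \<Rightarrow> real"
  assumes "\<And>n. Y n \<in> borel_measurable M"
    and "\<And>\<omega>. \<omega> \<in> space M \<Longrightarrow> (\<lambda>n. Y n \<omega>) \<longlonglongrightarrow> L \<omega>"
    and "\<And>n \<omega>. \<omega> \<in> space M \<Longrightarrow> \<bar>Y n \<omega>\<bar> \<le> K"
  shows "(\<lambda>n. \<integral>\<omega>. Y n \<omega> \<partial>P x) \<longlonglongrightarrow> (\<integral>\<omega>. L \<omega> \<partial>P x)"
proof (rule integral_dominated_convergence[where w="\<lambda>_. K"])
  have "L \<in> borel_measurable M"
    by (rule borel_measurable_LIMSEQ_real[OF _ assms(1)]) (rule assms(2))
  then show "L \<in> borel_measurable (P x)" by (simp cong: measurable_cong_sets)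
  show "Y n \<in> borel_measurable (P x)" for n
    using assms(1)[of n] by (simp cong: measurable_cong_sets)
  show "integrable (P x) (\<lambda>_. K)" by (rule integrable_bounded[of _ "\<bar>K\<bar>"]) auto
qed (use assms(2,3) in \<open>auto intro!: AE_I2\<close>)

lemma expectation_bound:
  fixes Y :: "'w \<Rightarrow> real"
  assumes "\<And>\<omega>. \<omega> \<in> space M \<Longrightarrow> \<bar>Y \<omega>\<bar> \<le> K"
  shows "\<bar>\<integral>\<omega>. Y \<omega> \<partial>P x\<bar> \<le> K"
proof (cases "integrable (P x) Y")
  case True
  interpret prob_space "P x" by (rule prob_space_P)
  have "\<bar>\<integral>\<omega>. Y \<omega> \<partial>P x\<bar> \<le> (\<integral>\<omega>. \<bar>Y \<omega>\<bar> \<partial>P x)"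
    using integral_norm_bound[of "P x" Y] by simp
  also have "\<dots> \<le> (\<integral>\<omega>. K \<partial>P x)"
    using True assms by (intro integral_mono) auto
  finally show ?thesis using prob_space by simp
next
  \<comment> \<open>A non-integrable function has integral 0 by convention, and
    \<open>0 \<le> K\<close> follows from the bound at any sample point.\<close>
  case False
  interpret prob_space "P x" by (rule prob_space_P)
  obtain \<omega> where "\<omega> \<in> space M" using not_empty by auto
  then have "0 \<le> K" using assms[of \<omega>] by simp
  then show ?thesis using False by (simp add: not_integrable_integral_eq)
qed

lemma expectation_start:
  assumes "bmf h"
  shows "(\<integral>\<omega>. h (X 0 \<omega>) \<partial>P x) = h x"
proof -
  interpret prob_space "P x" by (rule prob_space_P)
  have "(\<integral>\<omega>. h (X 0 \<omega>) \<partial>P x) = (\<integral>\<omega>. h x \<partial>P x)"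
    using start[of x] weight_measurable[OF _ weight_X[of 0 0, OF _ _ assms]]
    by (intro integral_cong_AE) (auto cong: measurable_cong_sets)
  then show ?thesis using prob_space by simp
qed

section \<open>Discount factors and the Feynman-Kac formula\<close>

lemma rate_path:
  assumes "\<omega> \<in> space M" "0 \<le> s"
  shows "bounded_right_cont (\<lambda>u. r (X (s + u) \<omega>)) R"
proof
  show "right_cont (\<lambda>u. r (X (s + u) \<omega>))"
    by (intro right_cont_compose[OF _ r_cont] right_cont_shift paths assms)
qed (use r_nonneg r_le in auto)

text \<open>Discounting from time \<open>s\<close> to time \<open>s + t\<close>: the second argument
  is a duration, not an end time. The same convention is used in \<open>cost\<close>.\<close>

definition disc :: "real \<Rightarrow> real \<Rightarrow> 'w \<Rightarrow> real" where
  "disc s t \<omega> = exp (- set_lebesgue_integral lborel {0..t} (\<lambda>u. r (X (s + u) \<omega>)))"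

lemma disc_0: "disc 0 t \<omega> = exp (- alpha r X t \<omega>)"
  by (simp add: disc_def alpha_def)

lemma disc_pos: "0 < disc s t \<omega>"
  by (simp add: disc_def)

lemma disc_le_1: "disc s t \<omega> \<le> 1"
  unfolding disc_def set_lebesgue_integral_def
  by (auto intro!: integral_nonneg_AE simp: r_nonneg)

lemma disc_abs_le: "\<bar>disc s t \<omega>\<bar> \<le> 1"
  using disc_pos[of s t \<omega>] disc_le_1[of s t \<omega>] by simp

lemma disc_ge: "\<omega> \<in> space M \<Longrightarrow> 0 \<le> s \<Longrightarrow> 0 \<le> t \<Longrightarrow> exp (- (R * t)) \<le> disc s t \<omega>"
  using bounded_right_cont.set_integral_bound[OF rate_path, of \<omega> s t] by (simp add: disc_def)

lemma disc_split: "\<omega> \<in> space M \<Longrightarrow> 0 \<le> s \<Longrightarrow> 0 \<le> t \<Longrightarrow> disc 0 (s + t) \<omega> = disc 0 s \<omega> * disc s t \<omega>"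
  using bounded_right_cont.set_integral_split[OF rate_path, of \<omega> 0 s t]
  by (simp add: disc_def exp_add[symmetric])

lemma disc_right_cont:
  assumes "\<omega> \<in> space M" "0 \<le> s"
  shows "right_cont (\<lambda>t. disc s t \<omega>)"
  unfolding disc_def
  by (rule right_cont_compose[OF bounded_right_cont.set_integral_right_cont[OF rate_path[OF assms]]])
     (intro continuous_intros)

text \<open>One grid step of the Feynman-Kac semigroup, with the rate frozen at its value at the end
  of the step. The exponential factor is thus a function of the new state and can be put inside the
  semigroup.\<close>

definition damped_step :: "real \<Rightarrow> ('e \<Rightarrow> real) \<Rightarrow> 'e \<Rightarrow> real" where
  "damped_step a \<phi> = semigrp P X a (\<lambda>z. exp (- (a * r z)) * \<phi> z)"

lemma bmf_exp: "0 \<le> a \<Longrightarrow> bmf (\<lambda>z. exp (- (a * r z)))"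
  using r_nonneg by (intro bmfI[of _ 1] borel_measurable_continuous_onI continuous_intros r_cont) auto

lemma damped_step_bmf: "0 \<le> a \<Longrightarrow> bmf \<phi> \<Longrightarrow> bmf (damped_step a \<phi>)"
  unfolding damped_step_def by (intro semigrp_bmf bmf_mult bmf_exp)

lemma damped_step_funpow_bmf: "0 \<le> a \<Longrightarrow> bmf \<phi> \<Longrightarrow> bmf ((damped_step a ^^ m) \<phi>)"
  by (induction m) (auto intro: damped_step_bmf)

lemma grid_exp_abs_le: "0 \<le> a \<Longrightarrow> \<bar>exp (- (\<Sum>j<m. a * r (Y j)))\<bar> \<le> 1"
  using r_nonneg by (auto intro!: sum_nonneg)

lemma weight_grid_exp:
  assumes "0 \<le> s" "0 \<le> a"
  shows "weight (s + real m * a) (\<lambda>\<omega>. exp (- (\<Sum>j<m. a * r (X (s + real (Suc j) * a) \<omega>))))"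
proof (rule weightI)
  have "(\<lambda>\<omega>. r (X (s + real (Suc j) * a) \<omega>)) \<in> borel_measurable (Nt (s + real m * a))" if "j < m" for j
  proof (rule measurable_compose[OF X_Nt borel_measurable_continuous_onI[OF r_cont]])
    show "s + real (Suc j) * a \<le> s + real m * a"
      using that assms by (intro add_left_mono mult_right_mono) auto
  qed (use assms in auto)
  then show "(\<lambda>\<omega>. exp (- (\<Sum>j<m. a * r (X (s + real (Suc j) * a) \<omega>)))) \<in> borel_measurable (Nt (s + real m * a))"
    by measurable
  show "\<bar>exp (- (\<Sum>j<m. a * r (X (s + real (Suc j) * a) \<omega>)))\<bar> \<le> 1" for \<omega>
    using assms(2) by (rule grid_exp_abs_le)
qed

text \<open>The grid is removed from its far end: the last exponential factor depends on the final
  state only and is absorbed into \<open>\<phi>\<close>, while the earlier factors are known one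
  step before and join the weight.\<close>

lemma feynman_kac_grid:
  assumes s: "0 \<le> s" and a: "0 \<le> a" and Z: "weight s Z" and \<phi>: "bmf \<phi>"
  shows "(\<integral>\<omega>. Z \<omega> * (exp (- (\<Sum>j<m. a * r (X (s + real (Suc j) * a) \<omega>))) * \<phi> (X (s + real m * a) \<omega>)) \<partial>P x)
    = (\<integral>\<omega>. Z \<omega> * (damped_step a ^^ m) \<phi> (X s \<omega>) \<partial>P x)"
  using \<phi>
proof (induction m arbitrary: \<phi>)
  case (Suc m)
  let ?E = "\<lambda>m \<omega>. exp (- (\<Sum>j<m. a * r (X (s + real (Suc j) * a) \<omega>)))"
  let ?\<phi> = "\<lambda>z. exp (- (a * r z)) * \<phi> z"
  have t: "0 \<le> s + real m * a" "s \<le> s + real m * a" using s a by auto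
  have "(\<integral>\<omega>. Z \<omega> * (?E (Suc m) \<omega> * \<phi> (X (s + real (Suc m) * a) \<omega>)) \<partial>P x)
      = (\<integral>\<omega>. (Z \<omega> * ?E m \<omega>) * ?\<phi> (X (s + real m * a + a) \<omega>) \<partial>P x)"
    by (intro Bochner_Integration.integral_cong) (auto simp: exp_add exp_minus exp_diff algebra_simps divide_inverse)
  also have "\<dots> = (\<integral>\<omega>. (Z \<omega> * ?E m \<omega>) * damped_step a \<phi> (X (s + real m * a) \<omega>) \<partial>P x)"
    unfolding damped_step_def
    by (intro markov_weight t a weight_mult weight_mono[OF s t(2) Z] weight_grid_exp s bmf_mult bmf_exp Suc.prems)
  also have "\<dots> = (\<integral>\<omega>. Z \<omega> * (?E m \<omega> * damped_step a \<phi> (X (s + real m * a) \<omega>)) \<partial>P x)"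
    by (simp add: mult.assoc)
  also have "\<dots> = (\<integral>\<omega>. Z \<omega> * (damped_step a ^^ m) (damped_step a \<phi>) (X s \<omega>) \<partial>P x)"
    by (rule Suc.IH[OF damped_step_bmf[OF a Suc.prems]])
  finally show ?case by (simp add: funpow_swap1)
qed simp

lemma disc_riemann:
  assumes "\<omega> \<in> space M" "0 \<le> s" "0 \<le> t"
  shows "(\<lambda>n. exp (- (\<Sum>j<Suc n. t / Suc n * r (X (s + real (Suc j) * (t / Suc n)) \<omega>)))) \<longlonglongrightarrow> disc s t \<omega>"
  unfolding disc_def
  using bounded_right_cont.riemann_sum_LIMSEQ[OF rate_path[OF assms(1,2)] assms(3)]
  by (intro tendsto_intros) simp

lemma grid_end: "real (Suc n) * (t / real (Suc n)) = t"
  by simp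

lemma weight_disc:
  assumes "0 \<le> s" "0 \<le> t"
  shows "weight (s + t) (disc s t)"
proof (rule weightI)
  have "weight (s + t) (\<lambda>\<omega>. exp (- (\<Sum>j<Suc n. t / Suc n * r (X (s + real (Suc j) * (t / Suc n)) \<omega>))))" for n
    using weight_grid_exp[of s "t / Suc n" "Suc n"] assms unfolding grid_end by simp
  then have *: "(\<lambda>\<omega>. exp (- (\<Sum>j<Suc n. t / Suc n * r (X (s + real (Suc j) * (t / Suc n)) \<omega>))))
      \<in> borel_measurable (Nt (s + t))" for n
    unfolding weight_def by blast
  show "disc s t \<in> borel_measurable (Nt (s + t))"
    by (rule borel_measurable_LIMSEQ_real[OF disc_riemann *]) (use assms in simp_all)
qed (rule disc_abs_le)

definition fk :: "real \<Rightarrow> ('e \<Rightarrow> real) \<Rightarrow> 'e \<Rightarrow> real" where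
  "fk t \<phi> y = (\<integral>\<omega>. disc 0 t \<omega> * \<phi> (X t \<omega>) \<partial>P y)"

lemma fk_LIMSEQ:
  assumes s: "0 \<le> s" and t: "0 \<le> t" and Z: "weight s Z" and \<phi>: "bmf \<phi>"
  shows "(\<lambda>n. \<integral>\<omega>. Z \<omega> * (damped_step (t / Suc n) ^^ Suc n) \<phi> (X s \<omega>) \<partial>P x)
    \<longlonglongrightarrow> (\<integral>\<omega>. Z \<omega> * (disc s t \<omega> * \<phi> (X (s + t) \<omega>)) \<partial>P x)"
proof -
  let ?E = "\<lambda>n \<omega>. exp (- (\<Sum>j<Suc n. t / Suc n * r (X (s + real (Suc j) * (t / Suc n)) \<omega>)))"
  obtain K where K: "0 < K" "\<And>\<omega>. \<omega> \<in> space M \<Longrightarrow> \<bar>Z \<omega>\<bar> \<le> K" using Z by (metis weight_bound)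
  obtain L where L: "0 < L" "\<And>y. \<bar>\<phi> y\<bar> \<le> L" using \<phi> by (metis bmf_bound)
  have st: "0 \<le> s + t" using s t by simp
  have wE: "weight (s + t) (?E n)" for n
    using weight_grid_exp[of s "t / Suc n" "Suc n"] s t unfolding grid_end by simp
  have "(\<lambda>n. \<integral>\<omega>. Z \<omega> * (?E n \<omega> * \<phi> (X (s + t) \<omega>)) \<partial>P x)
    \<longlonglongrightarrow> (\<integral>\<omega>. Z \<omega> * (disc s t \<omega> * \<phi> (X (s + t) \<omega>)) \<partial>P x)"
  proof (rule expectation_LIMSEQ[where K="K * (1 * L)"])
    show "(\<lambda>\<omega>. Z \<omega> * (?E n \<omega> * \<phi> (X (s + t) \<omega>))) \<in> borel_measurable M" for n
      by (rule weight_measurable[OF st]) (intro weight_mult wE weight_X st \<phi> weight_mono[OF s _ Z]; simp add: t)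
    show "(\<lambda>n. Z \<omega> * (?E n \<omega> * \<phi> (X (s + t) \<omega>))) \<longlonglongrightarrow> Z \<omega> * (disc s t \<omega> * \<phi> (X (s + t) \<omega>))"
      if "\<omega> \<in> space M" for \<omega>
      by (intro tendsto_intros disc_riemann that s t)
    show "\<bar>Z \<omega> * (?E n \<omega> * \<phi> (X (s + t) \<omega>))\<bar> \<le> K * (1 * L)" if "\<omega> \<in> space M" for n \<omega>
      unfolding abs_mult using K(1) t
      by (intro mult_mono K(2)[OF that] L(2) grid_exp_abs_le) simp_all
  qed
  moreover have "(\<integral>\<omega>. Z \<omega> * (?E n \<omega> * \<phi> (X (s + t) \<omega>)) \<partial>P x)
      = (\<integral>\<omega>. Z \<omega> * (damped_step (t / Suc n) ^^ Suc n) \<phi> (X s \<omega>) \<partial>P x)" for n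
    using feynman_kac_grid[OF s _ Z \<phi>, where a="t / Suc n" and m="Suc n" and x=x] t unfolding grid_end by simp
  ultimately show ?thesis by simp
qed

lemma fk_pointwise:
  assumes t: "0 \<le> t" and \<phi>: "bmf \<phi>"
  shows "(\<lambda>n. (damped_step (t / Suc n) ^^ Suc n) \<phi> y) \<longlonglongrightarrow> fk t \<phi> y"
proof -
  have "bmf ((damped_step (t / Suc n) ^^ Suc n) \<phi>)" for n
    by (intro damped_step_funpow_bmf) (use t \<phi> in auto)
  then have "(\<integral>\<omega>. 1 * (damped_step (t / Suc n) ^^ Suc n) \<phi> (X 0 \<omega>) \<partial>P y)
      = (damped_step (t / Suc n) ^^ Suc n) \<phi> y" for n
    unfolding mult_1 by (rule expectation_start)
  then show ?thesis
    using fk_LIMSEQ[OF _ t weight_const[of 0 1] \<phi>, of y] by (simp add: fk_def)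
qed

text \<open>Read through its Feynman-Kac expectation, the power averages \<open>\<phi>\<close> with
  factors at most 1. The resulting bound is uniform in \<open>n\<close>, as bounded convergence
  requires.\<close>

lemma grid_bound:
  assumes t: "0 \<le> t" and \<phi>: "bmf \<phi>" and K: "\<And>y. \<bar>\<phi> y\<bar> \<le> K"
  shows "\<bar>(damped_step (t / Suc n) ^^ Suc n) \<phi> y\<bar> \<le> K"
proof -
  let ?E = "\<lambda>\<omega>. exp (- (\<Sum>j<Suc n. t / Suc n * r (X (0 + real (Suc j) * (t / Suc n)) \<omega>)))"
  have "bmf ((damped_step (t / Suc n) ^^ Suc n) \<phi>)"
    by (intro damped_step_funpow_bmf) (use t \<phi> in auto)
  from expectation_start[OF this]
  have "(damped_step (t / Suc n) ^^ Suc n) \<phi> y = (\<integral>\<omega>. 1 * (damped_step (t / Suc n) ^^ Suc n) \<phi> (X 0 \<omega>) \<partial>P y)"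
    by simp
  also have "\<dots> = (\<integral>\<omega>. 1 * (?E \<omega> * \<phi> (X (0 + t) \<omega>)) \<partial>P y)"
    using feynman_kac_grid[OF _ _ weight_const[of 0 1] \<phi>, where a="t / Suc n" and m="Suc n" and x=y] t unfolding grid_end by simp
  also have "\<bar>\<dots>\<bar> \<le> 1 * K"
  proof (rule expectation_bound)
    fix \<omega>
    show "\<bar>1 * (?E \<omega> * \<phi> (X (0 + t) \<omega>))\<bar> \<le> 1 * K"
      unfolding mult_1_left[of "_ * \<phi> _"] abs_mult using t
      by (intro mult_mono K grid_exp_abs_le) simp_all
  qed
  finally show ?thesis by simp
qed

text \<open>Measurability in the initial state is not immediate for the expectation of a path
  functional; it is inherited from the powers of \<open>damped_step\<close>, to which the kernel
  assumption applies.\<close>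

lemma fk_bmf:
  assumes t: "0 \<le> t" and \<phi>: "bmf \<phi>"
  shows "bmf (fk t \<phi>)"
proof -
  obtain L where L: "0 < L" "\<And>y. \<bar>\<phi> y\<bar> \<le> L" using \<phi> by (metis bmf_bound)
  show ?thesis
    by (rule bmf_LIMSEQ[OF _ fk_pointwise[OF t \<phi>] grid_bound[OF t \<phi> L(2)]])
       (intro damped_step_funpow_bmf \<phi>, use t in simp)
qed

lemma fk_bound: "(\<And>y. \<bar>\<phi> y\<bar> \<le> K) \<Longrightarrow> \<bar>fk t \<phi> y\<bar> \<le> K"
  unfolding fk_def
  using mult_mono[OF disc_abs_le, of "\<bar>\<phi> (X t \<omega>)\<bar>" K 0 t \<omega> for \<omega>]
  by (intro expectation_bound) (simp add: abs_mult)

text \<open>Both sides are limits of one sequence: the grid powers evaluated at \<open>X s\<close>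
  converge to the left side through Riemann sums along the path after \<open>s\<close>, and to the
  right side by pointwise convergence in the state.\<close>

lemma feynman_kac:
  assumes s: "0 \<le> s" and t: "0 \<le> t" and Z: "weight s Z" and \<phi>: "bmf \<phi>"
  shows "(\<integral>\<omega>. Z \<omega> * (disc s t \<omega> * \<phi> (X (s + t) \<omega>)) \<partial>P x) = (\<integral>\<omega>. Z \<omega> * fk t \<phi> (X s \<omega>) \<partial>P x)"
proof (rule LIMSEQ_unique[OF fk_LIMSEQ[OF s t Z \<phi>]])
  obtain K where K: "0 < K" "\<And>\<omega>. \<omega> \<in> space M \<Longrightarrow> \<bar>Z \<omega>\<bar> \<le> K" using Z by (metis weight_bound)
  obtain L where L: "0 < L" "\<And>y. \<bar>\<phi> y\<bar> \<le> L" using \<phi> by (metis bmf_bound)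
  show "(\<lambda>n. \<integral>\<omega>. Z \<omega> * (damped_step (t / Suc n) ^^ Suc n) \<phi> (X s \<omega>) \<partial>P x)
    \<longlonglongrightarrow> (\<integral>\<omega>. Z \<omega> * fk t \<phi> (X s \<omega>) \<partial>P x)"
  proof (rule expectation_LIMSEQ[where K="K * L"])
    show "(\<lambda>\<omega>. Z \<omega> * (damped_step (t / Suc n) ^^ Suc n) \<phi> (X s \<omega>)) \<in> borel_measurable M" for n
      by (rule weight_measurable[OF s]) (intro weight_mult Z weight_X s order_refl damped_step_funpow_bmf \<phi>, use t in simp)
    show "(\<lambda>n. Z \<omega> * (damped_step (t / Suc n) ^^ Suc n) \<phi> (X s \<omega>)) \<longlonglongrightarrow> Z \<omega> * fk t \<phi> (X s \<omega>)" for \<omega>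
      by (intro tendsto_intros fk_pointwise t \<phi>)
    show "\<bar>Z \<omega> * (damped_step (t / Suc n) ^^ Suc n) \<phi> (X s \<omega>)\<bar> \<le> K * L" if "\<omega> \<in> space M" for n \<omega>
      unfolding abs_mult
      using K(2)[OF that] K(1) grid_bound[OF t \<phi> L(2)] by (intro mult_mono) auto
  qed
qed

section \<open>The discounted running reward\<close>

definition cost :: "('e \<Rightarrow> real) \<Rightarrow> real \<Rightarrow> real \<Rightarrow> 'w \<Rightarrow> real" where
  "cost k s t \<omega> = set_lebesgue_integral lborel {0..t} (\<lambda>u. disc s u \<omega> * k (X (s + u) \<omega>))"

lemma cost_path:
  assumes "\<omega> \<in> space M" "0 \<le> s" "cbf k" "\<And>y. \<bar>k y\<bar> \<le> L"
  shows "bounded_right_cont (\<lambda>u. disc s u \<omega> * k (X (s + u) \<omega>)) L"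
proof
  show "right_cont (\<lambda>u. disc s u \<omega> * k (X (s + u) \<omega>))"
    using assms(3)
    by (intro right_cont_mult disc_right_cont right_cont_compose[of "\<lambda>u. X (s + u) \<omega>" k] right_cont_shift paths assms)
       (simp add: cbf_def)
  show "\<bar>disc s t \<omega> * k (X (s + t) \<omega>)\<bar> \<le> L" for t
    using mult_mono[OF disc_abs_le assms(4)] by (simp add: abs_mult)
qed

lemma cost_bound:
  assumes "\<omega> \<in> space M" "0 \<le> s" "0 \<le> t" "cbf k" "\<And>y. \<bar>k y\<bar> \<le> L"
  shows "\<bar>cost k s t \<omega>\<bar> \<le> L * t"
  unfolding cost_def
  by (rule bounded_right_cont.set_integral_bound[OF cost_path[OF assms(1,2,4,5)] assms(3)])

lemma cost_riemann:
  assumes "\<omega> \<in> space M" "0 \<le> s" "0 \<le> t" "cbf k"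
  shows "(\<lambda>n. \<Sum>j<Suc n. t / Suc n * (disc s (real (Suc j) * t / Suc n) \<omega> * k (X (s + real (Suc j) * t / Suc n) \<omega>)))
    \<longlonglongrightarrow> cost k s t \<omega>"
proof -
  obtain L where "\<And>y. \<bar>k y\<bar> \<le> L" using assms(4) by (metis cbf_bound)
  from bounded_right_cont.riemann_sum_LIMSEQ[OF cost_path[OF assms(1,2,4) this] assms(3)]
  show ?thesis unfolding cost_def .
qed

lemma riemann_node:
  fixes t :: real
  assumes "0 \<le> t" "j < Suc n"
  shows "0 \<le> real (Suc j) * t / Suc n" "real (Suc j) * t / Suc n \<le> t"
proof -
  show "0 \<le> real (Suc j) * t / Suc n" using assms(1) by simp
  have "real (Suc j) * t \<le> real (Suc n) * t"
    using assms by (intro mult_right_mono) auto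
  then show "real (Suc j) * t / Suc n \<le> t"
    by (simp add: divide_le_eq mult.commute del: of_nat_Suc)
qed

lemma weight_riemann_term:
  assumes "0 \<le> s" "0 \<le> t" "j < Suc n" "bmf k"
  shows "weight (s + t) (\<lambda>\<omega>. disc s (real (Suc j) * t / Suc n) \<omega> * k (X (s + real (Suc j) * t / Suc n) \<omega>))"
  using riemann_node[OF assms(2,3)] assms(1)
  by (intro weight_mult weight_X weight_mono[OF _ _ weight_disc] assms(4) add_left_mono add_nonneg_nonneg)

lemma weight_sum: "finite S \<Longrightarrow> (\<And>j. j \<in> S \<Longrightarrow> weight t (Y j)) \<Longrightarrow> weight t (\<lambda>\<omega>. \<Sum>j\<in>S. Y j \<omega>)"
  by (induction S rule: finite_induct) (auto intro: weight_add weight_const)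

lemma weight_cost:
  assumes "0 \<le> s" "0 \<le> t" "cbf k"
  shows "weight (s + t) (cost k s t)"
proof -
  obtain L where L: "\<And>y. \<bar>k y\<bar> \<le> L" using assms(3) by (metis cbf_bound)
  have "weight (s + t) (\<lambda>\<omega>. \<Sum>j<Suc n. t / Suc n * (disc s (real (Suc j) * t / Suc n) \<omega> * k (X (s + real (Suc j) * t / Suc n) \<omega>)))" for n
    using assms by (intro weight_sum weight_mult[OF weight_const] weight_riemann_term cbf_bmf) auto
  then have *: "(\<lambda>\<omega>. \<Sum>j<Suc n. t / Suc n * (disc s (real (Suc j) * t / Suc n) \<omega> * k (X (s + real (Suc j) * t / Suc n) \<omega>)))
    \<in> borel_measurable (Nt (s + t))" for n
    unfolding weight_def by blast
  show ?thesis
  proof (rule weightI)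
    show "cost k s t \<in> borel_measurable (Nt (s + t))"
      by (rule borel_measurable_LIMSEQ_real[OF cost_riemann *]) (use assms in simp_all)
    show "\<bar>cost k s t \<omega>\<bar> \<le> L * t" if "\<omega> \<in> space M" for \<omega>
      by (rule cost_bound[OF that assms L])
  qed
qed

definition running :: "('e \<Rightarrow> real) \<Rightarrow> real \<Rightarrow> 'e \<Rightarrow> real" where
  "running k t y = (\<integral>\<omega>. cost k 0 t \<omega> \<partial>P y)"

text \<open>A Riemann sum in time taken outside the expectation. It transfers the Markov property
  and the measurability in the initial state from \<open>fk\<close> to \<open>running\<close>, and
  no joint measurability in time and path enters.\<close>

definition fk_sum :: "('e \<Rightarrow> real) \<Rightarrow> real \<Rightarrow> nat \<Rightarrow> 'e \<Rightarrow> real" where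
  "fk_sum k t n y = (\<Sum>j<Suc n. t / Suc n * fk (real (Suc j) * t / Suc n) k y)"

lemma bmf_sum: "finite S \<Longrightarrow> (\<And>j. j \<in> S \<Longrightarrow> bmf (p j)) \<Longrightarrow> bmf (\<lambda>y. \<Sum>j\<in>S. p j y)"
  by (induction S rule: finite_induct) (auto intro: bmf_add bmfI[of _ 0])

lemma bmf_const: "bmf (\<lambda>_. c)"
  by (rule bmfI) auto

lemma fk_sum_bmf:
  assumes "0 \<le> t" "bmf k"
  shows "bmf (fk_sum k t n)"
  unfolding fk_sum_def using assms
  by (intro bmf_sum bmf_mult[OF bmf_const] fk_bmf) auto

lemma fk_sum_bound:
  assumes "0 \<le> t" "\<And>y. \<bar>k y\<bar> \<le> L"
  shows "\<bar>fk_sum k t n y\<bar> \<le> L * t"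
proof -
  have "\<bar>fk_sum k t n y\<bar> \<le> (\<Sum>j<Suc n. \<bar>t / Suc n * fk (real (Suc j) * t / Suc n) k y\<bar>)"
    unfolding fk_sum_def by (rule sum_abs)
  also have "\<dots> \<le> (\<Sum>j<Suc n. t / Suc n * L)"
    unfolding abs_mult using assms(1) by (intro sum_mono mult_mono fk_bound assms(2)) auto
  also have "\<dots> = L * t" by (simp del: of_nat_Suc)
  finally show ?thesis .
qed

lemma fk_sum_LIMSEQ:
  assumes s: "0 \<le> s" and t: "0 \<le> t" and Z: "weight s Z" and k: "cbf k"
  shows "(\<lambda>n. \<integral>\<omega>. Z \<omega> * fk_sum k t n (X s \<omega>) \<partial>P x) \<longlonglongrightarrow> (\<integral>\<omega>. Z \<omega> * cost k s t \<omega> \<partial>P x)"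
proof -
  let ?Y = "\<lambda>n j \<omega>. disc s (real (Suc j) * t / Suc n) \<omega> * k (X (s + real (Suc j) * t / Suc n) \<omega>)"
  obtain K where K: "0 < K" "\<And>\<omega>. \<omega> \<in> space M \<Longrightarrow> \<bar>Z \<omega>\<bar> \<le> K" using Z by (metis weight_bound)
  obtain L where L: "0 < L" "\<And>y. \<bar>k y\<bar> \<le> L" using k by (metis cbf_bound)
  have st: "0 \<le> s + t" "s \<le> s + t" using s t by auto
  have w: "weight (s + t) (\<lambda>\<omega>. Z \<omega> * ?Y n j \<omega>)" if "j < Suc n" for n j
    by (intro weight_mult weight_mono[OF s st(2) Z] weight_riemann_term s t that cbf_bmf k)
  have w': "weight (s + t) (\<lambda>\<omega>. Z \<omega> * (\<Sum>j<Suc n. t / Suc n * ?Y n j \<omega>))" for n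
    by (intro weight_mult[OF weight_mono[OF s st(2) Z]] weight_sum weight_mult[OF weight_const] weight_riemann_term s t cbf_bmf k)
       auto
  have "(\<lambda>n. \<integral>\<omega>. Z \<omega> * (\<Sum>j<Suc n. t / Suc n * ?Y n j \<omega>) \<partial>P x) \<longlonglongrightarrow> (\<integral>\<omega>. Z \<omega> * cost k s t \<omega> \<partial>P x)"
  proof (rule expectation_LIMSEQ[where K="K * (L * t)"])
    show "(\<lambda>\<omega>. Z \<omega> * (\<Sum>j<Suc n. t / Suc n * ?Y n j \<omega>)) \<in> borel_measurable M" for n
      by (rule weight_measurable[OF st(1) w'])
    show "(\<lambda>n. Z \<omega> * (\<Sum>j<Suc n. t / Suc n * ?Y n j \<omega>)) \<longlonglongrightarrow> Z \<omega> * cost k s t \<omega>" if "\<omega> \<in> space M" for \<omega>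
      by (intro tendsto_intros cost_riemann that s t k)
    fix n \<omega> assume \<omega>: "\<omega> \<in> space M"
    have "\<bar>\<Sum>j<Suc n. t / Suc n * ?Y n j \<omega>\<bar> \<le> (\<Sum>j<Suc n. \<bar>t / Suc n * ?Y n j \<omega>\<bar>)"
      by (rule sum_abs)
    also have "\<dots> \<le> (\<Sum>j<Suc n. t / Suc n * (1 * L))"
      unfolding abs_mult using t by (intro sum_mono mult_mono disc_abs_le L) auto
    also have "\<dots> = L * t" by (simp del: of_nat_Suc)
    finally show "\<bar>Z \<omega> * (\<Sum>j<Suc n. t / Suc n * ?Y n j \<omega>)\<bar> \<le> K * (L * t)"
      unfolding abs_mult using K(1) by (intro mult_mono K(2)[OF \<omega>]) auto
  qed
  moreover have "(\<integral>\<omega>. Z \<omega> * (\<Sum>j<Suc n. t / Suc n * ?Y n j \<omega>) \<partial>P x)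
      = (\<integral>\<omega>. Z \<omega> * fk_sum k t n (X s \<omega>) \<partial>P x)" for n
  proof -
    have "(\<integral>\<omega>. Z \<omega> * (\<Sum>j<Suc n. t / Suc n * ?Y n j \<omega>) \<partial>P x)
        = (\<integral>\<omega>. (\<Sum>j<Suc n. t / Suc n * (Z \<omega> * ?Y n j \<omega>)) \<partial>P x)"
      by (simp only: sum_distrib_left mult.left_commute)
    also have "\<dots> = (\<Sum>j<Suc n. t / Suc n * (\<integral>\<omega>. Z \<omega> * ?Y n j \<omega> \<partial>P x))"
      using weight_integrable[OF st(1) w]
      by (subst Bochner_Integration.integral_sum) (auto simp del: of_nat_Suc sum.lessThan_Suc)
    also have "\<dots> = (\<Sum>j<Suc n. t / Suc n * (\<integral>\<omega>. Z \<omega> * fk (real (Suc j) * t / Suc n) k (X s \<omega>) \<partial>P x))"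
    proof (intro sum.cong refl arg_cong2[where f="(*)"])
      fix j assume "j \<in> {..<Suc n}"
      then show "(\<integral>\<omega>. Z \<omega> * ?Y n j \<omega> \<partial>P x) = (\<integral>\<omega>. Z \<omega> * fk (real (Suc j) * t / Suc n) k (X s \<omega>) \<partial>P x)"
        using riemann_node(1)[OF t, of j n] by (intro feynman_kac s Z cbf_bmf k) auto
    qed
    also have "\<dots> = (\<integral>\<omega>. (\<Sum>j<Suc n. t / Suc n * (Z \<omega> * fk (real (Suc j) * t / Suc n) k (X s \<omega>))) \<partial>P x)"
    proof -
      have "integrable (P x) (\<lambda>\<omega>. Z \<omega> * fk (real (Suc j) * t / Suc n) k (X s \<omega>))" if "j < Suc n" for j
        using riemann_node(1)[OF t that]
        by (intro weight_integrable[OF s] weight_mult Z weight_X fk_bmf cbf_bmf k s order_refl)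
      then show ?thesis
        by (subst Bochner_Integration.integral_sum) (auto simp del: of_nat_Suc sum.lessThan_Suc)
    qed
    also have "\<dots> = (\<integral>\<omega>. Z \<omega> * fk_sum k t n (X s \<omega>) \<partial>P x)"
      unfolding fk_sum_def by (simp only: sum_distrib_left mult.left_commute)
    finally show ?thesis .
  qed
  ultimately show ?thesis by simp
qed

lemma running_pointwise:
  assumes t: "0 \<le> t" and k: "cbf k"
  shows "(\<lambda>n. fk_sum k t n y) \<longlonglongrightarrow> running k t y"
  using fk_sum_LIMSEQ[OF order_refl t weight_const[of 0 1] k, of y]
  by (simp add: running_def expectation_start[OF fk_sum_bmf[OF t cbf_bmf[OF k]]])

lemma running_bmf:
  assumes t: "0 \<le> t" and k: "cbf k"
  shows "bmf (running k t)"
proof -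
  obtain L where L: "\<And>y. \<bar>k y\<bar> \<le> L" using k by (metis cbf_bound)
  show ?thesis
    by (rule bmf_LIMSEQ[OF fk_sum_bmf running_pointwise fk_sum_bound]) (use t k L in \<open>auto intro: cbf_bmf\<close>)
qed

lemma markov_cost:
  assumes s: "0 \<le> s" and t: "0 \<le> t" and Z: "weight s Z" and k: "cbf k"
  shows "(\<integral>\<omega>. Z \<omega> * cost k s t \<omega> \<partial>P x) = (\<integral>\<omega>. Z \<omega> * running k t (X s \<omega>) \<partial>P x)"
proof (rule LIMSEQ_unique[OF fk_sum_LIMSEQ[OF s t Z k]])
  obtain K where K: "0 < K" "\<And>\<omega>. \<omega> \<in> space M \<Longrightarrow> \<bar>Z \<omega>\<bar> \<le> K" using Z by (metis weight_bound)
  obtain L where L: "0 < L" "\<And>y. \<bar>k y\<bar> \<le> L" using k by (metis cbf_bound)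
  show "(\<lambda>n. \<integral>\<omega>. Z \<omega> * fk_sum k t n (X s \<omega>) \<partial>P x) \<longlonglongrightarrow> (\<integral>\<omega>. Z \<omega> * running k t (X s \<omega>) \<partial>P x)"
  proof (rule expectation_LIMSEQ[where K="K * (L * t)"])
    show "(\<lambda>\<omega>. Z \<omega> * fk_sum k t n (X s \<omega>)) \<in> borel_measurable M" for n
      by (rule weight_measurable[OF s]) (intro weight_mult Z weight_X s order_refl fk_sum_bmf t cbf_bmf k)
    show "(\<lambda>n. Z \<omega> * fk_sum k t n (X s \<omega>)) \<longlonglongrightarrow> Z \<omega> * running k t (X s \<omega>)" for \<omega>
      by (intro tendsto_intros running_pointwise t k)
    show "\<bar>Z \<omega> * fk_sum k t n (X s \<omega>)\<bar> \<le> K * (L * t)" if "\<omega> \<in> space M" for n \<omega>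
      unfolding abs_mult using K(1) by (intro mult_mono K(2)[OF that] fk_sum_bound t L) auto
  qed
qed

section \<open>The gain process and its one-step operator\<close>

definition gain :: "('e \<Rightarrow> real) \<Rightarrow> ('e \<Rightarrow> real) \<Rightarrow> real \<Rightarrow> 'w \<Rightarrow> real" where
  "gain k u t \<omega> = cost k 0 t \<omega> + disc 0 t \<omega> * u (X t \<omega>)"

text \<open>The value of collecting \<open>k\<close> for time \<open>t\<close> and then receiving
  \<open>u\<close>. An inequality \<open>Gop k u t y \<le> u y\<close> for all \<open>t\<close> and
  \<open>y\<close> says that \<open>u\<close> is superharmonic for reward \<open>k\<close>, so that
  \<open>gain k u\<close> is a supermartingale.\<close>

definition Gop :: "('e \<Rightarrow> real) \<Rightarrow> ('e \<Rightarrow> real) \<Rightarrow> real \<Rightarrow> 'e \<Rightarrow> real" where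
  "Gop k u t y = running k t y + fk t u y"

lemma Gop_bmf: "0 \<le> t \<Longrightarrow> cbf k \<Longrightarrow> bmf u \<Longrightarrow> bmf (Gop k u t)"
  unfolding Gop_def by (intro bmf_add running_bmf fk_bmf)

lemma weight_gain:
  assumes "0 \<le> s" "s \<le> t" "cbf k" "bmf u"
  shows "weight t (gain k u s)"
  unfolding gain_def using weight_cost[of 0 s k] weight_disc[of 0 s] weight_X[of s s u] assms
  by (intro weight_mono[of s t] weight_add weight_mult) auto

lemma gain_measurable: "0 \<le> t \<Longrightarrow> cbf k \<Longrightarrow> bmf u \<Longrightarrow> gain k u t \<in> borel_measurable M"
  by (rule weight_measurable[OF _ weight_gain]) auto

lemma Gop_expectation:
  assumes "0 \<le> t" "cbf k" "bmf u"
  shows "Gop k u t y = (\<integral>\<omega>. gain k u t \<omega> \<partial>P y)"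
proof -
  have "integrable (P y) (cost k 0 t)" "integrable (P y) (\<lambda>\<omega>. disc 0 t \<omega> * u (X t \<omega>))"
    using weight_cost[of 0 t k] weight_disc[of 0 t] weight_X[of t t u] assms
    by (auto intro!: weight_integrable[of t] weight_mult)
  then show ?thesis unfolding Gop_def running_def fk_def gain_def by simp
qed

lemma gain_0: "gain k u 0 \<omega> = u (X 0 \<omega>)"
proof -
  have "set_lebesgue_integral lborel {0..0} q = 0" for q :: "real \<Rightarrow> real"
  proof -
    have "AE u in lborel. indicator {0..0::real} u *\<^sub>R q u = 0"
      using AE_lborel_singleton[of "0::real"] by eventually_elim auto
    then show ?thesis
      unfolding set_lebesgue_integral_def by (rule integral_eq_zero_AE)
  qed
  then show ?thesis by (simp add: gain_def cost_def disc_def)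
qed

lemma gain_bound:
  assumes "\<omega> \<in> space M" "0 \<le> t" "cbf k" "\<And>y. \<bar>k y\<bar> \<le> L" "\<And>y. \<bar>u y\<bar> \<le> U"
  shows "\<bar>gain k u t \<omega>\<bar> \<le> L * t + U"
proof -
  have "\<bar>disc 0 t \<omega> * u (X t \<omega>)\<bar> \<le> 1 * U"
    unfolding abs_mult by (intro mult_mono disc_abs_le assms) auto
  then show ?thesis
    using cost_bound[OF assms(1) order_refl assms(2-4)] unfolding gain_def by linarith
qed

lemma gain_mono: "(\<And>y. u y \<le> v y) \<Longrightarrow> gain k u t \<omega> \<le> gain k v t \<omega>"
  unfolding gain_def using disc_pos[of 0 t \<omega>] by simp

lemma gain_split:
  assumes \<omega>: "\<omega> \<in> space M" and s: "0 \<le> s" and t: "0 \<le> t" and k: "cbf k"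
  shows "gain k u (s + t) \<omega> = cost k 0 s \<omega> + disc 0 s \<omega> * (cost k s t \<omega> + disc s t \<omega> * u (X (s + t) \<omega>))"
proof -
  obtain L where L: "\<And>y. \<bar>k y\<bar> \<le> L" using k by (metis cbf_bound)
  have "cost k 0 (s + t) \<omega> = cost k 0 s \<omega>
      + set_lebesgue_integral lborel {0..t} (\<lambda>v. disc 0 (s + v) \<omega> * k (X (0 + (s + v)) \<omega>))"
    unfolding cost_def
    by (rule bounded_right_cont.set_integral_split[OF cost_path[OF \<omega> order_refl k L] s t])
  also have "set_lebesgue_integral lborel {0..t} (\<lambda>v. disc 0 (s + v) \<omega> * k (X (0 + (s + v)) \<omega>))
      = set_lebesgue_integral lborel {0..t} (\<lambda>v. disc 0 s \<omega> * (disc s v \<omega> * k (X (s + v) \<omega>)))"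
    by (rule set_lebesgue_integral_cong) (auto simp: disc_split[OF \<omega> s])
  also have "\<dots> = disc 0 s \<omega> * cost k s t \<omega>"
    unfolding cost_def by (rule set_integral_mult_right)
  finally show ?thesis
    unfolding gain_def disc_split[OF \<omega> s t] by (simp add: algebra_simps)
qed

text \<open>The discount accumulated up to \<open>s\<close> joins the indicator of \<open>A\<close>
  to form a weight at time \<open>s\<close>; the reward collected after \<open>s\<close> and the
  terminal value are then treated by \<open>markov_cost\<close> and \<open>feynman_kac\<close>
  separately.\<close>

lemma markov_gain:
  assumes s: "0 \<le> s" and t: "0 \<le> t" and A: "A \<in> F s" and k: "cbf k" and u: "bmf u"
  shows "(\<integral>\<omega>. indicator A \<omega> * gain k u (s + t) \<omega> \<partial>P x)
    = (\<integral>\<omega>. indicator A \<omega> * gain k (Gop k u t) s \<omega> \<partial>P x)"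
proof -
  let ?Z = "\<lambda>\<omega>. indicator A \<omega> * disc 0 s \<omega>"
  have st: "0 \<le> s + t" "s \<le> s + t" using s t by auto
  have wZ: "weight s ?Z" using weight_disc[of 0 s] s A by (intro weight_mult weight_indicator) auto
  have 1: "weight s (\<lambda>\<omega>. indicator A \<omega> * cost k 0 s \<omega>)"
    using weight_cost[of 0 s k] s A k by (intro weight_mult weight_indicator) auto
  have 2: "weight (s + t) (\<lambda>\<omega>. ?Z \<omega> * cost k s t \<omega>)"
    by (intro weight_mult weight_mono[OF s st(2) wZ] weight_cost s t k)
  have 3: "weight (s + t) (\<lambda>\<omega>. ?Z \<omega> * (disc s t \<omega> * u (X (s + t) \<omega>)))"
    by (intro weight_mult weight_mono[OF s st(2) wZ] weight_disc weight_X s t u st order_refl)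
  have 4: "weight s (\<lambda>\<omega>. ?Z \<omega> * running k t (X s \<omega>))"
    by (intro weight_mult wZ weight_X running_bmf s t k order_refl)
  have 5: "weight s (\<lambda>\<omega>. ?Z \<omega> * fk t u (X s \<omega>))"
    by (intro weight_mult wZ weight_X fk_bmf s t u order_refl)
  note int = weight_integrable[OF s 1, of x] weight_integrable[OF st(1) 2, of x]
    weight_integrable[OF st(1) 3, of x] weight_integrable[OF s 4, of x] weight_integrable[OF s 5, of x]
  have "(\<integral>\<omega>. indicator A \<omega> * gain k u (s + t) \<omega> \<partial>P x)
      = (\<integral>\<omega>. indicator A \<omega> * cost k 0 s \<omega> + (?Z \<omega> * cost k s t \<omega> + ?Z \<omega> * (disc s t \<omega> * u (X (s + t) \<omega>))) \<partial>P x)"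
    by (intro Bochner_Integration.integral_cong refl) (simp add: gain_split[OF _ s t k] algebra_simps)
  also have "\<dots> = (\<integral>\<omega>. indicator A \<omega> * cost k 0 s \<omega> \<partial>P x) + ((\<integral>\<omega>. ?Z \<omega> * cost k s t \<omega> \<partial>P x)
      + (\<integral>\<omega>. ?Z \<omega> * (disc s t \<omega> * u (X (s + t) \<omega>)) \<partial>P x))"
    by (subst Bochner_Integration.integral_add[OF int(1) Bochner_Integration.integrable_add[OF int(2,3)]],
        subst Bochner_Integration.integral_add[OF int(2,3)]) (rule refl)
  also have "\<dots> = (\<integral>\<omega>. indicator A \<omega> * cost k 0 s \<omega> \<partial>P x) + ((\<integral>\<omega>. ?Z \<omega> * running k t (X s \<omega>) \<partial>P x)
      + (\<integral>\<omega>. ?Z \<omega> * fk t u (X s \<omega>) \<partial>P x))"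
    by (simp only: markov_cost[OF s t wZ k] feynman_kac[OF s t wZ u])
  also have "\<dots> = (\<integral>\<omega>. indicator A \<omega> * cost k 0 s \<omega> + (?Z \<omega> * running k t (X s \<omega>) + ?Z \<omega> * fk t u (X s \<omega>)) \<partial>P x)"
    by (subst Bochner_Integration.integral_add[OF int(1) Bochner_Integration.integrable_add[OF int(4,5)]],
        subst Bochner_Integration.integral_add[OF int(4,5)]) (rule refl)
  also have "\<dots> = (\<integral>\<omega>. indicator A \<omega> * gain k (Gop k u t) s \<omega> \<partial>P x)"
    by (intro Bochner_Integration.integral_cong refl) (simp add: gain_def Gop_def algebra_simps)
  finally show ?thesis .
qed

section \<open>Random grid times and supermartingales on a grid\<close>

lemma indicator_gain_integrable:
  "0 \<le> s \<Longrightarrow> s \<le> t \<Longrightarrow> A \<in> F t \<Longrightarrow> cbf k \<Longrightarrow> bmf u \<Longrightarrow> integrable (P x) (\<lambda>\<omega>. indicator A \<omega> * gain k u s \<omega>)"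
  by (intro weight_integrable[of t] weight_mult weight_indicator weight_gain) auto

lemma F_Int: "0 \<le> t \<Longrightarrow> A \<in> F t \<Longrightarrow> B \<in> F t \<Longrightarrow> A \<inter> B \<in> F t"
  using sets.Int[of A "Nt t" B] by (simp add: sets_Nt)

text \<open>The terminal function may change with the grid index. This admits Bellman iterates,
  whose number of remaining steps decreases along the grid.\<close>

lemma grid_gain_telescope:
  assumes "\<kappa> \<omega> \<le> m" "\<omega> \<in> space M"
  shows "gain k (u (\<kappa> \<omega>)) (c + real (\<kappa> \<omega>) * a) \<omega> = gain k (u 0) c \<omega> + (\<Sum>j<m. indicator {\<omega> \<in> space M. j < \<kappa> \<omega>} \<omega>
    * (gain k (u (Suc j)) (c + real (Suc j) * a) \<omega> - gain k (u j) (c + real j * a) \<omega>))"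
proof -
  let ?g = "\<lambda>j. gain k (u j) (c + real j * a) \<omega>"
  have "(\<Sum>j<m. indicator {\<omega> \<in> space M. j < \<kappa> \<omega>} \<omega> * (?g (Suc j) - ?g j))
      = (\<Sum>j<m. if j < \<kappa> \<omega> then ?g (Suc j) - ?g j else 0)"
    using assms(2) by (intro sum.cong) auto
  then show ?thesis
    using telescope_upto[OF assms(1), of ?g] by (simp del: of_nat_Suc)
qed

lemma grid_gain_measurable:
  assumes c: "0 \<le> c" and a: "0 \<le> a" and k: "cbf k" and u: "\<And>j. bmf (u j)"
    and \<kappa>: "\<And>j. j < m \<Longrightarrow> {\<omega> \<in> space M. j < \<kappa> \<omega>} \<in> F (c + real j * a)"
    and \<kappa>_le: "\<And>\<omega>. \<omega> \<in> space M \<Longrightarrow> \<kappa> \<omega> \<le> m"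
  shows "(\<lambda>\<omega>. gain k (u (\<kappa> \<omega>)) (c + real (\<kappa> \<omega>) * a) \<omega>) \<in> borel_measurable M"
proof (rule measurable_cong[THEN iffD2])
  show "gain k (u (\<kappa> \<omega>)) (c + real (\<kappa> \<omega>) * a) \<omega> = gain k (u 0) c \<omega> + (\<Sum>j<m. indicator {\<omega> \<in> space M. j < \<kappa> \<omega>} \<omega>
    * (gain k (u (Suc j)) (c + real (Suc j) * a) \<omega> - gain k (u j) (c + real j * a) \<omega>))"
    if "\<omega> \<in> space M" for \<omega>
    by (rule grid_gain_telescope[where \<kappa>=\<kappa>, OF \<kappa>_le[OF that] that])
  have t: "0 \<le> c + real j * a" for j using c a by auto
  have "{\<omega> \<in> space M. j < \<kappa> \<omega>} \<in> sets M" if "j < m" for j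
    using \<kappa>[OF that] F_sub[OF t] by auto
  then show "(\<lambda>\<omega>. gain k (u 0) c \<omega> + (\<Sum>j<m. indicator {\<omega> \<in> space M. j < \<kappa> \<omega>} \<omega>
    * (gain k (u (Suc j)) (c + real (Suc j) * a) \<omega> - gain k (u j) (c + real j * a) \<omega>))) \<in> borel_measurable M"
    by (intro borel_measurable_add gain_measurable t c k u borel_measurable_sum borel_measurable_times
        borel_measurable_diff borel_measurable_indicator) simp
qed

text \<open>Whether step \<open>j\<close> is taken is known at the beginning of that step, so the
  one-step inequality makes each switched increment nonpositive in mean. Restriction to
  \<open>A\<close> in \<open>F c\<close> gives the conditional form at time
  \<open>c\<close>.\<close>

lemma grid_supermartingale:
  assumes c: "0 \<le> c" and a: "0 \<le> a" and k: "cbf k" and u: "\<And>j. bmf (u j)"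
    and super: "\<And>j y. j < m \<Longrightarrow> Gop k (u (Suc j)) a y \<le> u j y"
    and A: "A \<in> F c" and \<kappa>: "\<And>j. j < m \<Longrightarrow> {\<omega> \<in> space M. j < \<kappa> \<omega>} \<in> F (c + real j * a)"
    and \<kappa>_le: "\<And>\<omega>. \<omega> \<in> space M \<Longrightarrow> \<kappa> \<omega> \<le> m"
  shows "(\<integral>\<omega>. indicator A \<omega> * gain k (u (\<kappa> \<omega>)) (c + real (\<kappa> \<omega>) * a) \<omega> \<partial>P x)
      \<le> (\<integral>\<omega>. indicator A \<omega> * gain k (u 0) c \<omega> \<partial>P x)"
proof -
  let ?g = "\<lambda>j. gain k (u j) (c + real j * a)"
  let ?B = "\<lambda>j. {\<omega> \<in> space M. j < \<kappa> \<omega>}"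
  have t: "0 \<le> c + real j * a" "c \<le> c + real j * a" for j using c a by auto
  have tele: "?g (\<kappa> \<omega>) \<omega> = ?g 0 \<omega> + (\<Sum>j<m. indicator (?B j) \<omega> * (?g (Suc j) \<omega> - ?g j \<omega>))"
    if "\<omega> \<in> space M" for \<omega>
    using grid_gain_telescope[where \<kappa>=\<kappa> and k=k and u=u and c=c and a=a, OF \<kappa>_le[OF that] that] by simp
  have AB: "A \<inter> ?B j \<in> F (c + real j * a)" if "j < m" for j
    using F_mono[OF c t(2)[of j]] A by (intro F_Int t \<kappa> that) auto
  have AB': "A \<inter> ?B j \<in> F (c + real (Suc j) * a)" if "j < m" for j
    using AB[OF that] F_mono[OF t(1)[of j], of "c + real (Suc j) * a"] a
    by (auto simp: mult_right_mono)
  have int: "integrable (P x) (\<lambda>\<omega>. indicator (A \<inter> ?B j) \<omega> * ?g (Suc j) \<omega>)"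
    "integrable (P x) (\<lambda>\<omega>. indicator (A \<inter> ?B j) \<omega> * ?g j \<omega>)" if "j < m" for j
    using AB[OF that] AB'[OF that] t u k by (auto intro!: indicator_gain_integrable simp del: of_nat_Suc)
  have int0: "integrable (P x) (\<lambda>\<omega>. indicator A \<omega> * ?g 0 \<omega>)"
    using A c u k by (intro indicator_gain_integrable[where t=c]) auto
  have step: "(\<integral>\<omega>. indicator (A \<inter> ?B j) \<omega> * ?g (Suc j) \<omega> \<partial>P x)
      \<le> (\<integral>\<omega>. indicator (A \<inter> ?B j) \<omega> * ?g j \<omega> \<partial>P x)" if "j < m" for j
  proof -
    have e: "c + real (Suc j) * a = (c + real j * a) + a" by (simp add: algebra_simps)
    have "(\<integral>\<omega>. indicator (A \<inter> ?B j) \<omega> * ?g (Suc j) \<omega> \<partial>P x)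
        = (\<integral>\<omega>. indicator (A \<inter> ?B j) \<omega> * gain k (Gop k (u (Suc j)) a) (c + real j * a) \<omega> \<partial>P x)"
      unfolding e by (rule markov_gain[OF t(1) a AB[OF that] k u])
    also have "\<dots> \<le> (\<integral>\<omega>. indicator (A \<inter> ?B j) \<omega> * ?g j \<omega> \<partial>P x)"
      by (intro integral_mono int(2)[OF that] indicator_gain_integrable[OF t(1) order_refl AB[OF that] k]
          mult_left_mono gain_mono super that Gop_bmf a k u) auto
    finally show ?thesis .
  qed
  have "(\<integral>\<omega>. indicator A \<omega> * ?g (\<kappa> \<omega>) \<omega> \<partial>P x)
      = (\<integral>\<omega>. indicator A \<omega> * ?g 0 \<omega> + (\<Sum>j<m. indicator (A \<inter> ?B j) \<omega> * ?g (Suc j) \<omega> - indicator (A \<inter> ?B j) \<omega> * ?g j \<omega>) \<partial>P x)"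
  proof (intro Bochner_Integration.integral_cong refl)
    fix \<omega> assume "\<omega> \<in> space (P x)"
    then have "indicator A \<omega> * ?g (\<kappa> \<omega>) \<omega>
        = indicator A \<omega> * (?g 0 \<omega> + (\<Sum>j<m. indicator (?B j) \<omega> * (?g (Suc j) \<omega> - ?g j \<omega>)))"
      using tele by simp
    also have "\<dots> = indicator A \<omega> * ?g 0 \<omega> + (\<Sum>j<m. indicator A \<omega> * (indicator (?B j) \<omega> * (?g (Suc j) \<omega> - ?g j \<omega>)))"
      by (simp only: distrib_left sum_distrib_left)
    also have "\<dots> = indicator A \<omega> * ?g 0 \<omega> + (\<Sum>j<m. indicator (A \<inter> ?B j) \<omega> * ?g (Suc j) \<omega> - indicator (A \<inter> ?B j) \<omega> * ?g j \<omega>)"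
      by (simp only: indicator_inter_arith mult.assoc right_diff_distrib)
    finally show "indicator A \<omega> * ?g (\<kappa> \<omega>) \<omega> = \<dots>" .
  qed
  also have "\<dots> = (\<integral>\<omega>. indicator A \<omega> * ?g 0 \<omega> \<partial>P x) + (\<Sum>j<m.
      (\<integral>\<omega>. indicator (A \<inter> ?B j) \<omega> * ?g (Suc j) \<omega> \<partial>P x) - (\<integral>\<omega>. indicator (A \<inter> ?B j) \<omega> * ?g j \<omega> \<partial>P x))"
    using int int0
    by (subst Bochner_Integration.integral_add)
       (auto intro!: Bochner_Integration.integrable_sum Bochner_Integration.integrable_diff
         simp: Bochner_Integration.integral_sum Bochner_Integration.integral_diff simp del: of_nat_Suc)
  also have "\<dots> \<le> (\<integral>\<omega>. indicator A \<omega> * ?g 0 \<omega> \<partial>P x)"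
  proof -
    have "(\<Sum>j<m. (\<integral>\<omega>. indicator (A \<inter> ?B j) \<omega> * ?g (Suc j) \<omega> \<partial>P x)
        - (\<integral>\<omega>. indicator (A \<inter> ?B j) \<omega> * ?g j \<omega> \<partial>P x)) \<le> 0"
      by (rule sum_nonpos) (use step in auto)
    then show ?thesis by linarith
  qed
  finally show "(\<integral>\<omega>. indicator A \<omega> * ?g (\<kappa> \<omega>) \<omega> \<partial>P x) \<le> (\<integral>\<omega>. indicator A \<omega> * gain k (u 0) c \<omega> \<partial>P x)"
    by simp
qed

section \<open>Optional stopping\<close>

text \<open>Real-valued stopping times with a deterministic bound. The range condition is imposed at
  every point, also outside \<open>space M\<close>, which spares side conditions later.\<close>

definition bounded_stop :: "real \<Rightarrow> ('w \<Rightarrow> real) \<Rightarrow> bool" where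
  "bounded_stop N \<rho> \<longleftrightarrow> (\<forall>\<omega>. 0 \<le> \<rho> \<omega> \<and> \<rho> \<omega> \<le> N) \<and> (\<forall>t\<ge>0. {\<omega> \<in> space M. \<rho> \<omega> \<le> t} \<in> F t)"

lemma F_space: "0 \<le> t \<Longrightarrow> space M \<in> F t"
  using sets.top[of "Nt t"] by (simp add: sets_Nt)

lemma F_empty: "0 \<le> t \<Longrightarrow> {} \<in> F t"
  using sets.empty_sets[of "Nt t"] by (simp add: sets_Nt)

lemma F_Un: "0 \<le> t \<Longrightarrow> A \<in> F t \<Longrightarrow> B \<in> F t \<Longrightarrow> A \<union> B \<in> F t"
  using sets.Un[of A "Nt t" B] by (simp add: sets_Nt)

lemma F_Diff: "0 \<le> t \<Longrightarrow> A \<in> F t \<Longrightarrow> B \<in> F t \<Longrightarrow> A - B \<in> F t"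
  using sets.Diff[of A "Nt t" B] by (simp add: sets_Nt)

lemma F_UN: "0 \<le> t \<Longrightarrow> (\<And>n::nat. B n \<in> F t) \<Longrightarrow> (\<Union>n. B n) \<in> F t"
  using sets.countable_UN[of B UNIV "Nt t"] by (auto simp: sets_Nt)

lemma bounded_stop_range: "bounded_stop N \<rho> \<Longrightarrow> 0 \<le> \<rho> \<omega>" "bounded_stop N \<rho> \<Longrightarrow> \<rho> \<omega> \<le> N"
  by (auto simp: bounded_stop_def)

lemma bounded_stop_le: "bounded_stop N \<rho> \<Longrightarrow> 0 \<le> t \<Longrightarrow> {\<omega> \<in> space M. \<rho> \<omega> \<le> t} \<in> F t"
  by (auto simp: bounded_stop_def)

lemma bounded_stop_gt:
  assumes "bounded_stop N \<rho>" "0 \<le> t"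
  shows "{\<omega> \<in> space M. t < \<rho> \<omega>} \<in> F t"
proof -
  have "{\<omega> \<in> space M. t < \<rho> \<omega>} = space M - {\<omega> \<in> space M. \<rho> \<omega> \<le> t}" by auto
  then show ?thesis using F_Diff[OF assms(2) F_space bounded_stop_le[OF assms]] assms(2) by simp
qed

lemma bounded_stop_ge:
  assumes \<rho>: "bounded_stop N \<rho>" and t: "0 < t"
  shows "{\<omega> \<in> space M. t \<le> \<rho> \<omega>} \<in> F t"
proof -
  \<comment> \<open>The event \<open>\<rho> < t\<close> is the union of the events
    \<open>\<rho> \<le> s\<close> over times \<open>s\<close> approaching \<open>t\<close> from
    below, each of which lies in \<open>F t\<close>. Cutting off at 0 keeps the indices of
    \<open>F\<close> nonnegative.\<close>
  let ?s = "\<lambda>n. max 0 (t - inverse (real (Suc n)))"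
  have "(\<lambda>n. t - inverse (real (Suc n))) \<longlonglongrightarrow> t - 0"
    by (intro tendsto_intros LIMSEQ_inverse_real_of_nat)
  then have lim: "(\<lambda>n. t - inverse (real (Suc n))) \<longlonglongrightarrow> t" by simp
  have "{\<omega> \<in> space M. \<rho> \<omega> < t} = (\<Union>n. {\<omega> \<in> space M. \<rho> \<omega> \<le> ?s n})"
  proof (intro equalityI subsetI)
    fix \<omega> assume \<omega>: "\<omega> \<in> {\<omega> \<in> space M. \<rho> \<omega> < t}"
    then have "eventually (\<lambda>n. \<rho> \<omega> < t - inverse (real (Suc n))) sequentially"
      using order_tendstoD(1)[OF lim] by auto
    then obtain n where "\<rho> \<omega> < t - inverse (real (Suc n))"
      by (auto simp: eventually_sequentially)
    then show "\<omega> \<in> (\<Union>n. {\<omega> \<in> space M. \<rho> \<omega> \<le> ?s n})"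
      using \<omega> by (intro UN_I[of n]) auto
  next
    fix \<omega> assume "\<omega> \<in> (\<Union>n. {\<omega> \<in> space M. \<rho> \<omega> \<le> ?s n})"
    then obtain n where \<omega>: "\<omega> \<in> space M" "\<rho> \<omega> \<le> ?s n" by auto
    have "?s n < t" using t by simp
    with \<omega> show "\<omega> \<in> {\<omega> \<in> space M. \<rho> \<omega> < t}" using order.strict_trans1[of "\<rho> \<omega>" "?s n" t] by blast
  qed
  moreover have "{\<omega> \<in> space M. \<rho> \<omega> \<le> ?s n} \<in> F t" for n
    using bounded_stop_le[OF \<rho>, of "?s n"] F_mono[of "?s n" t] t by auto
  ultimately have "{\<omega> \<in> space M. \<rho> \<omega> < t} \<in> F t"
    using F_UN[of t "\<lambda>n. {\<omega> \<in> space M. \<rho> \<omega> \<le> ?s n}"] t by simp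
  moreover have "{\<omega> \<in> space M. t \<le> \<rho> \<omega>} = space M - {\<omega> \<in> space M. \<rho> \<omega> < t}" by auto
  ultimately show ?thesis using F_Diff[OF _ F_space] t by simp
qed

lemma bounded_stop_const: "0 \<le> h \<Longrightarrow> bounded_stop h (\<lambda>_. h)"
proof -
  assume h: "0 \<le> h"
  have "{\<omega> \<in> space M. h \<le> t} = (if h \<le> t then space M else {})" for t by auto
  then show ?thesis using h by (simp add: bounded_stop_def F_space F_empty)
qed

lemma bounded_stop_min:
  assumes "bounded_stop N \<rho>" "0 \<le> h"
  shows "bounded_stop h (\<lambda>\<omega>. min (\<rho> \<omega>) h)"
  unfolding bounded_stop_def
proof (intro conjI allI impI)
  fix t :: real assume t: "0 \<le> t"
  have "{\<omega> \<in> space M. min (\<rho> \<omega>) h \<le> t} = (if h \<le> t then space M else {\<omega> \<in> space M. \<rho> \<omega> \<le> t})"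
    by (auto simp: min_le_iff_disj)
  then show "{\<omega> \<in> space M. min (\<rho> \<omega>) h \<le> t} \<in> F t"
    using F_space[OF t] bounded_stop_le[OF assms(1) t] by simp
qed (use assms bounded_stop_range in auto)

lemma bounded_stop_max:
  assumes "bounded_stop N \<rho>" "0 \<le> h"
  shows "bounded_stop (max N h) (\<lambda>\<omega>. max (\<rho> \<omega>) h)"
  unfolding bounded_stop_def
proof (intro conjI allI impI)
  fix t :: real assume t: "0 \<le> t"
  have "{\<omega> \<in> space M. max (\<rho> \<omega>) h \<le> t} = (if h \<le> t then {\<omega> \<in> space M. \<rho> \<omega> \<le> t} else {})"
    by auto
  then show "{\<omega> \<in> space M. max (\<rho> \<omega>) h \<le> t} \<in> F t"
    using F_empty[OF t] bounded_stop_le[OF assms(1) t] by simp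
next
  show "max (\<rho> \<omega>) h \<le> max N h" for \<omega>
    using bounded_stop_range(2)[OF assms(1)] by (intro max.mono) auto
qed (use assms(2) in \<open>simp add: le_max_iff_disj\<close>)

section \<open>Approximation of stopping times from above by grid times\<close>

definition grid_index :: "real \<Rightarrow> real \<Rightarrow> ('w \<Rightarrow> real) \<Rightarrow> 'w \<Rightarrow> nat" where
  "grid_index c a \<rho> \<omega> = nat \<lceil>(\<rho> \<omega> - c) / a\<rceil>"

text \<open>Since rounding is upwards, the index exceeds \<open>j\<close> exactly when the time lies
  strictly beyond the \<open>j\<close>-th node, an event decided at that node. The truncation by
  \<open>nat\<close> yields index 0 when the time is at most \<open>c\<close>.\<close>

lemma less_grid_index: "0 < a \<Longrightarrow> j < grid_index c a \<rho> \<omega> \<longleftrightarrow> c + real j * a < \<rho> \<omega>"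
proof -
  assume a: "0 < a"
  have "j < grid_index c a \<rho> \<omega> \<longleftrightarrow> int j < \<lceil>(\<rho> \<omega> - c) / a\<rceil>"
    unfolding grid_index_def by linarith
  also have "\<dots> \<longleftrightarrow> real j < (\<rho> \<omega> - c) / a" by (simp add: less_ceiling_iff)
  also have "\<dots> \<longleftrightarrow> c + real j * a < \<rho> \<omega>" using a by (auto simp: less_divide_eq)
  finally show ?thesis .
qed

lemma grid_index_F:
  assumes "bounded_stop N \<rho>" "0 \<le> c" "0 < a"
  shows "{\<omega> \<in> space M. j < grid_index c a \<rho> \<omega>} \<in> F (c + real j * a)"
  using bounded_stop_gt[OF assms(1), of "c + real j * a"] assms by (simp add: less_grid_index)

lemma grid_index_le:
  assumes "0 < a" "\<rho> \<omega> \<le> c + real m * a"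
  shows "grid_index c a \<rho> \<omega> \<le> m"
  using less_grid_index[OF assms(1), of m c \<rho> \<omega>] assms(2) by linarith

lemma grid_index_ge: "0 < a \<Longrightarrow> \<rho> \<omega> \<le> c + real (grid_index c a \<rho> \<omega>) * a"
  using less_grid_index[of a "grid_index c a \<rho> \<omega>" c \<rho> \<omega>] by simp

lemma grid_index_upper:
  assumes a: "0 < a" and "c \<le> \<rho> \<omega>"
  shows "c + real (grid_index c a \<rho> \<omega>) * a \<le> \<rho> \<omega> + a"
proof (cases "grid_index c a \<rho> \<omega>")
  case (Suc j)
  then have "c + real j * a < \<rho> \<omega>" using less_grid_index[OF a, of j c \<rho> \<omega>] by simp
  then show ?thesis unfolding Suc by (simp add: algebra_simps)
qed (use assms in simp)

lemma gain_right_cont: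
  assumes "\<omega> \<in> space M" "cbf k" "cbf u"
  shows "right_cont (\<lambda>t. gain k u t \<omega>)"
proof -
  obtain L where L: "\<And>y. \<bar>k y\<bar> \<le> L" using assms(2) by (metis cbf_bound)
  have 1: "right_cont (\<lambda>t. cost k 0 t \<omega>)"
    unfolding cost_def
    by (rule bounded_right_cont.set_integral_right_cont[OF cost_path[OF assms(1) order_refl assms(2) L]])
  have 2: "right_cont (\<lambda>t. disc 0 t \<omega> * u (X t \<omega>))"
    using assms(3) by (intro right_cont_mult disc_right_cont right_cont_compose[of "\<lambda>t. X t \<omega>" u] paths assms)
      (auto simp: cbf_def)
  show ?thesis
    using 1 2 unfolding right_cont_def gain_def by (auto intro!: tendsto_add)
qed

context
  fixes N c :: real and \<rho> :: "'w \<Rightarrow> real" and k u :: "'e \<Rightarrow> real"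
  assumes \<rho>: "bounded_stop N \<rho>" and c: "0 \<le> c" and c_le: "\<And>\<omega>. \<omega> \<in> space M \<Longrightarrow> c \<le> \<rho> \<omega>"
    and k: "cbf k" and u: "cbf u"
begin

text \<open>The rounded times lie above \<open>\<rho>\<close> and within \<open>1 / (n + 1)\<close>
  of it, so right continuity of the gain process applies.\<close>

definition approx :: "nat \<Rightarrow> 'w \<Rightarrow> real" where
  "approx n \<omega> = gain k u (c + real (grid_index c (1 / Suc n) \<rho> \<omega>) * (1 / Suc n)) \<omega>"

lemma grid_index_bound: "\<omega> \<in> space M \<Longrightarrow> grid_index c (1 / Suc n) \<rho> \<omega> \<le> nat \<lceil>N\<rceil> * Suc n"
proof (rule grid_index_le)
  have "\<rho> \<omega> \<le> N" by (rule bounded_stop_range(2)[OF \<rho>])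
  also have "N \<le> real (nat \<lceil>N\<rceil>)" by linarith
  also have "\<dots> = real (nat \<lceil>N\<rceil> * Suc n) * (1 / Suc n)"
    unfolding of_nat_mult mult.assoc by (simp del: of_nat_Suc)
  finally show "\<rho> \<omega> \<le> c + real (nat \<lceil>N\<rceil> * Suc n) * (1 / Suc n)" using c by linarith
qed simp

lemma approx_measurable: "approx n \<in> borel_measurable M"
  unfolding approx_def
  by (rule grid_gain_measurable[where u="\<lambda>_. u", OF c _ k cbf_bmf[OF u] grid_index_F[OF \<rho> c] grid_index_bound]) simp_all

lemma approx_LIMSEQ:
  assumes \<omega>: "\<omega> \<in> space M"
  shows "(\<lambda>n. approx n \<omega>) \<longlonglongrightarrow> gain k u (\<rho> \<omega>) \<omega>"
  unfolding approx_def
proof (rule right_cont_LIMSEQ[OF gain_right_cont[OF \<omega> k u] bounded_stop_range(1)[OF \<rho>]])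
  let ?t = "\<lambda>n. c + real (grid_index c (1 / Suc n) \<rho> \<omega>) * (1 / Suc n)"
  have "(\<lambda>n. \<rho> \<omega> + inverse (real (Suc n))) \<longlonglongrightarrow> \<rho> \<omega> + 0"
    by (intro tendsto_intros LIMSEQ_inverse_real_of_nat)
  then have *: "(\<lambda>n. \<rho> \<omega> + inverse (real (Suc n))) \<longlonglongrightarrow> \<rho> \<omega>" by simp
  show ge: "\<rho> \<omega> \<le> ?t n" for n by (rule grid_index_ge) simp
  have le: "?t n \<le> \<rho> \<omega> + inverse (real (Suc n))" for n
    using grid_index_upper[of "1 / Suc n" c \<rho> \<omega>, OF _ c_le[OF \<omega>]] by (simp add: inverse_eq_divide)
  show "?t \<longlonglongrightarrow> \<rho> \<omega>"
    by (rule tendsto_sandwich[OF _ _ tendsto_const *]) (use ge le in auto)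
qed

lemma approx_bound: "\<exists>B. \<forall>n. \<forall>\<omega>\<in>space M. \<bar>approx n \<omega>\<bar> \<le> B"
proof -
  obtain L where L: "0 < L" "\<And>y. \<bar>k y\<bar> \<le> L" using k by (metis cbf_bound)
  obtain U where U: "\<And>y. \<bar>u y\<bar> \<le> U" using u by (metis cbf_bound)
  have "\<bar>approx n \<omega>\<bar> \<le> L * (N + 1) + U" if \<omega>: "\<omega> \<in> space M" for n \<omega>
  proof -
    let ?t = "c + real (grid_index c (1 / Suc n) \<rho> \<omega>) * (1 / Suc n)"
    \<comment> \<open>The overshoot from rounding is at most 1 for every mesh, whence the uniform
      horizon \<open>N + 1\<close>.\<close>
    have "?t \<le> \<rho> \<omega> + 1 / Suc n" by (rule grid_index_upper) (auto intro: c_le \<omega>)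
    also have "\<dots> \<le> N + 1" using bounded_stop_range(2)[OF \<rho>, of \<omega>] by (intro add_mono) auto
    finally have t: "?t \<le> N + 1" .
    have "\<bar>approx n \<omega>\<bar> \<le> L * ?t + U"
      unfolding approx_def by (rule gain_bound[OF \<omega> _ k L(2) U]) (use c in simp)
    also have "\<dots> \<le> L * (N + 1) + U" using t L(1) by (intro add_right_mono mult_left_mono) auto
    finally show ?thesis .
  qed
  then show ?thesis by blast
qed

lemma stopped_gain_measurable: "(\<lambda>\<omega>. gain k u (\<rho> \<omega>) \<omega>) \<in> borel_measurable M"
  by (rule borel_measurable_LIMSEQ_real[OF approx_LIMSEQ approx_measurable])

lemma stopped_gain_integrable:
  assumes "A \<in> sets M"
  shows "integrable (P x) (\<lambda>\<omega>. indicator A \<omega> * gain k u (\<rho> \<omega>) \<omega>)"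
proof -
  obtain B where B: "\<And>n \<omega>. \<omega> \<in> space M \<Longrightarrow> \<bar>approx n \<omega>\<bar> \<le> B" using approx_bound by blast
  have "\<bar>gain k u (\<rho> \<omega>) \<omega>\<bar> \<le> B" if "\<omega> \<in> space M" for \<omega>
    by (rule LIMSEQ_le_const2[OF tendsto_rabs[OF approx_LIMSEQ[OF that]]]) (use B that in auto)
  then have "\<bar>indicator A \<omega> * gain k u (\<rho> \<omega>) \<omega>\<bar> \<le> B" if "\<omega> \<in> space M" for \<omega>
    using that abs_ge_zero[of "gain k u (\<rho> \<omega>) \<omega>"] by (fastforce simp: indicator_def)
  then show ?thesis
    using assms by (intro integrable_bounded borel_measurable_times stopped_gain_measurable borel_measurable_indicator)
qed

lemma stopped_gain_LIMSEQ:
  assumes "A \<in> sets M"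
  shows "(\<lambda>n. \<integral>\<omega>. indicator A \<omega> * approx n \<omega> \<partial>P x) \<longlonglongrightarrow> (\<integral>\<omega>. indicator A \<omega> * gain k u (\<rho> \<omega>) \<omega> \<partial>P x)"
proof -
  obtain B where B: "\<And>n \<omega>. \<omega> \<in> space M \<Longrightarrow> \<bar>approx n \<omega>\<bar> \<le> B" using approx_bound by blast
  show ?thesis
  proof (rule expectation_LIMSEQ[where K=B])
    show "(\<lambda>\<omega>. indicator A \<omega> * approx n \<omega>) \<in> borel_measurable M" for n
      by (intro borel_measurable_times approx_measurable borel_measurable_indicator assms)
    show "(\<lambda>n. indicator A \<omega> * approx n \<omega>) \<longlonglongrightarrow> indicator A \<omega> * gain k u (\<rho> \<omega>) \<omega>" if "\<omega> \<in> space M" for \<omega>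
      by (intro tendsto_intros approx_LIMSEQ that)
    show "\<bar>indicator A \<omega> * approx n \<omega>\<bar> \<le> B" if "\<omega> \<in> space M" for n \<omega>
      using B[OF that, of n] by (auto simp: indicator_def)
  qed
qed

text \<open>Limit of the grid version with a terminal function that does not vary. As
  \<open>A\<close> ranges over \<open>F c\<close> it compares the stopped gain with the gain at
  \<open>c\<close> conditionally on \<open>F c\<close>, which is needed for stopping rules that
  survive past \<open>c\<close>.\<close>

lemma optional_stopping:
  assumes super: "\<And>a y. 0 < a \<Longrightarrow> Gop k u a y \<le> u y" and A: "A \<in> F c"
  shows "(\<integral>\<omega>. indicator A \<omega> * gain k u (\<rho> \<omega>) \<omega> \<partial>P x) \<le> (\<integral>\<omega>. indicator A \<omega> * gain k u c \<omega> \<partial>P x)"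
proof (rule LIMSEQ_le_const2[OF stopped_gain_LIMSEQ])
  show "A \<in> sets M" using A F_sub[OF c] by auto
  have "(\<integral>\<omega>. indicator A \<omega> * approx n \<omega> \<partial>P x) \<le> (\<integral>\<omega>. indicator A \<omega> * gain k u c \<omega> \<partial>P x)" for n
    unfolding approx_def
    by (rule grid_supermartingale[where u="\<lambda>_. u", OF c _ k cbf_bmf[OF u] super A grid_index_F[OF \<rho> c] grid_index_bound])
       simp_all
  then show "\<exists>n0. \<forall>n\<ge>n0. (\<integral>\<omega>. indicator A \<omega> * approx n \<omega> \<partial>P x) \<le> (\<integral>\<omega>. indicator A \<omega> * gain k u c \<omega> \<partial>P x)"
    by blast
qed

end

section \<open>The generator\<close>

lemma disc_0_0: "disc s 0 \<omega> = 1"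
proof -
  have "AE u in lborel. indicator {0..0::real} u *\<^sub>R r (X (s + u) \<omega>) = 0"
    using AE_lborel_singleton[of "0::real"] by eventually_elim auto
  then show ?thesis
    unfolding disc_def set_lebesgue_integral_def by (simp add: integral_eq_zero_AE)
qed

lemma rate_integral_bounds:
  assumes "\<omega> \<in> space M" "0 \<le> a"
  shows "0 \<le> alpha r X a \<omega>" "alpha r X a \<omega> \<le> R * a"
proof -
  show "0 \<le> alpha r X a \<omega>"
    unfolding alpha_def set_lebesgue_integral_def by (auto intro!: integral_nonneg_AE simp: r_nonneg)
  show "alpha r X a \<omega> \<le> R * a"
    using bounded_right_cont.set_integral_bound[OF rate_path[OF assms(1) order_refl] assms(2)]
    by (simp add: alpha_def)
qed

text \<open>To first order the exponential contributes \<open>- alpha / a\<close>, an average of the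
  rate that tends to its value at time 0; the quadratic remainder is at most \<open>R^2 a\<close>
  after division.\<close>

lemma disc_derivative:
  assumes "\<omega> \<in> space M"
  shows "((\<lambda>a. (disc 0 a \<omega> - 1) / a) \<longlongrightarrow> - r (X 0 \<omega>)) (at_right 0)"
proof -
  have "((\<lambda>a. alpha r X a \<omega> / a) \<longlongrightarrow> r (X 0 \<omega>)) (at_right 0)"
    using bounded_right_cont.set_integral_average[OF rate_path[OF assms order_refl]] by (simp add: alpha_def)
  moreover have "((\<lambda>a. (disc 0 a \<omega> - 1) / a + alpha r X a \<omega> / a) \<longlongrightarrow> 0) (at_right 0)"
  proof (rule Lim_null_comparison)
    have "norm ((disc 0 a \<omega> - 1) / a + alpha r X a \<omega> / a) \<le> R\<^sup>2 * a" if a: "0 < a" for a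
    proof -
      note A = rate_integral_bounds[OF assms less_imp_le[OF a]]
      have "\<bar>disc 0 a \<omega> - 1 + alpha r X a \<omega>\<bar> \<le> (alpha r X a \<omega>)\<^sup>2"
        unfolding disc_0 by (rule exp_minus_bounds[OF A(1)])
      also have "\<dots> \<le> (R * a)\<^sup>2" using A by (intro power_mono)
      finally have "\<bar>disc 0 a \<omega> - 1 + alpha r X a \<omega>\<bar> / a \<le> (R * a)\<^sup>2 / a"
        using a by (intro divide_right_mono) auto
      moreover have "(R * a)\<^sup>2 / a = R\<^sup>2 * a" using a by (simp add: power2_eq_square)
      moreover have "norm ((disc 0 a \<omega> - 1) / a + alpha r X a \<omega> / a) = \<bar>disc 0 a \<omega> - 1 + alpha r X a \<omega>\<bar> / a"
        using a by (simp add: add_divide_distrib[symmetric])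
      ultimately show ?thesis by simp
    qed
    then show "eventually (\<lambda>a. norm ((disc 0 a \<omega> - 1) / a + alpha r X a \<omega> / a) \<le> R\<^sup>2 * a) (at_right 0)"
      by (auto simp: eventually_at_filter)
    have "((\<lambda>a. R\<^sup>2 * a) \<longlongrightarrow> R\<^sup>2 * 0) (at_right (0::real))" by (intro tendsto_intros)
    then show "((\<lambda>a. R\<^sup>2 * a) \<longlongrightarrow> 0) (at_right (0::real))" by simp
  qed
  ultimately have "((\<lambda>a. ((disc 0 a \<omega> - 1) / a + alpha r X a \<omega> / a) - alpha r X a \<omega> / a) \<longlongrightarrow> 0 - r (X 0 \<omega>)) (at_right 0)"
    by (intro tendsto_diff)
  then show ?thesis by simp
qed

lemma disc_difference_bound:
  assumes "\<omega> \<in> space M" "0 < a"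
  shows "\<bar>(disc 0 a \<omega> - 1) / a\<bar> \<le> R"
proof -
  note A = rate_integral_bounds[OF assms(1) less_imp_le[OF assms(2)]]
  have "1 - alpha r X a \<omega> \<le> disc 0 a \<omega>"
    unfolding disc_0 using exp_ge_add_one_self[of "- alpha r X a \<omega>"] by simp
  then have "\<bar>disc 0 a \<omega> - 1\<bar> \<le> R * a" using A(2) disc_le_1[of 0 a \<omega>] by linarith
  then show ?thesis using assms(2) by (simp add: pos_divide_le_eq)
qed

section \<open>Difference quotients of the one-step operator\<close>

lemma gen_domE:
  assumes "\<psi> \<in> gen_dom P X"
  obtains h C where "cbf \<psi>" "cbf h" "0 \<le> C"
    "\<And>a y. 0 < a \<Longrightarrow> a \<le> 1 \<Longrightarrow> \<bar>(semigrp P X a \<psi> y - \<psi> y) / a\<bar> \<le> C"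
    "\<And>y. ((\<lambda>a. (semigrp P X a \<psi> y - \<psi> y) / a) \<longlongrightarrow> h y) (at_right 0)"
    "\<And>y. gen P X \<psi> y = h y"
proof -
  obtain h C where h: "\<psi> \<in> C0" "h \<in> C0" "\<And>a y. a \<in> {0<..1} \<Longrightarrow> \<bar>(semigrp P X a \<psi> y - \<psi> y) / a\<bar> \<le> C"
    and lim: "\<And>y. ((\<lambda>a. (semigrp P X a \<psi> y - \<psi> y) / a) \<longlongrightarrow> h y) (at_right 0)"
    using assms unfolding gen_dom_def by blast
  have "gen P X \<psi> y = h y" for y
    unfolding gen_def by (rule tendsto_Lim[OF _ lim]) simp
  moreover have "0 \<le> C" using h(3)[of 1 undefined] by simp
  ultimately show thesis using h lim by (intro that[of h C]) (auto simp: C0_def cbf_def)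
qed

text \<open>Pathwise, the quotient is the average of a right-continuous bounded function over a
  shrinking interval. The limit is taken along sequences, the setting of dominated
  convergence.\<close>

lemma cost_difference_LIMSEQ:
  assumes k: "cbf k" and a: "\<And>n. 0 < a n" "a \<longlonglongrightarrow> 0"
  shows "(\<lambda>n. running k (a n) x / a n) \<longlonglongrightarrow> k x"
proof -
  obtain L where L: "0 < L" "\<And>y. \<bar>k y\<bar> \<le> L" using k by (metis cbf_bound)
  have lim: "filterlim a (at_right 0) sequentially"
    by (rule filterlim_at_right_0_sequentially[OF a])
  have "(\<lambda>n. \<integral>\<omega>. cost k 0 (a n) \<omega> / a n \<partial>P x) \<longlonglongrightarrow> (\<integral>\<omega>. k (X 0 \<omega>) \<partial>P x)"
  proof (rule expectation_LIMSEQ[where K=L])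
    show "(\<lambda>\<omega>. cost k 0 (a n) \<omega> / a n) \<in> borel_measurable M" for n
      using weight_measurable[OF _ weight_cost[OF order_refl less_imp_le[OF a(1)] k]] less_imp_le[OF a(1)]
      by (intro borel_measurable_divide) auto
    fix \<omega> assume \<omega>: "\<omega> \<in> space M"
    have "((\<lambda>a. cost k 0 a \<omega> / a) \<longlongrightarrow> disc 0 0 \<omega> * k (X (0 + 0) \<omega>)) (at_right 0)"
      unfolding cost_def by (rule bounded_right_cont.set_integral_average[OF cost_path[OF \<omega> order_refl k L(2)]])
    then show "(\<lambda>n. cost k 0 (a n) \<omega> / a n) \<longlonglongrightarrow> k (X 0 \<omega>)"
      using filterlim_compose[OF _ lim] by (simp add: disc_0_0)
    show "\<bar>cost k 0 (a n) \<omega> / a n\<bar> \<le> L" for n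
      using cost_bound[OF \<omega> order_refl less_imp_le[OF a(1)] k L(2), of n] a(1)[of n] by (simp add: pos_divide_le_eq)
  qed
  then show ?thesis by (simp add: running_def expectation_start[OF cbf_bmf[OF k]])
qed

text \<open>Isolates the effect of discounting, so that the undiscounted quotient is left exactly as
  it appears in the definition of the generator.\<close>

lemma discount_difference_LIMSEQ:
  assumes \<psi>: "cbf \<psi>" and a: "\<And>n. 0 < a n" "a \<longlonglongrightarrow> 0"
  shows "(\<lambda>n. (fk (a n) \<psi> x - semigrp P X (a n) \<psi> x) / a n) \<longlonglongrightarrow> - (r x * \<psi> x)"
proof -
  obtain K where K: "0 < K" "\<And>y. \<bar>\<psi> y\<bar> \<le> K" using \<psi> by (metis cbf_bound)
  have lim: "filterlim a (at_right 0) sequentially"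
    by (rule filterlim_at_right_0_sequentially[OF a])
  have wd: "weight (a n) (disc 0 (a n))" "weight (a n) (\<lambda>\<omega>. \<psi> (X (a n) \<omega>))" for n
    using weight_disc[of 0 "a n"] a(1)[of n] weight_X[of "a n" "a n" \<psi>] cbf_bmf[OF \<psi>] by auto
  have br: "bmf r" using r_nonneg r_le by (intro bmfI[of _ R] borel_measurable_continuous_onI r_cont) auto
  have "(\<lambda>n. \<integral>\<omega>. (disc 0 (a n) \<omega> - 1) / a n * \<psi> (X (a n) \<omega>) \<partial>P x) \<longlonglongrightarrow> (\<integral>\<omega>. - r (X 0 \<omega>) * \<psi> (X 0 \<omega>) \<partial>P x)"
  proof (rule expectation_LIMSEQ[where K="R * K"])
    show "(\<lambda>\<omega>. (disc 0 (a n) \<omega> - 1) / a n * \<psi> (X (a n) \<omega>)) \<in> borel_measurable M" for n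
      using weight_measurable[OF less_imp_le[OF a(1)] wd(1)] weight_measurable[OF less_imp_le[OF a(1)] wd(2)]
      by (intro borel_measurable_times borel_measurable_divide borel_measurable_diff) auto
    fix \<omega> assume \<omega>: "\<omega> \<in> space M"
    have "right_cont (\<lambda>t. \<psi> (X t \<omega>))"
      using \<psi> by (intro right_cont_compose[of "\<lambda>t. X t \<omega>" \<psi>] paths \<omega>) (simp add: cbf_def)
    then have "(\<lambda>n. \<psi> (X (a n) \<omega>)) \<longlonglongrightarrow> \<psi> (X 0 \<omega>)"
      by (rule right_cont_LIMSEQ) (use a less_imp_le in auto)
    then show "(\<lambda>n. (disc 0 (a n) \<omega> - 1) / a n * \<psi> (X (a n) \<omega>)) \<longlonglongrightarrow> - r (X 0 \<omega>) * \<psi> (X 0 \<omega>)"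
      by (intro tendsto_mult filterlim_compose[OF disc_derivative[OF \<omega>] lim])
    show "\<bar>(disc 0 (a n) \<omega> - 1) / a n * \<psi> (X (a n) \<omega>)\<bar> \<le> R * K" for n
      unfolding abs_mult[of "_ / _"] using disc_difference_bound[OF \<omega> a(1)] K by (intro mult_mono) (auto simp: R_nonneg)
  qed
  also have "(\<integral>\<omega>. - r (X 0 \<omega>) * \<psi> (X 0 \<omega>) \<partial>P x) = - (r x * \<psi> x)"
    using expectation_start[OF bmf_mult[OF br cbf_bmf[OF \<psi>]], of x] by simp
  finally have 1: "(\<lambda>n. \<integral>\<omega>. (disc 0 (a n) \<omega> - 1) / a n * \<psi> (X (a n) \<omega>) \<partial>P x) \<longlonglongrightarrow> - (r x * \<psi> x)" .
  have "(fk (a n) \<psi> x - semigrp P X (a n) \<psi> x) / a n = (\<integral>\<omega>. (disc 0 (a n) \<omega> - 1) / a n * \<psi> (X (a n) \<omega>) \<partial>P x)" for n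
  proof -
    have "fk (a n) \<psi> x - semigrp P X (a n) \<psi> x = (\<integral>\<omega>. disc 0 (a n) \<omega> * \<psi> (X (a n) \<omega>) - \<psi> (X (a n) \<omega>) \<partial>P x)"
      unfolding fk_def semigrp_def
      by (intro Bochner_Integration.integral_diff[symmetric] weight_integrable[OF less_imp_le[OF a(1)[of n]]] weight_mult wd)
    also have "\<dots> / a n = (\<integral>\<omega>. (disc 0 (a n) \<omega> * \<psi> (X (a n) \<omega>) - \<psi> (X (a n) \<omega>)) / a n \<partial>P x)"
      by simp
    also have "\<dots> = (\<integral>\<omega>. (disc 0 (a n) \<omega> - 1) / a n * \<psi> (X (a n) \<omega>) \<partial>P x)"
      by (intro Bochner_Integration.integral_cong refl) (simp add: left_diff_distrib)
    finally show ?thesis .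
  qed
  with 1 show ?thesis by (simp only:)
qed

text \<open>The quotient is the sum of an undiscounted part, a discounting part and a running reward
  part, with limits \<open>h\<close>, \<open>- r x * \<psi> x\<close> and
  \<open>k x\<close>.\<close>

lemma Gop_derivative:
  assumes k: "cbf k" and \<psi>: "cbf \<psi>"
    and lim: "((\<lambda>a. (semigrp P X a \<psi> x - \<psi> x) / a) \<longlongrightarrow> h) (at_right 0)"
  shows "((\<lambda>a. (Gop k \<psi> a x - \<psi> x) / a) \<longlongrightarrow> h - r x * \<psi> x + k x) (at_right 0)"
  unfolding tendsto_at_iff_sequentially
proof (intro allI impI)
  fix a :: "nat \<Rightarrow> real" assume "\<forall>n. a n \<in> {0<..} - {0}" and a0: "a \<longlonglongrightarrow> 0"
  then have a: "0 < a n" for n by auto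
  have "(\<lambda>n. (semigrp P X (a n) \<psi> x - \<psi> x) / a n) \<longlonglongrightarrow> h"
    using lim a a0 unfolding tendsto_at_iff_sequentially o_def by auto
  from tendsto_add[OF tendsto_add[OF this discount_difference_LIMSEQ[OF \<psi> a a0]] cost_difference_LIMSEQ[OF k a a0]]
  have "(\<lambda>n. (semigrp P X (a n) \<psi> x - \<psi> x) / a n + (fk (a n) \<psi> x - semigrp P X (a n) \<psi> x) / a n
      + running k (a n) x / a n) \<longlonglongrightarrow> h - r x * \<psi> x + k x" by simp
  moreover have "(semigrp P X (a n) \<psi> x - \<psi> x) / a n + (fk (a n) \<psi> x - semigrp P X (a n) \<psi> x) / a n
      + running k (a n) x / a n = (Gop k \<psi> (a n) x - \<psi> x) / a n" for n
    unfolding Gop_def add_divide_distrib[symmetric] by simp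
  ultimately show "((\<lambda>a. (Gop k \<psi> a x - \<psi> x) / a) \<circ> a) \<longlonglongrightarrow> h - r x * \<psi> x + k x"
    by (simp add: o_def)
qed

lemma Gop_difference_bound:
  assumes k: "cbf k" and \<psi>: "cbf \<psi>"
    and C: "0 \<le> C" "\<And>a y. 0 < a \<Longrightarrow> a \<le> 1 \<Longrightarrow> \<bar>(semigrp P X a \<psi> y - \<psi> y) / a\<bar> \<le> C"
  shows "\<exists>B. \<forall>a>0. \<forall>y. \<bar>Gop k \<psi> a y - \<psi> y\<bar> \<le> B * a"
proof -
  obtain L where L: "0 < L" "\<And>y. \<bar>k y\<bar> \<le> L" using k by (metis cbf_bound)
  obtain K where K: "0 < K" "\<And>y. \<bar>\<psi> y\<bar> \<le> K" using \<psi> by (metis cbf_bound)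
  have "\<bar>Gop k \<psi> a y - \<psi> y\<bar> \<le> (L + C + R * K + 2 * K) * a" if a: "0 < a" for a y
  proof -
    have run: "\<bar>running k a y\<bar> \<le> L * a"
      unfolding running_def by (intro expectation_bound cost_bound k L less_imp_le a order_refl)
    show ?thesis
    proof (cases "a \<le> 1")
      case True
      have "\<bar>semigrp P X a \<psi> y - \<psi> y\<bar> \<le> C * a" using C(2)[OF a True, of y] a by (simp add: pos_divide_le_eq)
      moreover have "\<bar>fk a \<psi> y - semigrp P X a \<psi> y\<bar> \<le> R * a * K"
      proof -
        have wd: "weight a (disc 0 a)" "weight a (\<lambda>\<omega>. \<psi> (X a \<omega>))"
          using weight_disc[of 0 a] a weight_X[of a a \<psi>] cbf_bmf[OF \<psi>] by auto
        have "fk a \<psi> y - semigrp P X a \<psi> y = (\<integral>\<omega>. disc 0 a \<omega> * \<psi> (X a \<omega>) - \<psi> (X a \<omega>) \<partial>P y)"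
          unfolding fk_def semigrp_def
          by (intro Bochner_Integration.integral_diff[symmetric] weight_integrable[OF less_imp_le[OF a]] weight_mult wd)
        also have "\<bar>\<dots>\<bar> \<le> R * a * K"
        proof (rule expectation_bound)
          fix \<omega> assume \<omega>: "\<omega> \<in> space M"
          have "\<bar>disc 0 a \<omega> - 1\<bar> \<le> R * a"
            using disc_difference_bound[OF \<omega> a] a by (simp add: pos_divide_le_eq)
          then have "\<bar>disc 0 a \<omega> - 1\<bar> * \<bar>\<psi> (X a \<omega>)\<bar> \<le> R * a * K"
            using a R_nonneg by (intro mult_mono K) auto
          then show "\<bar>disc 0 a \<omega> * \<psi> (X a \<omega>) - \<psi> (X a \<omega>)\<bar> \<le> R * a * K"
            by (simp add: abs_mult[symmetric] left_diff_distrib)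
        qed
        finally show ?thesis .
      qed
      ultimately have "\<bar>Gop k \<psi> a y - \<psi> y\<bar> \<le> L * a + C * a + R * a * K"
        using run unfolding Gop_def by linarith
      also have "\<dots> \<le> (L + C + R * K + 2 * K) * a"
        using K(1) a by (simp add: algebra_simps)
      finally show ?thesis .
    next
      case False
      have "\<bar>fk a \<psi> y\<bar> \<le> K" by (rule fk_bound[OF K(2)])
      then have "\<bar>Gop k \<psi> a y - \<psi> y\<bar> \<le> L * a + 2 * K"
        using run K(2)[of y] unfolding Gop_def by linarith
      also have "\<dots> \<le> L * a + 2 * K * a" using False K(1) by simp
      also have "\<dots> \<le> (L + C + R * K + 2 * K) * a"
        using a C(1) R_nonneg K(1) by (simp add: algebra_simps)
      finally show ?thesis .
    qed
  qed
  then show ?thesis by blast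
qed

text \<open>The increment after time \<open>t\<close> is the image under \<open>fk t\<close> of the
  increment at time 0; bounds and right derivatives at 0 thereby propagate to every
  \<open>t\<close>.\<close>

lemma Gop_increment:
  assumes t: "0 \<le> t" and a: "0 \<le> a" and k: "cbf k" and u: "bmf u"
  shows "Gop k u (t + a) y - Gop k u t y = fk t (\<lambda>z. Gop k u a z - u z) y"
proof -
  have v: "bmf (Gop k u a)" by (rule Gop_bmf[OF a k u])
  have ind: "(\<integral>\<omega>. indicator (space M) \<omega> * Y \<omega> \<partial>P y) = (\<integral>\<omega>. Y \<omega> \<partial>P y)" for Y :: "_ \<Rightarrow> real"
    by (intro Bochner_Integration.integral_cong) auto
  have "Gop k u (t + a) y = (\<integral>\<omega>. gain k (Gop k u a) t \<omega> \<partial>P y)"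
    using markov_gain[OF t a F_space[OF t] k u, of y] Gop_expectation[of "t + a" k u y] t a k u by (simp add: ind)
  then have "Gop k u (t + a) y - Gop k u t y = (\<integral>\<omega>. gain k (Gop k u a) t \<omega> - gain k u t \<omega> \<partial>P y)"
    unfolding Gop_expectation[OF t k u]
    by (simp add: Bochner_Integration.integral_diff weight_integrable[OF t weight_gain[OF t order_refl k u]]
        weight_integrable[OF t weight_gain[OF t order_refl k v]])
  also have "\<dots> = fk t (\<lambda>z. Gop k u a z - u z) y"
    unfolding fk_def by (intro Bochner_Integration.integral_cong refl) (simp add: gain_def right_diff_distrib)
  finally show ?thesis .
qed

lemma Gop_0: "bmf u \<Longrightarrow> cbf k \<Longrightarrow> Gop k u 0 y = u y"
  by (simp add: Gop_expectation gain_0 expectation_start)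

text \<open>Dynkin's formula, as an inequality: only the right derivative of \<open>t \<mapsto> Gop k \<psi> t y\<close> is
  available, and it vanishes for this \<open>k\<close>.\<close>

lemma dynkin:
  assumes \<psi>: "cbf \<psi>" and h: "cbf h" and k: "cbf k"
    and C: "0 \<le> C" "\<And>a y. 0 < a \<Longrightarrow> a \<le> 1 \<Longrightarrow> \<bar>(semigrp P X a \<psi> y - \<psi> y) / a\<bar> \<le> C"
    and lim: "\<And>y. ((\<lambda>a. (semigrp P X a \<psi> y - \<psi> y) / a) \<longlongrightarrow> h y) (at_right 0)"
    and k_eq: "\<And>y. k y = r y * \<psi> y - h y" and T: "0 \<le> T"
  shows "Gop k \<psi> T y \<le> \<psi> y"
proof -
  have b\<psi>: "bmf \<psi>" by (rule cbf_bmf[OF \<psi>])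
  let ?\<theta> = "\<lambda>t. Gop k \<psi> t y"
  obtain B where B: "\<And>a y. 0 < a \<Longrightarrow> \<bar>Gop k \<psi> a y - \<psi> y\<bar> \<le> B * a"
    using Gop_difference_bound[OF k \<psi> C] by blast
  have B0: "0 \<le> B" using B[of 1 undefined] by simp
  have incr: "\<bar>?\<theta> (t + a) - ?\<theta> t\<bar> \<le> B * a" if "0 \<le> t" "0 < a" for t a
    unfolding Gop_increment[OF that(1) less_imp_le[OF that(2)] k b\<psi>] by (intro fk_bound B that)
  have lip: "\<bar>?\<theta> s - ?\<theta> t\<bar> \<le> B * \<bar>s - t\<bar>" if "0 \<le> s" "0 \<le> t" for s t
    using incr[of s "t - s"] incr[of t "s - t"] that by (cases s t rule: linorder_cases) auto
  \<comment> \<open>The Lipschitz bound supplies the continuity that \<open>right_decreasing\<close>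
    asks for.\<close>
  have "B-lipschitz_on {0..T} ?\<theta>"
    using lip B0 by (intro lipschitz_onI) (auto simp: dist_real_def)
  then have cont: "continuous_on {0..T} ?\<theta>" by (rule lipschitz_on_continuous_on)
  have "eventually (\<lambda>s. ?\<theta> s \<le> ?\<theta> t + \<epsilon> * (s - t)) (at_right t)" if \<epsilon>: "0 < \<epsilon>" and t: "0 \<le> t" for \<epsilon> t
  proof -
    \<comment> \<open>The right derivative at \<open>t\<close>: the quotient inside
      \<open>fk t\<close> is bounded by \<open>B\<close> and tends pointwise to
      \<open>h - r \<psi> + k\<close>, which is 0 by the choice of \<open>k\<close>.\<close>
    have "((\<lambda>a. fk t (\<lambda>z. Gop k \<psi> a z - \<psi> z) y / a) \<longlongrightarrow> 0) (at_right 0)"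
      unfolding tendsto_at_iff_sequentially
    proof (intro allI impI)
      fix a :: "nat \<Rightarrow> real" assume "\<forall>n. a n \<in> {0<..} - {0}" and a0: "a \<longlonglongrightarrow> 0"
      then have a: "0 < a n" for n by auto
      have bm: "bmf (Gop k \<psi> (a n))" for n by (rule Gop_bmf[OF less_imp_le[OF a] k b\<psi>])
      let ?D = "\<lambda>n \<omega>. disc 0 t \<omega> * ((Gop k \<psi> (a n) (X t \<omega>) - \<psi> (X t \<omega>)) / a n)"
      have D: "(\<lambda>n. \<integral>\<omega>. ?D n \<omega> \<partial>P y) \<longlonglongrightarrow> (\<integral>\<omega>. 0 \<partial>P y)"
      proof (rule expectation_LIMSEQ[where K="1 * B"])
        show "?D n \<in> borel_measurable M" for n
          using weight_measurable[OF _ weight_disc[of 0 t]] t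
            weight_measurable[OF t weight_X[OF t order_refl bm]] weight_measurable[OF t weight_X[OF t order_refl b\<psi>]]
          by (intro borel_measurable_times borel_measurable_divide borel_measurable_diff) auto
        fix \<omega>
        have "((\<lambda>a. (Gop k \<psi> a (X t \<omega>) - \<psi> (X t \<omega>)) / a) \<longlongrightarrow> 0) (at_right 0)"
          using Gop_derivative[OF k \<psi> lim, of "X t \<omega>"] by (simp add: k_eq)
        then have "(\<lambda>n. (Gop k \<psi> (a n) (X t \<omega>) - \<psi> (X t \<omega>)) / a n) \<longlonglongrightarrow> 0"
          using a a0 unfolding tendsto_at_iff_sequentially o_def by auto
        from tendsto_mult[OF tendsto_const this]
        show "(\<lambda>n. ?D n \<omega>) \<longlonglongrightarrow> 0" by simp
        have "\<bar>(Gop k \<psi> (a n) (X t \<omega>) - \<psi> (X t \<omega>)) / a n\<bar> \<le> B" for n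
          using B[OF a, of n "X t \<omega>"] a[of n] by (simp add: pos_divide_le_eq)
        then show "\<bar>?D n \<omega>\<bar> \<le> 1 * B" for n
          unfolding abs_mult by (intro mult_mono disc_abs_le) auto
      qed
      have "(\<integral>\<omega>. ?D n \<omega> \<partial>P y) = fk t (\<lambda>z. Gop k \<psi> (a n) z - \<psi> z) y / a n" for n
        unfolding fk_def times_divide_eq_right by (rule Bochner_Integration.integral_divide_zero)
      with D show "((\<lambda>a. fk t (\<lambda>z. Gop k \<psi> a z - \<psi> z) y / a) \<circ> a) \<longlonglongrightarrow> 0"
        by (simp only: o_def Bochner_Integration.integral_zero)
    qed
    then have "eventually (\<lambda>a. fk t (\<lambda>z. Gop k \<psi> a z - \<psi> z) y / a < \<epsilon>) (at_right 0)"
      using \<epsilon> by (rule order_tendstoD)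
    then obtain b where b: "0 < b" "\<And>a. 0 < a \<Longrightarrow> a < b \<Longrightarrow> fk t (\<lambda>z. Gop k \<psi> a z - \<psi> z) y / a < \<epsilon>"
      by (auto simp: eventually_at_right_field)
    have "?\<theta> s \<le> ?\<theta> t + \<epsilon> * (s - t)" if s: "t < s" "s < t + b" for s
    proof -
      have "?\<theta> s - ?\<theta> t = fk t (\<lambda>z. Gop k \<psi> (s - t) z - \<psi> z) y"
        using Gop_increment[OF t _ k b\<psi>, of "s - t" y] s by simp
      moreover have "fk t (\<lambda>z. Gop k \<psi> (s - t) z - \<psi> z) y < \<epsilon> * (s - t)"
        using b(2)[of "s - t"] s by (simp add: pos_divide_less_eq)
      ultimately show ?thesis by simp
    qed
    then show ?thesis using b(1) by (auto simp: eventually_at_right_field intro!: exI[of _ "t + b"])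
  qed
  then have "?\<theta> T \<le> ?\<theta> 0" by (intro right_decreasing T cont) auto
  then show ?thesis by (simp add: Gop_0[OF b\<psi> k])
qed

text \<open>Right continuity at 0 keeps almost every path near \<open>x\<close> for a positive
  random time; at the price of a small exceptional event this time is made deterministic. A fixed
  \<open>h\<close> is what makes the later loss uniform over stopping times.\<close>

lemma stays_near_start:
  assumes \<eta>: "0 < \<eta>" and \<epsilon>: "0 < \<epsilon>"
  obtains h A where "0 < h" "h \<le> 1" "A \<in> sets M" "1 - \<epsilon> \<le> measure (P x) A"
    "\<And>\<omega> s. \<omega> \<in> A \<Longrightarrow> 0 \<le> s \<Longrightarrow> s \<le> h \<Longrightarrow> X s \<omega> \<in> cball x \<eta>"
proof -
  interpret prob_space "P x" by (rule prob_space_P)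
  \<comment> \<open>Rational times make the event measurable. All other times follow by right
    continuity, because the complement of the closed ball is open.\<close>
  define Q where "Q n = \<rat> \<inter> {0<..<1 / real (Suc n)}" for n
  define A where "A n = {\<omega> \<in> space M. \<forall>q\<in>Q n. X q \<omega> \<in> cball x \<eta>}" for n
  have A: "A n \<in> sets M" for n
    unfolding A_def
  proof (rule sets.sets_Collect_countable_All')
    show "countable (Q n)" unfolding Q_def by (intro countable_Int1 countable_rat)
    fix q assume "q \<in> Q n"
    then have "X q \<in> measurable M borel" by (intro X_M) (auto simp: Q_def)
    then show "{\<omega> \<in> space M. X q \<omega> \<in> cball x \<eta>} \<in> sets M"
      by (rule measurable_sets_Collect) simp
  qed
  have near: "X s \<omega> \<in> cball x \<eta>" if \<omega>: "\<omega> \<in> A n" and s: "0 \<le> s" "s < 1 / real (Suc n)" for \<omega> s n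
  proof (rule ccontr)
    assume "X s \<omega> \<notin> cball x \<eta>"
    then have "X s \<omega> \<in> - cball x \<eta>" by simp
    moreover have "((\<lambda>t. X t \<omega>) \<longlongrightarrow> X s \<omega>) (at_right s)"
      using paths[of \<omega>] \<omega> s(1) by (simp add: A_def right_cont_def)
    ultimately have "eventually (\<lambda>t. X t \<omega> \<in> - cball x \<eta>) (at_right s)"
      by (intro topological_tendstoD) (auto intro: open_Compl)
    then obtain b where b: "s < b" "\<And>t. s < t \<Longrightarrow> t < b \<Longrightarrow> X t \<omega> \<notin> cball x \<eta>"
      by (auto simp: eventually_at_right_field)
    obtain q where q: "q \<in> \<rat>" "s < q" "q < min b (1 / real (Suc n))"
      using Rats_dense_in_real[of s "min b (1 / real (Suc n))"] b(1) s(2) by auto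
    then have "q \<in> Q n" using s(1) by (auto simp: Q_def)
    then show False using b(2)[of q] q \<omega> by (auto simp: A_def)
  qed
  have "incseq A"
  proof (rule incseq_SucI)
    fix n
    have "1 / real (Suc (Suc n)) \<le> 1 / real (Suc n)" by (intro divide_left_mono) auto
    then have "Q (Suc n) \<subseteq> Q n" unfolding Q_def by auto
    then show "A n \<subseteq> A (Suc n)" unfolding A_def by blast
  qed
  then have lim: "(\<lambda>n. measure (P x) (A n)) \<longlonglongrightarrow> measure (P x) (\<Union>n. A n)"
    using A by (intro finite_Lim_measure_incseq) auto
  have "AE \<omega> in P x. \<omega> \<in> (\<Union>n. A n)"
    using start[of x]
  proof (rule AE_mp, intro AE_I2 impI)
    fix \<omega> assume \<omega>: "\<omega> \<in> space (P x)" and 0: "X 0 \<omega> = x"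
    have "((\<lambda>t. X t \<omega>) \<longlongrightarrow> X 0 \<omega>) (at_right 0)"
      using paths[of \<omega>] \<omega> by (simp add: right_cont_def)
    then have "eventually (\<lambda>t. X t \<omega> \<in> ball x \<eta>) (at_right 0)"
      using \<eta> by (intro topological_tendstoD) (auto simp: 0)
    then obtain b where b: "0 < b" "\<And>t. 0 < t \<Longrightarrow> t < b \<Longrightarrow> X t \<omega> \<in> ball x \<eta>"
      by (auto simp: eventually_at_right_field)
    obtain n where n: "inverse (real (Suc n)) < b" using reals_Archimedean[OF b(1)] by blast
    have "X q \<omega> \<in> cball x \<eta>" if "q \<in> Q n" for q
      using b(2)[of q] that n by (auto simp: Q_def inverse_eq_divide less_imp_le)
    then show "\<omega> \<in> (\<Union>n. A n)" using \<omega> by (auto simp: A_def)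
  qed
  then have "measure (P x) (\<Union>n. A n) = 1"
    using A by (subst prob_eq_1) auto
  with lim have "(\<lambda>n. measure (P x) (A n)) \<longlonglongrightarrow> 1" by simp
  then have "eventually (\<lambda>n. 1 - \<epsilon> < measure (P x) (A n)) sequentially"
    using \<epsilon> by (intro order_tendstoD) auto
  then obtain n where n: "1 - \<epsilon> < measure (P x) (A n)" by (auto simp: eventually_sequentially)
  show thesis
  \<comment> \<open>Halving the window places the closed interval \<open>[0,h]\<close> strictly
    inside it.\<close>
  proof (rule that[of "1 / (2 * real (Suc n))" "A n"])
    have "1 / (2 * real (Suc n)) < 1 / real (Suc n)" by (intro divide_strict_left_mono) auto
    then show "X s \<omega> \<in> cball x \<eta>" if "\<omega> \<in> A n" "0 \<le> s" "s \<le> 1 / (2 * real (Suc n))" for \<omega> s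
      using that by (intro near[of \<omega> n]) auto
  qed (use A n in auto)
qed

lemma cost_diff:
  assumes \<omega>: "\<omega> \<in> space M" and s: "0 \<le> s" and "cbf k" "cbf l"
  shows "cost (\<lambda>y. k y - l y) s t \<omega> = cost k s t \<omega> - cost l s t \<omega>"
proof -
  obtain K where K: "\<And>y. \<bar>k y\<bar> \<le> K" using assms(3) by (metis cbf_bound)
  obtain L where L: "\<And>y. \<bar>l y\<bar> \<le> L" using assms(4) by (metis cbf_bound)
  show ?thesis
    unfolding cost_def right_diff_distrib
    by (rule set_integral_diff(2)[OF bounded_right_cont.set_integrable_Icc[OF cost_path[OF \<omega> s assms(3) K]]
          bounded_right_cont.set_integrable_Icc[OF cost_path[OF \<omega> s assms(4) L]]])
qed

text \<open>On a time interval of length at most 1 the discount factor is at least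
  \<open>exp (- R)\<close>.\<close>

lemma cost_lower:
  assumes \<omega>: "\<omega> \<in> space M" and t: "0 \<le> t" "t \<le> 1" and k: "cbf k" and c: "0 \<le> c"
    and lower: "\<And>s. 0 \<le> s \<Longrightarrow> s \<le> t \<Longrightarrow> c \<le> k (X s \<omega>)"
  shows "exp (- R) * c * t \<le> cost k 0 t \<omega>"
proof -
  obtain K where K: "\<And>y. \<bar>k y\<bar> \<le> K" using k by (metis cbf_bound)
  show ?thesis
    unfolding cost_def
  proof (rule bounded_right_cont.set_integral_lower[OF cost_path[OF \<omega> order_refl k K] t(1)])
    fix u assume u: "0 \<le> u" "u \<le> t"
    have "R * u \<le> R * 1" using R_nonneg u t by (intro mult_left_mono) auto
    then have "exp (- R) \<le> exp (- (R * u))" by simp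
    also have "\<dots> \<le> disc 0 u \<omega>" by (rule disc_ge[OF \<omega> order_refl u(1)])
    finally show "exp (- R) * c \<le> disc 0 u \<omega> * k (X (0 + u) \<omega>)"
      using lower[OF u] c less_imp_le[OF disc_pos] by (intro mult_mono) auto
  qed
qed

end

section \<open>The value function\<close>

locale stopping_problem = discounted_markov M F P X r R
  for M :: "'w measure" and F :: "real \<Rightarrow> 'w set set"
    and P :: "'e::{metric_space, second_countable_topology} \<Rightarrow> 'w measure"
    and X :: "real \<Rightarrow> 'w \<Rightarrow> 'e" and r :: "'e \<Rightarrow> real" and R :: real +
  fixes f g w :: "'e \<Rightarrow> real"
  assumes f: "cbf f" and g: "cbf g"
    and value_eq: "\<And>x. value_fn M F P X r f g x = ereal (w x)"
begin

section \<open>Reduction of the value function to bounded stopping times\<close>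

lemma payoff_eq_gain: "payoff r f g X \<tau> T \<omega> = gain f g (stopT \<tau> T \<omega>) \<omega>"
  by (simp add: payoff_def gain_def cost_def disc_0)

text \<open>Truncation at \<open>T\<close> has no effect once \<open>T \<ge> N\<close>, so the upper
  limit is that of an eventually constant function.\<close>

lemma value_upper:
  assumes \<rho>: "bounded_stop N \<rho>"
  shows "(\<integral>\<omega>. gain f g (\<rho> \<omega>) \<omega> \<partial>P x) \<le> w x"
proof -
  let ?\<tau> = "\<lambda>\<omega>. ennreal (\<rho> \<omega>)"
  have st: "stopping_timeF M F ?\<tau>"
    using \<rho> by (simp add: stopping_timeF_def bounded_stop_def ennreal_le_iff)
  have "stopT ?\<tau> T \<omega> = \<rho> \<omega>" if "N \<le> T" for T \<omega>
  proof -
    have "\<rho> \<omega> \<le> T" "0 \<le> \<rho> \<omega>" using \<rho> that by (auto simp: bounded_stop_def intro: order_trans)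
    then show ?thesis by (simp add: stopT_def min_absorb1 ennreal_leI)
  qed
  then have "eventually (\<lambda>T. ereal (\<integral>\<omega>. payoff r f g X ?\<tau> T \<omega> \<partial>P x) = ereal (\<integral>\<omega>. gain f g (\<rho> \<omega>) \<omega> \<partial>P x)) at_top"
    by (intro eventually_mono[OF eventually_ge_at_top[of N]]) (simp add: payoff_eq_gain)
  then have "Limsup at_top (\<lambda>T. ereal (\<integral>\<omega>. payoff r f g X ?\<tau> T \<omega> \<partial>P x))
      = Limsup at_top (\<lambda>T::real. ereal (\<integral>\<omega>. gain f g (\<rho> \<omega>) \<omega> \<partial>P x))"
    by (rule Limsup_eq)
  also have "\<dots> = ereal (\<integral>\<omega>. gain f g (\<rho> \<omega>) \<omega> \<partial>P x)"
    by (rule Limsup_const) simp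
  finally have "ereal (\<integral>\<omega>. gain f g (\<rho> \<omega>) \<omega> \<partial>P x) \<le> value_fn M F P X r f g x"
    unfolding value_fn_def using st by (intro SUP_upper2[of ?\<tau>]) auto
  then show ?thesis by (simp add: value_eq)
qed

lemma stopT_bounded_stop:
  assumes \<tau>: "stopping_timeF M F \<tau>" and T: "0 \<le> T"
  shows "bounded_stop T (stopT \<tau> T)"
  unfolding bounded_stop_def
proof (intro conjI allI impI)
  fix \<omega>
  show "0 \<le> stopT \<tau> T \<omega>" by (simp add: stopT_def)
  have "stopT \<tau> T \<omega> \<le> enn2real (ennreal T)"
    unfolding stopT_def by (intro enn2real_mono) auto
  then show "stopT \<tau> T \<omega> \<le> T" using T by simp
next
  fix t :: real assume t: "0 \<le> t"
  have "stopT \<tau> T \<omega> \<le> t \<longleftrightarrow> T \<le> t \<or> \<tau> \<omega> \<le> ennreal t" for \<omega>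
  proof -
    have "stopT \<tau> T \<omega> \<le> t \<longleftrightarrow> ennreal (stopT \<tau> T \<omega>) \<le> ennreal t"
      using t by (simp add: ennreal_le_iff)
    also have "ennreal (stopT \<tau> T \<omega>) = min (\<tau> \<omega>) (ennreal T)"
      unfolding stopT_def by (rule ennreal_enn2real) (simp add: min_less_iff_disj)
    also have "min (\<tau> \<omega>) (ennreal T) \<le> ennreal t \<longleftrightarrow> T \<le> t \<or> \<tau> \<omega> \<le> ennreal t"
      using t by (auto simp: min_le_iff_disj ennreal_le_iff)
    finally show ?thesis .
  qed
  then have "{\<omega> \<in> space M. stopT \<tau> T \<omega> \<le> t} = (if T \<le> t then space M else {\<omega> \<in> space M. \<tau> \<omega> \<le> ennreal t})"
    by auto
  then show "{\<omega> \<in> space M. stopT \<tau> T \<omega> \<le> t} \<in> F t"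
    using \<tau> t F_space[OF t] by (simp add: stopping_timeF_def)
qed

text \<open>If all truncated payoffs of a stopping time were at most \<open>c\<close>, so would be
  their upper limit. The truncated times serve as the bounded competitors.\<close>

lemma value_lower:
  assumes "c < w x"
  obtains N \<rho> where "bounded_stop N \<rho>" "c < (\<integral>\<omega>. gain f g (\<rho> \<omega>) \<omega> \<partial>P x)"
proof -
  have "ereal c < value_fn M F P X r f g x" using assms by (simp add: value_eq)
  then obtain \<tau> where \<tau>: "stopping_timeF M F \<tau>"
    and c: "ereal c < Limsup at_top (\<lambda>T::real. ereal (\<integral>\<omega>. payoff r f g X \<tau> T \<omega> \<partial>P x))"
    unfolding value_fn_def less_SUP_iff by auto
  have "\<exists>T\<ge>0. c < (\<integral>\<omega>. payoff r f g X \<tau> T \<omega> \<partial>P x)"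
  proof (rule ccontr)
    assume "\<not> ?thesis"
    then have "(\<integral>\<omega>. payoff r f g X \<tau> T \<omega> \<partial>P x) \<le> c" if "0 \<le> T" for T using that by force
    then have "eventually (\<lambda>T. ereal (\<integral>\<omega>. payoff r f g X \<tau> T \<omega> \<partial>P x) \<le> ereal c) at_top"
      by (intro eventually_mono[OF eventually_ge_at_top[of "0::real"]]) simp
    then have "Limsup at_top (\<lambda>T::real. ereal (\<integral>\<omega>. payoff r f g X \<tau> T \<omega> \<partial>P x)) \<le> ereal c"
      by (rule Limsup_bounded)
    then show False using c by simp
  qed
  then obtain T where "0 \<le> T" "c < (\<integral>\<omega>. payoff r f g X \<tau> T \<omega> \<partial>P x)" by blast
  then show thesis
    using stopT_bounded_stop[OF \<tau>] by (intro that[of T "stopT \<tau> T"]) (simp_all add: payoff_eq_gain)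
qed

lemma value_ge: "g x \<le> w x"
  using value_upper[OF bounded_stop_const[of 0], of x] expectation_start[OF cbf_bmf[OF g], of x]
  by (simp add: gain_0)

text \<open>Without shift operators on the sample space, stopping rules started at time \<open>t\<close> cannot be
  obtained by shifting; instead a reward is called attained if at each time \<open>t\<close> one single
  stopping time after \<open>t\<close> does at least as well under every \<open>P x\<close>, conditionally on \<open>F t\<close>.\<close>
definition attained :: "('e \<Rightarrow> real) \<Rightarrow> bool" where
  "attained u \<longleftrightarrow> (\<forall>t\<ge>0. \<exists>N \<tau>. bounded_stop N \<tau> \<and> (\<forall>\<omega>. t \<le> \<tau> \<omega>) \<and>
    (\<forall>x. \<forall>A\<in>F t. (\<integral>\<omega>. indicator A \<omega> * gain f u t \<omega> \<partial>P x) \<le> (\<integral>\<omega>. indicator A \<omega> * gain f g (\<tau> \<omega>) \<omega> \<partial>P x)))"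

lemma attained_g: "attained g"
  unfolding attained_def
proof (intro allI impI)
  fix t :: real assume "0 \<le> t"
  then show "\<exists>N \<tau>. bounded_stop N \<tau> \<and> (\<forall>\<omega>. t \<le> \<tau> \<omega>) \<and>
    (\<forall>x. \<forall>A\<in>F t. (\<integral>\<omega>. indicator A \<omega> * gain f g t \<omega> \<partial>P x) \<le> (\<integral>\<omega>. indicator A \<omega> * gain f g (\<tau> \<omega>) \<omega> \<partial>P x))"
    by (intro exI[of _ t] exI[of _ "\<lambda>_. t"]) (simp add: bounded_stop_const)
qed

lemma indicator_split: "(indicator A \<omega> :: real) = indicator (A \<inter> B) \<omega> + indicator (A - B) \<omega>"
  by (simp add: indicator_def)

text \<open>Stop at \<open>t\<close> where \<open>g\<close> is at least the continuation value,
  otherwise follow the rule available from \<open>t + a\<close>. The stopping region is described by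
  \<open>X t\<close> alone, so the combined rule does not depend on the initial law.\<close>

lemma attained_step:
  assumes u: "bmf u" and att: "attained u" and a: "0 \<le> a"
  shows "attained (\<lambda>y. max (g y) (Gop f u a y))"
  unfolding attained_def
proof (intro allI impI)
  fix t :: real assume t: "0 \<le> t"
  let ?v = "Gop f u a"
  let ?m = "\<lambda>y. max (g y) (?v y)"
  let ?B = "{\<omega> \<in> space M. ?v (X t \<omega>) \<le> g (X t \<omega>)}"
  have v: "bmf ?v" by (rule Gop_bmf[OF a f u])
  have bg: "bmf g" by (rule cbf_bmf[OF g])
  have m: "bmf ?m" by (rule bmf_max[OF bg v])
  from att obtain N \<tau> where \<tau>: "bounded_stop N \<tau>" "\<And>\<omega>. t + a \<le> \<tau> \<omega>"
    and dom: "\<And>x A. A \<in> F (t + a) \<Longrightarrow>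
      (\<integral>\<omega>. indicator A \<omega> * gain f u (t + a) \<omega> \<partial>P x) \<le> (\<integral>\<omega>. indicator A \<omega> * gain f g (\<tau> \<omega>) \<omega> \<partial>P x)"
    unfolding attained_def using add_nonneg_nonneg[OF t a] by blast
  have B: "?B \<in> F t"
  proof -
    have "?B \<in> sets (Nt t)"
      using weight_X[OF t order_refl v] weight_X[OF t order_refl bg] unfolding weight_def
      by (subst space_Nt[of t, symmetric], intro borel_measurable_le) auto
    then show ?thesis using t by (simp add: sets_Nt)
  qed
  define \<sigma> where "\<sigma> \<omega> = (if \<omega> \<in> ?B then t else \<tau> \<omega>)" for \<omega>
  \<comment> \<open>\<open>undefined\<close> is an arbitrary sample point; the bounds on
    \<open>\<tau>\<close> hold everywhere.\<close>
  have tN: "t \<le> N" using \<tau>(2)[of undefined] bounded_stop_range(2)[OF \<tau>(1), of undefined] a by linarith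
  have ge: "t \<le> \<sigma> \<omega>" for \<omega> using \<tau>(2)[of \<omega>] a by (simp add: \<sigma>_def)
  have \<sigma>: "bounded_stop N \<sigma>"
    unfolding bounded_stop_def
  proof (intro conjI allI impI)
    show "0 \<le> \<sigma> \<omega>" "\<sigma> \<omega> \<le> N" for \<omega>
      using t tN bounded_stop_range[OF \<tau>(1), of \<omega>] by (auto simp: \<sigma>_def)
    fix s :: real assume s: "0 \<le> s"
    show "{\<omega> \<in> space M. \<sigma> \<omega> \<le> s} \<in> F s"
    proof (cases "t \<le> s")
      case True
      have "{\<omega> \<in> space M. \<sigma> \<omega> \<le> s} = ?B \<union> ({\<omega> \<in> space M. \<tau> \<omega> \<le> s} - ?B)"
        using True by (auto simp: \<sigma>_def)
      moreover have "?B \<in> F s" using B F_mono[OF t True] by auto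
      ultimately show ?thesis
        using bounded_stop_le[OF \<tau>(1) s] s by (auto intro!: F_Un F_Diff)
    next
      case False
      then have e: "{\<omega> \<in> space M. \<sigma> \<omega> \<le> s} = {}" using ge by (auto simp: not_le intro: order.strict_trans2)
      show ?thesis unfolding e by (rule F_empty[OF s])
    qed
  qed
  have "(\<integral>\<omega>. indicator A \<omega> * gain f ?m t \<omega> \<partial>P x) \<le> (\<integral>\<omega>. indicator A \<omega> * gain f g (\<sigma> \<omega>) \<omega> \<partial>P x)"
    if A: "A \<in> F t" for x A
  proof -
    have AB: "A \<inter> ?B \<in> F t" "A - ?B \<in> F t" using A B t by (auto intro: F_Int F_Diff)
    have AB': "A - ?B \<in> F (t + a)" using AB(2) F_mono[OF t, of "t + a"] a by auto
    have ABM: "A \<inter> ?B \<in> sets M" "A - ?B \<in> sets M" using AB F_sub[OF t] by auto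
    have i: "integrable (P x) (\<lambda>\<omega>. indicator (A \<inter> ?B) \<omega> * gain f ?m t \<omega>)"
      "integrable (P x) (\<lambda>\<omega>. indicator (A - ?B) \<omega> * gain f ?m t \<omega>)"
      by (intro indicator_gain_integrable[OF t order_refl] AB f m)+
    have j: "integrable (P x) (\<lambda>\<omega>. indicator (A \<inter> ?B) \<omega> * gain f g (\<sigma> \<omega>) \<omega>)"
      "integrable (P x) (\<lambda>\<omega>. indicator (A - ?B) \<omega> * gain f g (\<sigma> \<omega>) \<omega>)"
      by (intro stopped_gain_integrable[OF \<sigma> t ge f g] ABM)+
    have 1: "(\<integral>\<omega>. indicator A \<omega> * gain f ?m t \<omega> \<partial>P x)
        = (\<integral>\<omega>. indicator (A \<inter> ?B) \<omega> * gain f ?m t \<omega> \<partial>P x) + (\<integral>\<omega>. indicator (A - ?B) \<omega> * gain f ?m t \<omega> \<partial>P x)"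
      unfolding indicator_split[of A _ ?B] distrib_right by (rule Bochner_Integration.integral_add[OF i])
    have 2: "(\<integral>\<omega>. indicator A \<omega> * gain f g (\<sigma> \<omega>) \<omega> \<partial>P x)
        = (\<integral>\<omega>. indicator (A \<inter> ?B) \<omega> * gain f g (\<sigma> \<omega>) \<omega> \<partial>P x) + (\<integral>\<omega>. indicator (A - ?B) \<omega> * gain f g (\<sigma> \<omega>) \<omega> \<partial>P x)"
      unfolding indicator_split[of A _ ?B] distrib_right by (rule Bochner_Integration.integral_add[OF j])
    have 3: "(\<integral>\<omega>. indicator (A \<inter> ?B) \<omega> * gain f ?m t \<omega> \<partial>P x) = (\<integral>\<omega>. indicator (A \<inter> ?B) \<omega> * gain f g (\<sigma> \<omega>) \<omega> \<partial>P x)"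
      by (intro Bochner_Integration.integral_cong refl) (auto simp: indicator_def \<sigma>_def gain_def max_def)
    \<comment> \<open>Off the stopping region the Markov property trades the continuation value at
      \<open>t\<close> for \<open>u\<close> at \<open>t + a\<close>, where the rule
      \<open>\<tau>\<close> does at least as well.\<close>
    have "(\<integral>\<omega>. indicator (A - ?B) \<omega> * gain f ?m t \<omega> \<partial>P x) = (\<integral>\<omega>. indicator (A - ?B) \<omega> * gain f ?v t \<omega> \<partial>P x)"
      by (intro Bochner_Integration.integral_cong refl) (auto simp: indicator_def gain_def max_def)
    also have "\<dots> = (\<integral>\<omega>. indicator (A - ?B) \<omega> * gain f u (t + a) \<omega> \<partial>P x)"
      by (rule markov_gain[OF t a AB(2) f u, symmetric])
    also have "\<dots> \<le> (\<integral>\<omega>. indicator (A - ?B) \<omega> * gain f g (\<tau> \<omega>) \<omega> \<partial>P x)"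
      by (rule dom[OF AB'])
    also have "\<dots> = (\<integral>\<omega>. indicator (A - ?B) \<omega> * gain f g (\<sigma> \<omega>) \<omega> \<partial>P x)"
      by (intro Bochner_Integration.integral_cong refl) (auto simp: indicator_def \<sigma>_def)
    finally show ?thesis
      unfolding 1 2 3 by (rule add_left_mono)
  qed
  then show "\<exists>N \<tau>. bounded_stop N \<tau> \<and> (\<forall>\<omega>. t \<le> \<tau> \<omega>) \<and>
    (\<forall>x. \<forall>A\<in>F t. (\<integral>\<omega>. indicator A \<omega> * gain f ?m t \<omega> \<partial>P x) \<le> (\<integral>\<omega>. indicator A \<omega> * gain f g (\<tau> \<omega>) \<omega> \<partial>P x))"
    using \<sigma> ge by (intro exI[of _ N] exI[of _ \<sigma>]) auto
qed

text \<open>Value iteration for stopping at multiples of \<open>a\<close> with at most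
  \<open>n\<close> steps left; when none is left the reward \<open>g\<close> is taken.\<close>

fun iter :: "real \<Rightarrow> nat \<Rightarrow> 'e \<Rightarrow> real" where
  "iter a 0 = g"
| "iter a (Suc n) = (\<lambda>y. max (g y) (Gop f (iter a n) a y))"

lemma iter_bmf: "0 \<le> a \<Longrightarrow> bmf (iter a n)"
  by (induction n) (auto intro: bmf_max Gop_bmf cbf_bmf f g)

lemma iter_attained: "0 \<le> a \<Longrightarrow> attained (iter a n)"
  by (induction n) (auto intro: attained_g attained_step iter_bmf)

lemma iter_ge: "g y \<le> iter a n y"
  by (cases n) auto

lemma attained_Gop_le:
  assumes u: "bmf u" and att: "attained u" and t: "0 \<le> t"
  shows "Gop f u t x \<le> w x"
proof -
  obtain N \<tau> where \<tau>: "bounded_stop N \<tau>" and dom: "\<And>A. A \<in> F t \<Longrightarrow>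
      (\<integral>\<omega>. indicator A \<omega> * gain f u t \<omega> \<partial>P x) \<le> (\<integral>\<omega>. indicator A \<omega> * gain f g (\<tau> \<omega>) \<omega> \<partial>P x)"
    using att t unfolding attained_def by blast
  have "Gop f u t x = (\<integral>\<omega>. gain f u t \<omega> \<partial>P x)" by (rule Gop_expectation[OF t f u])
  also have "\<dots> = (\<integral>\<omega>. indicator (space M) \<omega> * gain f u t \<omega> \<partial>P x)"
    by (intro Bochner_Integration.integral_cong) auto
  also have "\<dots> \<le> (\<integral>\<omega>. indicator (space M) \<omega> * gain f g (\<tau> \<omega>) \<omega> \<partial>P x)"
    by (rule dom[OF F_space[OF t]])
  also have "\<dots> = (\<integral>\<omega>. gain f g (\<tau> \<omega>) \<omega> \<partial>P x)"
    by (intro Bochner_Integration.integral_cong) auto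
  also have "\<dots> \<le> w x" by (rule value_upper[OF \<tau>])
  finally show ?thesis .
qed

lemma iter_le:
  assumes "0 \<le> a"
  shows "iter a n x \<le> w x"
  using assms attained_Gop_le[OF iter_bmf[OF assms] iter_attained[OF assms] assms] value_ge[of x]
  by (cases n) auto

text \<open>A stopped iterate has a random number of remaining steps, so one bound must serve all
  iterates up to \<open>m\<close>.\<close>

lemma iter_bound:
  assumes "0 \<le> a"
  shows "\<exists>U. \<forall>n\<le>m. \<forall>y. \<bar>iter a n y\<bar> \<le> U"
proof (induction m)
  case 0
  show ?case using bmf_bound[OF iter_bmf[OF assms, of 0]] by (metis le_zero_eq)
next
  case (Suc m)
  then obtain U where U: "\<And>n y. n \<le> m \<Longrightarrow> \<bar>iter a n y\<bar> \<le> U" by blast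
  obtain V where V: "\<And>y. \<bar>iter a (Suc m) y\<bar> \<le> V" using bmf_bound[OF iter_bmf[OF assms]] by metis
  have "\<bar>iter a n y\<bar> \<le> max U V" if "n \<le> Suc m" for n y
    using U[of n y] V[of y] that by (cases "n = Suc m") (auto simp: le_max_iff_disj simp del: iter.simps)
  then show ?case by blast
qed

text \<open>With mesh \<open>1 / (n + 1)\<close> and \<open>(n + 1)^2\<close> steps the horizon is
  \<open>n + 1\<close>: the grid is refined and the horizon grows at the same time.\<close>

definition val :: "nat \<Rightarrow> 'e \<Rightarrow> real" where
  "val n = iter (1 / Suc n) (Suc n * Suc n)"

text \<open>At node \<open>j\<close> the iterate with \<open>m - j\<close> steps left is used. By
  construction these functions satisfy the one-step inequality of a supermartingale and lie above
  \<open>g\<close>, so stopping at any rounded time earns at most the initial iterate.\<close>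

lemma iter_dominates_grid:
  assumes \<rho>: "bounded_stop N \<rho>" and a: "0 < a" and m: "N \<le> real m * a"
  shows "(\<integral>\<omega>. gain f g (real (grid_index 0 a \<rho> \<omega>) * a) \<omega> \<partial>P x) \<le> iter a m x"
proof -
  let ?\<kappa> = "grid_index 0 a \<rho>"
  let ?u = "\<lambda>j. iter a (m - j)"
  have a0: "0 \<le> a" using a by simp
  have \<kappa>: "?\<kappa> \<omega> \<le> m" for \<omega>
    using bounded_stop_range(2)[OF \<rho>, of \<omega>] m by (intro grid_index_le a) simp
  have super: "Gop f (?u (Suc j)) a y \<le> ?u j y" if "j < m" for j y
  proof -
    have "m - j = Suc (m - Suc j)" using that by simp
    then show ?thesis by simp
  qed
  note meas = grid_gain_measurable[OF order_refl a0 f _ grid_index_F[OF \<rho> order_refl a] \<kappa>]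
  obtain L where L: "0 < L" "\<And>y. \<bar>f y\<bar> \<le> L" using f by (metis cbf_bound)
  obtain U where U: "\<And>n y. n \<le> m \<Longrightarrow> \<bar>iter a n y\<bar> \<le> U" using iter_bound[OF a0] by blast
  obtain G where G: "\<And>y. \<bar>g y\<bar> \<le> G" using g by (metis cbf_bound)
  have t: "0 \<le> real (?\<kappa> \<omega>) * a" "real (?\<kappa> \<omega>) * a \<le> real m * a" for \<omega>
    using a \<kappa>[of \<omega>] by (auto intro: mult_right_mono)
  have i1: "integrable (P x) (\<lambda>\<omega>. gain f g (real (?\<kappa> \<omega>) * a) \<omega>)"
  proof (rule integrable_bounded)
    show "(\<lambda>\<omega>. gain f g (real (?\<kappa> \<omega>) * a) \<omega>) \<in> borel_measurable M"
      using meas[of "\<lambda>_. g"] cbf_bmf[OF g] by simp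
    show "\<bar>gain f g (real (?\<kappa> \<omega>) * a) \<omega>\<bar> \<le> L * (real m * a) + G" if "\<omega> \<in> space M" for \<omega>
      using gain_bound[OF that t(1) f L(2) G] mult_left_mono[OF t(2)[of \<omega>], of L] L(1)
      by (meson add_right_mono less_imp_le order_trans)
  qed
  have i2: "integrable (P x) (\<lambda>\<omega>. gain f (?u (?\<kappa> \<omega>)) (real (?\<kappa> \<omega>) * a) \<omega>)"
  proof (rule integrable_bounded)
    show "(\<lambda>\<omega>. gain f (?u (?\<kappa> \<omega>)) (real (?\<kappa> \<omega>) * a) \<omega>) \<in> borel_measurable M"
      using meas[of ?u] iter_bmf[OF a0] by simp
    show "\<bar>gain f (?u (?\<kappa> \<omega>)) (real (?\<kappa> \<omega>) * a) \<omega>\<bar> \<le> L * (real m * a) + U" if "\<omega> \<in> space M" for \<omega>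
      using gain_bound[OF that t(1) f L(2), of "?u (?\<kappa> \<omega>)" U \<omega>] U mult_left_mono[OF t(2)[of \<omega>], of L] L(1)
      by (smt (verit) diff_le_self)
  qed
  have "(\<integral>\<omega>. gain f g (real (?\<kappa> \<omega>) * a) \<omega> \<partial>P x) \<le> (\<integral>\<omega>. gain f (?u (?\<kappa> \<omega>)) (real (?\<kappa> \<omega>) * a) \<omega> \<partial>P x)"
    by (intro integral_mono i1 i2 gain_mono iter_ge)
  also have "\<dots> = (\<integral>\<omega>. indicator (space M) \<omega> * gain f (?u (?\<kappa> \<omega>)) (0 + real (?\<kappa> \<omega>) * a) \<omega> \<partial>P x)"
    by (intro Bochner_Integration.integral_cong) auto
  also have "\<dots> \<le> (\<integral>\<omega>. indicator (space M) \<omega> * gain f (?u 0) 0 \<omega> \<partial>P x)"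
    by (rule grid_supermartingale[where u="?u" and m=m, OF order_refl a0 f iter_bmf[OF a0] super F_space[OF order_refl]
          grid_index_F[OF \<rho> order_refl a] \<kappa>])
  also have "\<dots> = (\<integral>\<omega>. iter a m (X 0 \<omega>) \<partial>P x)"
    by (intro Bochner_Integration.integral_cong) (auto simp: gain_0)
  also have "\<dots> = iter a m x" by (rule expectation_start[OF iter_bmf[OF a0]])
  finally show ?thesis .
qed

text \<open>These grids are not nested, so a squeeze replaces monotonicity: \<open>val n x\<close>
  lies below \<open>w x\<close> and above the payoff of a nearly optimal time rounded to the grid,
  as soon as the horizon covers its bound \<open>N\<close>.\<close>

lemma val_LIMSEQ: "(\<lambda>n. val n x) \<longlonglongrightarrow> w x"
proof (rule LIMSEQ_I)
  fix e :: real assume e: "0 < e"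
  obtain N \<rho> where \<rho>: "bounded_stop N \<rho>" and J: "w x - e < (\<integral>\<omega>. gain f g (\<rho> \<omega>) \<omega> \<partial>P x)"
    using value_lower[of "w x - e" x] e by auto
  let ?A = "\<lambda>n. (\<integral>\<omega>. gain f g (0 + real (grid_index 0 (1 / Suc n) \<rho> \<omega>) * (1 / Suc n)) \<omega> \<partial>P x)"
  have ge: "0 \<le> \<rho> \<omega>" for \<omega> by (rule bounded_stop_range(1)[OF \<rho>])
  have ind: "(\<integral>\<omega>. indicator (space M) \<omega> * Y \<omega> \<partial>P x) = (\<integral>\<omega>. Y \<omega> \<partial>P x)" for Y :: "_ \<Rightarrow> real"
    by (intro Bochner_Integration.integral_cong) auto
  have "?A \<longlonglongrightarrow> (\<integral>\<omega>. gain f g (\<rho> \<omega>) \<omega> \<partial>P x)"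
    using stopped_gain_LIMSEQ[OF \<rho> order_refl ge f g sets.top, of x]
    unfolding approx_def[OF \<rho> order_refl ge f g] ind .
  from order_tendstoD(1)[OF this J]
  have "eventually (\<lambda>n. w x - e < ?A n) sequentially" .
  moreover have "eventually (\<lambda>n. nat \<lceil>N\<rceil> \<le> n) sequentially" by (rule eventually_ge_at_top)
  ultimately have "eventually (\<lambda>n. norm (val n x - w x) < e) sequentially"
  proof eventually_elim
    case (elim n)
    have "N \<le> real (Suc n)" using elim(2) by linarith
    also have "\<dots> = real (Suc n * Suc n) * (1 / Suc n)"
      unfolding of_nat_mult mult.assoc by (simp del: of_nat_Suc)
    finally have "?A n \<le> val n x"
      using iter_dominates_grid[OF \<rho>, of "1 / Suc n" "Suc n * Suc n" x] by (simp add: val_def del: of_nat_Suc mult_Suc)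
    moreover have "val n x \<le> w x" unfolding val_def by (rule iter_le) simp
    ultimately show ?case using elim(1) by (simp del: of_nat_Suc)
  qed
  then show "\<exists>no. \<forall>n\<ge>no. norm (val n x - w x) < e" by (simp add: eventually_sequentially)
qed

section \<open>Dynamic programming and the supersolution property\<close>

lemma fk_mono:
  assumes "0 \<le> t" "bmf u" "bmf v" "\<And>y. u y \<le> v y"
  shows "fk t u y \<le> fk t v y"
proof -
  have "integrable (P y) (\<lambda>\<omega>. disc 0 t \<omega> * h (X t \<omega>))" if "bmf h" for h
    using weight_disc[of 0 t] assms(1) that by (intro weight_integrable[of t] weight_mult weight_X) auto
  then show ?thesis
    unfolding fk_def using assms less_imp_le[OF disc_pos] by (intro integral_mono mult_left_mono) auto
qed

text \<open>The inequality holds with \<open>val n\<close> in place of \<open>u\<close> because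
  iterates are attained; it is transferred to \<open>u\<close> by a limit. It serves twice, for test
  functions below \<open>w\<close> and for \<open>w\<close> itself once \<open>w\<close> is known to
  be bounded.\<close>

lemma dynamic_programming:
  assumes u: "bmf u" and le: "\<And>y. u y \<le> w y" and t: "0 \<le> t"
  shows "Gop f u t x \<le> w x"
proof -
  obtain U where U: "\<And>y. \<bar>u y\<bar> \<le> U" using u by (metis bmf_bound)
  obtain G where G: "\<And>y. \<bar>g y\<bar> \<le> G" using g by (metis cbf_bound)
  \<comment> \<open>Capping by \<open>u\<close> gives a bound uniform in \<open>n\<close>: from
    above by \<open>u\<close>, from below because \<open>val n \<ge> g\<close>. As
    \<open>u \<le> w\<close>, the limit of these minima is \<open>u\<close>.\<close>
  let ?u = "\<lambda>n y. min (val n y) (u y)"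
  have v: "bmf (val n)" for n unfolding val_def by (rule iter_bmf) simp
  have b: "bmf (?u n)" for n by (intro bmf_min v u)
  have "(\<lambda>n. \<integral>\<omega>. disc 0 t \<omega> * ?u n (X t \<omega>) \<partial>P x) \<longlonglongrightarrow> (\<integral>\<omega>. disc 0 t \<omega> * u (X t \<omega>) \<partial>P x)"
  proof (rule expectation_LIMSEQ[where K="1 * max U G"])
    show "(\<lambda>\<omega>. disc 0 t \<omega> * ?u n (X t \<omega>)) \<in> borel_measurable M" for n
      using weight_disc[of 0 t] t b by (intro weight_measurable[of t] weight_mult weight_X) auto
    fix \<omega>
    have "(\<lambda>n. ?u n (X t \<omega>)) \<longlonglongrightarrow> min (w (X t \<omega>)) (u (X t \<omega>))"
      by (intro tendsto_min val_LIMSEQ tendsto_const)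
    then show "(\<lambda>n. disc 0 t \<omega> * ?u n (X t \<omega>)) \<longlonglongrightarrow> disc 0 t \<omega> * u (X t \<omega>)"
      using le[of "X t \<omega>"] by (intro tendsto_intros) (simp add: min_absorb2)
    have "\<bar>?u n y\<bar> \<le> max U G" for n y
      using U[of y] G[of y] iter_ge[of y "1 / Suc n" "Suc n * Suc n"] unfolding val_def by linarith
    then show "\<bar>disc 0 t \<omega> * ?u n (X t \<omega>)\<bar> \<le> 1 * max U G" for n
      unfolding abs_mult by (intro mult_mono disc_abs_le) auto
  qed
  then have "(\<lambda>n. running f t x + fk t (?u n) x) \<longlonglongrightarrow> running f t x + fk t u x"
    unfolding fk_def by (intro tendsto_intros)
  moreover have "running f t x + fk t (?u n) x \<le> w x" for n
  proof -
    have "running f t x + fk t (?u n) x \<le> Gop f (val n) t x"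
      unfolding Gop_def by (intro add_left_mono fk_mono t b v) simp
    also have "\<dots> \<le> w x"
      unfolding val_def by (intro attained_Gop_le iter_bmf iter_attained t) simp_all
    finally show ?thesis .
  qed
  ultimately show ?thesis
    unfolding Gop_def by (intro LIMSEQ_le_const2) auto
qed

text \<open>From \<open>Gop f \<phi> a x \<le> w x = \<phi> x\<close> every difference quotient at
  \<open>x\<close> is nonpositive, hence so is its limit
  \<open>h x - r x * \<phi> x + f x\<close>.\<close>

lemma supersolution:
  assumes w_cont: "continuous_on UNIV w"
  shows "visc_super (gen_dom P X) (gen P X) r f g w"
  unfolding visc_super_def
proof (intro conjI allI ballI impI w_cont)
  fix x \<phi> assume \<phi>: "\<phi> \<in> gen_dom P X" and le: "(\<forall>y. \<phi> y \<le> w y) \<and> \<phi> x = w x"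
  obtain h C where h: "cbf \<phi>" "cbf h" and C: "0 \<le> C"
    "\<And>a y. 0 < a \<Longrightarrow> a \<le> 1 \<Longrightarrow> \<bar>(semigrp P X a \<phi> y - \<phi> y) / a\<bar> \<le> C"
    and lim: "\<And>y. ((\<lambda>a. (semigrp P X a \<phi> y - \<phi> y) / a) \<longlongrightarrow> h y) (at_right 0)"
    and gen: "\<And>y. gen P X \<phi> y = h y"
    by (rule gen_domE[OF \<phi>], rule that) simp_all
  have "h x - r x * \<phi> x + f x \<le> 0"
  proof (rule tendsto_upperbound[OF Gop_derivative[OF f h(1) lim]])
    have "(Gop f \<phi> a x - \<phi> x) / a \<le> 0" if "0 < a" for a
      using dynamic_programming[OF cbf_bmf[OF h(1)], of a x] le that by (simp add: divide_le_0_iff)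
    then show "eventually (\<lambda>a. (Gop f \<phi> a x - \<phi> x) / a \<le> 0) (at_right 0)"
      by (auto simp: eventually_at_filter)
  qed simp
  then show "0 \<le> min (- gen P X \<phi> x + r x * \<phi> x - f x) (w x - g x)"
    using value_ge[of x] by (simp add: gen)
qed

text \<open>Under reward \<open>k\<close> and terminal value \<open>\<psi>\<close> no rule earns
  more than \<open>\<psi> x\<close>. Passing to \<open>f\<close> and \<open>g\<close> costs the
  running difference \<open>k - f\<close> while continuing and the gap \<open>\<psi> - g\<close>
  when stopping early; both are positive near \<open>x\<close>, and at time \<open>h\<close> the
  continuation is worth at most \<open>w \<le> \<psi>\<close>.\<close>

lemma strict_subsolution_gap:
  assumes w: "cbf w" and \<psi>: "cbf \<psi>" and k: "cbf k"
    and w_le: "\<And>y. w y \<le> \<psi> y"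
    and super: "\<And>a y. 0 < a \<Longrightarrow> Gop k \<psi> a y \<le> \<psi> y"
    and fk_pos: "0 < k x - f x" and gap_pos: "0 < \<psi> x - g x"
  obtains \<gamma> where "0 < \<gamma>" "\<And>N \<rho>. bounded_stop N \<rho> \<Longrightarrow> (\<integral>\<omega>. gain f g (\<rho> \<omega>) \<omega> \<partial>P x) \<le> \<psi> x - \<gamma>"
proof -
  interpret prob_space "P x" by (rule prob_space_P)
  let ?l = "\<lambda>y. k y - f y" and ?d = "\<lambda>y. \<psi> y - g y"
  have l: "cbf ?l" by (rule cbf_diff[OF k f])
  obtain K where K: "0 < K" "\<And>y. \<bar>?l y\<bar> \<le> K" using cbf_bound[OF l] by blast
  \<comment> \<open>Half of the smaller of the two margins at \<open>x\<close>, so that by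
    continuity both margins stay above \<open>c\<close> on a neighbourhood.\<close>
  define c where "c = min (?l x) (?d x) / 2"
  have c: "0 < c" using fk_pos gap_pos by (simp add: c_def)
  have cont: "continuous_on UNIV (\<lambda>y. min (?l y) (?d y))"
    using k f \<psi> g by (intro continuous_intros) (auto simp: cbf_def)
  have "isCont (\<lambda>y. min (?l y) (?d y)) x"
    using cont by (simp add: continuous_on_eq_continuous_at)
  then obtain \<delta> where \<delta>: "0 < \<delta>" "\<And>y. dist y x < \<delta> \<Longrightarrow> dist (min (?l y) (?d y)) (min (?l x) (?d x)) < c"
    using c unfolding continuous_at_eps_delta by blast
  have near: "c \<le> ?l y" "c \<le> ?d y" if "y \<in> cball x (\<delta> / 2)" for y
  proof -
    have "dist y x < \<delta>" using that \<delta>(1) by (simp add: dist_commute)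
    have half: "\<bar>a - b\<bar> < b / 2 \<Longrightarrow> b / 2 \<le> a" for a b :: real by linarith
    from \<delta>(2)[OF \<open>dist y x < \<delta>\<close>] have "c \<le> min (?l y) (?d y)"
      unfolding dist_real_def c_def by (rule half)
    then show "c \<le> ?l y" "c \<le> ?d y" by auto
  qed
  \<comment> \<open>The margin after discounting over a time of at most 1.\<close>
  define q where "q = exp (- R) * c"
  have q: "0 < q" using c by (simp add: q_def)
  \<comment> \<open>Balances the gain rate \<open>q\<close> on the good event against the loss rate
    \<open>K\<close> off it: \<open>(q + K) (1 - \<epsilon>) - K = q / 2\<close>.\<close>
  define \<epsilon> where "\<epsilon> = q / (2 * (q + K))"
  have \<epsilon>: "0 < \<epsilon>" using q K by (simp add: \<epsilon>_def)
  obtain h G where h: "0 < h" "h \<le> 1" and G: "G \<in> sets M" "1 - \<epsilon> \<le> measure (P x) G"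
    and stay: "\<And>\<omega> s. \<omega> \<in> G \<Longrightarrow> 0 \<le> s \<Longrightarrow> s \<le> h \<Longrightarrow> X s \<omega> \<in> cball x (\<delta> / 2)"
    using stays_near_start[of "\<delta> / 2" \<epsilon> x] \<delta>(1) \<epsilon> by auto
  have h0: "0 \<le> h" using h by simp
  show thesis
  proof (rule that[of "h * q / 2"])
    show "0 < h * q / 2" using h q by simp
    fix N \<rho> assume \<rho>: "bounded_stop N \<rho>"
    \<comment> \<open>\<open>?A\<close> collects the paths that are not stopped before
      \<open>h\<close>. There the comparison with \<open>\<psi>\<close> is made at time
      \<open>h\<close>, elsewhere at \<open>\<rho>\<close>; in both cases this is the time
      \<open>?\<sigma>\<close>.\<close>
    let ?A = "{\<omega> \<in> space M. h \<le> \<rho> \<omega>}"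
    let ?B = "space M - ?A"
    let ?\<sigma> = "\<lambda>\<omega>. min (\<rho> \<omega>) h"
    have \<sigma>: "bounded_stop h ?\<sigma>" by (rule bounded_stop_min[OF \<rho> h0])
    have \<tau>: "bounded_stop (max N h) (\<lambda>\<omega>. max (\<rho> \<omega>) h)" by (rule bounded_stop_max[OF \<rho> h0])
    have A: "?A \<in> F h" by (rule bounded_stop_ge[OF \<rho> h(1)])
    have AM: "?A \<in> sets M" "?B \<in> sets M" using A F_sub[OF h0] by auto
    have ge0: "0 \<le> \<rho> \<omega>" "0 \<le> ?\<sigma> \<omega>" for \<omega> using bounded_stop_range(1)[OF \<rho>, of \<omega>] h0 by auto
    have geh: "h \<le> max (\<rho> \<omega>) h" for \<omega> by simp
    note int = stopped_gain_integrable[OF \<rho> order_refl ge0(1) f g]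
      stopped_gain_integrable[OF \<tau> h0 geh f g] stopped_gain_integrable[OF \<tau> h0 geh f w]
      stopped_gain_integrable[OF \<sigma> order_refl ge0(2) f g] stopped_gain_integrable[OF \<sigma> order_refl ge0(2) k \<psi>]
    have iA: "integrable (P x) (\<lambda>\<omega>. indicator ?A \<omega> * gain f u h \<omega>)" if "cbf u" for u
      by (rule indicator_gain_integrable[OF h0 order_refl A f cbf_bmf[OF that]])
    \<comment> \<open>On \<open>?A\<close> the time may be replaced by its maximum with
      \<open>h\<close>, which is at least \<open>h\<close> everywhere as
      \<open>optional_stopping\<close> requires. This brings the value back to time
      \<open>h\<close>.\<close>
    have "(\<integral>\<omega>. indicator ?A \<omega> * gain f g (\<rho> \<omega>) \<omega> \<partial>P x) = (\<integral>\<omega>. indicator ?A \<omega> * gain f g (max (\<rho> \<omega>) h) \<omega> \<partial>P x)"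
      by (intro Bochner_Integration.integral_cong refl) (auto simp: indicator_def max_def)
    also have "\<dots> \<le> (\<integral>\<omega>. indicator ?A \<omega> * gain f w (max (\<rho> \<omega>) h) \<omega> \<partial>P x)"
      by (intro integral_mono int AM mult_left_mono gain_mono value_ge) simp
    also have "\<dots> \<le> (\<integral>\<omega>. indicator ?A \<omega> * gain f w h \<omega> \<partial>P x)"
      by (rule optional_stopping[OF \<tau> h0 geh f w _ A]) (intro dynamic_programming cbf_bmf w, auto)
    also have "\<dots> \<le> (\<integral>\<omega>. indicator ?A \<omega> * gain f \<psi> h \<omega> \<partial>P x)"
      by (intro integral_mono iA w \<psi> mult_left_mono gain_mono w_le) simp
    finally have 1: "(\<integral>\<omega>. indicator ?A \<omega> * gain f g (\<rho> \<omega>) \<omega> \<partial>P x) \<le> (\<integral>\<omega>. indicator ?A \<omega> * gain f \<psi> h \<omega> \<partial>P x)" .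
    have 2: "(\<integral>\<omega>. indicator ?B \<omega> * gain f g (\<rho> \<omega>) \<omega> \<partial>P x) = (\<integral>\<omega>. indicator ?B \<omega> * gain f g (?\<sigma> \<omega>) \<omega> \<partial>P x)"
      by (intro Bochner_Integration.integral_cong refl) (auto simp: indicator_def min_def)
    have "(\<integral>\<omega>. gain f g (\<rho> \<omega>) \<omega> \<partial>P x)
        = (\<integral>\<omega>. indicator ?A \<omega> * gain f g (\<rho> \<omega>) \<omega> + indicator ?B \<omega> * gain f g (\<rho> \<omega>) \<omega> \<partial>P x)"
      by (intro Bochner_Integration.integral_cong refl) (auto simp: indicator_def)
    also have "\<dots> = (\<integral>\<omega>. indicator ?A \<omega> * gain f g (\<rho> \<omega>) \<omega> \<partial>P x) + (\<integral>\<omega>. indicator ?B \<omega> * gain f g (\<rho> \<omega>) \<omega> \<partial>P x)"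
      by (rule Bochner_Integration.integral_add[OF int(1)[OF AM(1)] int(1)[OF AM(2)]])
    finally have 3: "(\<integral>\<omega>. gain f g (\<rho> \<omega>) \<omega> \<partial>P x) \<le> (\<integral>\<omega>. indicator ?A \<omega> * gain f \<psi> h \<omega> \<partial>P x)
        + (\<integral>\<omega>. indicator ?B \<omega> * gain f g (?\<sigma> \<omega>) \<omega> \<partial>P x)"
      using 1 2 by linarith
    \<comment> \<open>The benchmark: optional stopping for the superharmonic \<open>\<psi>\<close>
      under reward \<open>k\<close>.\<close>
    have "(\<integral>\<omega>. indicator (space M) \<omega> * gain k \<psi> (?\<sigma> \<omega>) \<omega> \<partial>P x) \<le> (\<integral>\<omega>. indicator (space M) \<omega> * gain k \<psi> 0 \<omega> \<partial>P x)"
      by (rule optional_stopping[OF \<sigma> order_refl ge0(2) k \<psi> super F_space]) simp_all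
    also have "\<dots> = (\<integral>\<omega>. \<psi> (X 0 \<omega>) \<partial>P x)"
      by (intro Bochner_Integration.integral_cong refl) (simp add: gain_0)
    also have "\<dots> = \<psi> x" by (rule expectation_start[OF cbf_bmf[OF \<psi>]])
    finally have 4: "(\<integral>\<omega>. indicator (space M) \<omega> * gain k \<psi> (?\<sigma> \<omega>) \<omega> \<partial>P x) \<le> \<psi> x" .
    \<comment> \<open>Pathwise loss. On \<open>G\<close> it is at least \<open>q h\<close>, through
      the running difference if time \<open>h\<close> is reached, and through the gap at stopping
      otherwise, using \<open>h \<le> 1\<close>. Off \<open>G\<close> the gap is still nonnegative
      and the running difference is at least \<open>- K h\<close>.\<close>
    have pos: "(if \<omega> \<in> G then q * h else - (K * h)) \<le> indicator (space M) \<omega> * gain k \<psi> (?\<sigma> \<omega>) \<omega>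
        - (indicator ?A \<omega> * gain f \<psi> h \<omega> + indicator ?B \<omega> * gain f g (?\<sigma> \<omega>) \<omega>)"
      if \<omega>: "\<omega> \<in> space M" for \<omega>
    proof -
      let ?t = "?\<sigma> \<omega>"
      have t: "0 \<le> ?t" "?t \<le> h" "?t \<le> 1" using ge0 h by auto
      have rhs: "indicator (space M) \<omega> * gain k \<psi> ?t \<omega> - (indicator ?A \<omega> * gain f \<psi> h \<omega> + indicator ?B \<omega> * gain f g ?t \<omega>)
          = cost ?l 0 ?t \<omega> + (if \<rho> \<omega> < h then disc 0 ?t \<omega> * ?d (X ?t \<omega>) else 0)"
        using \<omega> by (auto simp: gain_def cost_diff[OF \<omega> order_refl k f] right_diff_distrib indicator_def min_def)
      have d0: "0 \<le> ?d y" for y using w_le[of y] value_ge[of y] by simp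
      show ?thesis
      proof (cases "\<omega> \<in> G")
        case True
        have cl: "q * ?t \<le> cost ?l 0 ?t \<omega>"
          unfolding q_def by (rule cost_lower[OF \<omega> t(1,3) l]) (use c near stay[OF True] t in auto)
        show ?thesis
        proof (cases "\<rho> \<omega> < h")
          case lt: True
          have "exp (- R) * c \<le> disc 0 ?t \<omega> * ?d (X ?t \<omega>)"
          proof (rule mult_mono)
            have "R * ?t \<le> R * 1" using R_nonneg t by (intro mult_left_mono) auto
            then have "exp (- R) \<le> exp (- (R * ?t))" by simp
            then show "exp (- R) \<le> disc 0 ?t \<omega>" using disc_ge[OF \<omega> order_refl t(1)] by (rule order_trans)
            show "c \<le> ?d (X ?t \<omega>)" by (rule near(2)[OF stay[OF True t(1,2)]])
          qed (use c disc_pos[of 0 ?t \<omega>] in auto)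
          then have "q \<le> disc 0 ?t \<omega> * ?d (X ?t \<omega>)" by (simp only: q_def)
          moreover have "q * h \<le> q" using q h by simp
          moreover have "0 \<le> q * ?t" using q t(1) by simp
          ultimately have "q * h \<le> cost ?l 0 ?t \<omega> + disc 0 ?t \<omega> * ?d (X ?t \<omega>)"
            using cl by linarith
          then show ?thesis
            unfolding rhs using True lt by (simp only: if_True)
        next
          case False
          then show ?thesis unfolding rhs using cl True by (simp add: min_def split: if_splits)
        qed
      next
        case False
        have "\<bar>cost ?l 0 ?t \<omega>\<bar> \<le> K * ?t" by (rule cost_bound[OF \<omega> order_refl t(1) l K(2)])
        moreover have "K * ?t \<le> K * h" using K t by (intro mult_left_mono) auto
        moreover have "0 \<le> disc 0 ?t \<omega> * ?d (X ?t \<omega>)" using d0 disc_pos[of 0 ?t \<omega>] by simp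
        ultimately have "- (K * h) \<le> cost ?l 0 ?t \<omega>" "- (K * h) \<le> cost ?l 0 ?t \<omega> + disc 0 ?t \<omega> * ?d (X ?t \<omega>)"
          by linarith+
        then show ?thesis
          unfolding rhs using False by (cases "\<rho> \<omega> < h") (simp_all only: if_True if_False add_0_right)
      qed
    qed
    have i5: "integrable (P x) (\<lambda>\<omega>. indicator ?A \<omega> * gain f \<psi> h \<omega> + indicator ?B \<omega> * gain f g (?\<sigma> \<omega>) \<omega>)"
      by (intro Bochner_Integration.integrable_add iA \<psi> int AM)
    have iG: "integrable (P x) (\<lambda>\<omega>. (q * h + K * h) * indicator G \<omega>)"
      using G(1) by (intro integrable_mult_right integrable_real_indicator) (auto simp: emeasure_eq_measure)
    have "(\<integral>\<omega>. (q * h + K * h) * indicator G \<omega> - K * h \<partial>P x) \<le>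
        (\<integral>\<omega>. indicator (space M) \<omega> * gain k \<psi> (?\<sigma> \<omega>) \<omega>
        - (indicator ?A \<omega> * gain f \<psi> h \<omega> + indicator ?B \<omega> * gain f g (?\<sigma> \<omega>) \<omega>) \<partial>P x)"
    proof (rule integral_mono)
      fix \<omega> assume "\<omega> \<in> space (P x)"
      moreover have "(q * h + K * h) * indicator G \<omega> - K * h = (if \<omega> \<in> G then q * h else - (K * h))"
        by simp
      ultimately show "(q * h + K * h) * indicator G \<omega> - K * h \<le> indicator (space M) \<omega> * gain k \<psi> (?\<sigma> \<omega>) \<omega>
        - (indicator ?A \<omega> * gain f \<psi> h \<omega> + indicator ?B \<omega> * gain f g (?\<sigma> \<omega>) \<omega>)"
        using pos[of \<omega>] by (simp only: space_P)
    qed (intro Bochner_Integration.integrable_diff iG i5 int sets.top integrable_const)+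
    also have "\<dots> = (\<integral>\<omega>. indicator (space M) \<omega> * gain k \<psi> (?\<sigma> \<omega>) \<omega> \<partial>P x)
        - ((\<integral>\<omega>. indicator ?A \<omega> * gain f \<psi> h \<omega> \<partial>P x) + (\<integral>\<omega>. indicator ?B \<omega> * gain f g (?\<sigma> \<omega>) \<omega> \<partial>P x))"
      unfolding Bochner_Integration.integral_diff[OF int(5)[OF sets.top] i5]
        Bochner_Integration.integral_add[OF iA[OF \<psi>] int(4)[OF AM(2)]] by (rule refl)
    finally have "(\<integral>\<omega>. (q * h + K * h) * indicator G \<omega> - K * h \<partial>P x) \<le> \<psi> x - (\<integral>\<omega>. gain f g (\<rho> \<omega>) \<omega> \<partial>P x)"
      using 3 4 by linarith
    moreover have "(\<integral>\<omega>. (q * h + K * h) * indicator G \<omega> - K * h \<partial>P x) = (q * h + K * h) * measure (P x) G - K * h"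
      using G(1) by (subst Bochner_Integration.integral_diff[OF iG]) (use prob_space in \<open>auto simp: sets.Int_space_eq2\<close>)
    moreover have "h * q / 2 \<le> (q * h + K * h) * measure (P x) G - K * h"
    proof -
      have "q + K \<noteq> 0" using q K(1) by linarith
      then have "2 * ((q + K) * \<epsilon>) = q"
        unfolding \<epsilon>_def by (rule mult_half_cancel)
      then have "(q + K) * \<epsilon> = q / 2" by linarith
      then have "q / 2 = (q + K) * (1 - \<epsilon>) - K" by (simp add: algebra_simps)
      also have "\<dots> \<le> (q + K) * measure (P x) G - K"
        using q K by (intro diff_right_mono mult_left_mono G(2)) auto
      finally have "h * (q / 2) \<le> h * ((q + K) * measure (P x) G - K)" using h0 by (rule mult_left_mono)
      then show ?thesis by (simp add: algebra_simps)
    qed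
    ultimately show "(\<integral>\<omega>. gain f g (\<rho> \<omega>) \<omega> \<partial>P x) \<le> \<psi> x - h * q / 2" by linarith
  qed
qed

text \<open>If the inequality failed, both margins would be positive at \<open>x\<close> and every
  bounded stopping time would earn at most \<open>w x - \<gamma>\<close>, although such times come
  arbitrarily close to \<open>w x\<close>.\<close>

lemma subsolution:
  assumes w_cont: "continuous_on UNIV w"
  shows "visc_sub (gen_dom P X) (gen P X) r f g w"
  unfolding visc_sub_def
proof (intro conjI allI ballI impI w_cont)
  fix x \<psi> assume \<psi>: "\<psi> \<in> gen_dom P X" and ge: "(\<forall>y. w y \<le> \<psi> y) \<and> \<psi> x = w x"
  obtain h C where h: "cbf \<psi>" "cbf h" and C: "0 \<le> C"
    "\<And>a y. 0 < a \<Longrightarrow> a \<le> 1 \<Longrightarrow> \<bar>(semigrp P X a \<psi> y - \<psi> y) / a\<bar> \<le> C"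
    and lim: "\<And>y. ((\<lambda>a. (semigrp P X a \<psi> y - \<psi> y) / a) \<longlongrightarrow> h y) (at_right 0)"
    and gen: "\<And>y. gen P X \<psi> y = h y"
    by (rule gen_domE[OF \<psi>], rule that) simp_all
  \<comment> \<open>The reward for which the right derivative of \<open>Gop ?k \<psi>\<close> at
    time 0 vanishes; at \<open>x\<close> its excess over \<open>f\<close> is the differential
    expression in the equation.\<close>
  let ?k = "\<lambda>y. r y * \<psi> y - h y"
  have "cbf r" unfolding cbf_def using r_cont r_nonneg r_le by (auto intro!: boundedI[of _ R])
  then have k: "cbf ?k" by (intro cbf_diff cbf_mult h)
  have w: "cbf w" using ge by (intro cbf_sandwich[OF g h(1) w_cont] value_ge) auto
  show "min (- gen P X \<psi> x + r x * \<psi> x - f x) (w x - g x) \<le> 0"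
  proof (rule ccontr)
    assume "\<not> ?thesis"
    then have "0 < ?k x - f x" "0 < \<psi> x - g x" using ge by (auto simp: gen)
    moreover have "Gop ?k \<psi> a y \<le> \<psi> y" if "0 < a" for a y
      by (rule dynkin[OF h k C lim _ less_imp_le[OF that]]) simp_all
    ultimately obtain \<gamma> where \<gamma>: "0 < \<gamma>"
      "\<And>N \<rho>. bounded_stop N \<rho> \<Longrightarrow> (\<integral>\<omega>. gain f g (\<rho> \<omega>) \<omega> \<partial>P x) \<le> \<psi> x - \<gamma>"
      using strict_subsolution_gap[OF w h(1) k, of x] ge by blast
    obtain N \<rho> where "bounded_stop N \<rho>" "w x - \<gamma> < (\<integral>\<omega>. gain f g (\<rho> \<omega>) \<omega> \<partial>P x)"
      using value_lower[of "w x - \<gamma>" x] \<gamma>(1) by auto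
    then show False using \<gamma>(2)[of N \<rho>] ge by simp
  qed
qed

end

theorem theorem4p2:
  fixes M :: "'w measure" and F :: "real \<Rightarrow> 'w set set"
    and P :: "'e::{metric_space, second_countable_topology} \<Rightarrow> 'w measure"
    and X :: "real \<Rightarrow> 'w \<Rightarrow> 'e"
    and r f g w :: "'e \<Rightarrow> real"
  assumes proper: "\<forall>(x::'e) (e::real). compact (cball x e)"
    and loc_compact: "locally compact (UNIV :: 'e set)"
    and markov: "standard_markov M F P X"
    and feller: "weak_feller P X"
    and erg: "ergodic M P X"
    and f_cont: "continuous_on UNIV f" and f_bdd: "bounded (range f)"
    and g_cont: "continuous_on UNIV g" and g_bdd: "bounded (range g)"
    and r_cont: "continuous_on UNIV r" and r_bdd: "bounded (range r)"
    and r_nonneg: "\<forall>x. r x \<ge> 0"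
    and E1: "\<forall>x. \<exists>d<0.
        (SUP \<tau>\<in>{\<tau>. stopping_timeF M F \<tau>}.
           Limsup at_top (\<lambda>T::real. ereal (\<integral>\<omega>.
              set_lebesgue_integral lborel {0..stopT \<tau> T \<omega>}
                 (\<lambda>s. exp (- alpha r X s \<omega>) * (f (X s \<omega>) - d)) \<partial>(P x)))) < \<infinity>"
    and D3': "\<exists>\<delta>>0. \<forall>x. \<forall>t\<ge>0. AE \<omega> in P x. alpha r X t \<omega> \<le> - ln \<delta>"
    and w_def: "\<forall>x. value_fn M F P X r f g x = ereal (w x)"
    and w_cont: "continuous_on UNIV w"
  shows "visc_solution (gen_dom P X) (gen P X) r f g w"
proof -
  obtain R where R: "\<And>y. norm (r y) \<le> R"
    using r_bdd unfolding bounded_iff by auto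
  interpret stopping_problem M F P X r R f g w
  proof
    show "r y \<le> R" for y using R[of y] by simp
  qed (use markov r_cont r_nonneg f_cont f_bdd g_cont g_bdd w_def in \<open>auto simp: cbf_def\<close>)
  show ?thesis
    unfolding visc_solution_def using subsolution[OF w_cont] supersolution[OF w_cont] by blast
qed

end
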